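(* Let $\pi:(M,\varphi,\xi,\eta,g)\to(M',J,g')$ be a contact-complex Riemannian submersion with $\dim M=2m+1\ge5$ and $\dim M'=2n\geq 2$, and assume that $M$ is almost cosymplectic. Then: (1) The horizontal distribution is integrable and totally geodesic. (2) Any fibre of $\pi$ is a minimal submanifold of $M$ and inherits from $M$ an almost cosymplectic structure. (3) For every $X\in\chi^h(M)$ and $U\in\chi^v(M)$, \[(\nabla_X\varphi)U=0,\qquad(\nabla_U\varphi)X=\tfrac12N_\varphi(X,\varphi U).\] (4) $(M',J,g')$ is an almost Kähler manifold.
   Context: All objects are smooth. An almost contact metric (ACM) manifold $(M,\varphi,\xi,\eta,g)$ is a $(2m+1)$-dimensional Riemannian manifold with a $(1,1)$-tensor field $\varphi$, a vector field $\xi$ and a 1-form $\eta$ such that $\varphi^2=-I+\eta\otimes\xi$, $\eta(\xi)=1$, $g(\varphi X,\varphi Y)=g(X,Y)-\eta(X)\eta(Y)$. Its fundamental form is $\phi(X,Y)=g(X,\varphi Y)$. The Nijenhuis tensor of $\varphi$ is $N_\varphi(X,Y)=\varphi^2[X,Y]+[\varphi X,\varphi Y]-\varphi[X,\varphi Y]-\varphi[\varphi X,Y]$. $\nabla$ is the Levi-Civita connection. $M$ is almost cosymplectic if $d\phi=0$ and $d\eta=0$. An almost Hermitian manifold $(M',J,g')$ ($J^2=-I$, $g'(J\cdot,J\cdot)=g'$) with fundamental form $\Omega(X,Y)=g'(X,JY)$ is almost Kähler if $d\Omega=0$. A contact-complex Riemannian submersion $\pi:(M,\varphi,\xi,\eta,g)\to(M',J,g')$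 is a Riemannian submersion from an ACM manifold onto an almost Hermitian manifold with $J\circ\pi_*=\pi_*\circ\varphi$. Let $\mathcal V=\ker\pi_*$, $\mathcal H=\mathcal V^\perp$ be the vertical and horizontal distributions and $\chi^v(M),\chi^h(M)$ the vertical and horizontal vector fields. $\xi$ is vertical and $\varphi$ preserves $\mathcal V$ and $\mathcal H$. Write $m=n+r$; if $r=0$ the fibres are 1-dimensional and tangent to $\xi$; if $r\ge1$, every fibre $F$ is an ACM manifold with the induced structure $\hat\varphi=\varphi|_{TF}$, $\hat\xi=\xi|_F$, $\hat\eta=\eta|_{TF}$, $\hat g=g|_{TF\times TF}$, and "inherits a structure" refers to this. $\mathcal H$ is totally geodesic if $\nabla_XY\in\chi^h(M)$ for all $X,Y\in\chi^h(M)$. *)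

theory Defs
  imports "HOL-Analysis.Analysis" "HOL-Library.Function_Algebras"
begin

section \<open>Real-valued functions as a vector space\<close>

text \<open>Addition on functions is the pointwise one of \<^theory>\<open>HOL-Library.Function_Algebras\<close>.\<close>

instantiation "fun" :: (type, real_vector) real_vector
begin

definition scaleR_fun :: "real \<Rightarrow> ('a \<Rightarrow> 'b) \<Rightarrow> 'a \<Rightarrow> 'b"
  where "scaleR_fun a f = (\<lambda>x. a *\<^sub>R f x)"

instance
  by standard (auto simp: scaleR_fun_def fun_eq_iff scaleR_add_left scaleR_add_right)

end

section \<open>Smooth manifolds\<close>

text \<open>Both notions are used for open sets \<open>S\<close> only.\<close>

primrec Ck_on :: "nat \<Rightarrow> 'e::euclidean_space set \<Rightarrow> ('e \<Rightarrow> 'f::real_normed_vector) \<Rightarrow> bool"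
  where
    "Ck_on 0 S f \<longleftrightarrow> continuous_on S f"
  | "Ck_on (Suc k) S f \<longleftrightarrow> (\<forall>x\<in>S. f differentiable (at x)) \<and>
       (\<forall>v. Ck_on k S (\<lambda>x. frechet_derivative f (at x) v))"

definition smooth_on :: "'e::euclidean_space set \<Rightarrow> ('e \<Rightarrow> 'f::real_normed_vector) \<Rightarrow> bool"
  where "smooth_on S f \<longleftrightarrow> (\<forall>k. Ck_on k S f)"

text \<open>The underlying set of a manifold is the \<^const>\<open>topspace\<close> of its topology; the dimension is
  \<open>DIM('e)\<close>. A chart \<open>(U, c)\<close> carries its domain; values of \<open>c\<close> outside \<open>U\<close> are irrelevant.\<close>

record ('a, 'e) mfd =
  mtop :: "'a topology"
  atlas :: "('a set \<times> ('a \<Rightarrow> 'e)) set"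

definition carrier_of :: "('a, 'e) mfd \<Rightarrow> 'a set"
  where "carrier_of M = topspace (mtop M)"

definition smooth_manifold :: "('a, 'e::euclidean_space) mfd \<Rightarrow> bool"
  where "smooth_manifold M \<longleftrightarrow>
    Hausdorff_space (mtop M) \<and> second_countable (mtop M) \<and>
    carrier_of M = (\<Union>(U, c)\<in>atlas M. U) \<and>
    (\<forall>(U, c)\<in>atlas M. openin (mtop M) U \<and> open (c ` U) \<and>
       homeomorphic_map (subtopology (mtop M) U) (top_of_set (c ` U)) c) \<and>
    (\<forall>(U, c)\<in>atlas M. \<forall>(V, d)\<in>atlas M. smooth_on (c ` (U \<inter> V)) (d \<circ> inv_into U c))"

definition smooth_map ::
    "('a, 'e::euclidean_space) mfd \<Rightarrow> ('b, 'd::euclidean_space) mfd \<Rightarrow> ('a \<Rightarrow> 'b) \<Rightarrow> bool"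
  where "smooth_map M N h \<longleftrightarrow> continuous_map (mtop M) (mtop N) h \<and>
    (\<forall>(U, c)\<in>atlas M. \<forall>(V, d)\<in>atlas N. smooth_on (c ` (U \<inter> h -` V)) (d \<circ> h \<circ> inv_into U c))"

text \<open>The smooth functions on an open subset \<open>W\<close> of \<open>M\<close>, as total functions whose values outside
  \<open>W\<close> are irrelevant.\<close>

definition smooth_funs :: "('a, 'e::euclidean_space) mfd \<Rightarrow> 'a set \<Rightarrow> ('a \<Rightarrow> real) set"
  where "smooth_funs M W = {f. \<forall>(U, c)\<in>atlas M. smooth_on (c ` (U \<inter> W)) (f \<circ> inv_into U c)}"

definition smooth_near :: "('a, 'e::euclidean_space) mfd \<Rightarrow> 'a \<Rightarrow> ('a \<Rightarrow> real) \<Rightarrow> bool"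
  where "smooth_near M p f \<longleftrightarrow> (\<exists>W. openin (mtop M) W \<and> p \<in> W \<and> f \<in> smooth_funs M W)"

section \<open>Tangent vectors, vector fields and tensor fields\<close>

text \<open>Tangent vectors at \<open>p\<close> are the derivations at \<open>p\<close> of the functions that are smooth near \<open>p\<close>.
  They are made total by the value \<open>0\<close> on all other functions. The Leibniz rule forces a
  derivation to depend only on the germ at \<open>p\<close>.\<close>

type_synonym 'a tvec = "('a \<Rightarrow> real) \<Rightarrow> real"
type_synonym 'a vfield = "'a \<Rightarrow> 'a tvec"

definition tangent_space :: "('a, 'e::euclidean_space) mfd \<Rightarrow> 'a \<Rightarrow> 'a tvec set"
  where "tangent_space M p = {D.
    (\<forall>f h a. smooth_near M p f \<longrightarrow> smooth_near M p h \<longrightarrow>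
       D (\<lambda>x. a * f x + h x) = a * D f + D h) \<and>
    (\<forall>f h. smooth_near M p f \<longrightarrow> smooth_near M p h \<longrightarrow>
       D (\<lambda>x. f x * h x) = f p * D h + h p * D f) \<and>
    (\<forall>f. \<not> smooth_near M p f \<longrightarrow> D f = 0)}"

text \<open>Vector fields, and all tensor fields below, are total functions of the point; only their
  values on the carrier matter.\<close>

definition vector_fields :: "('a, 'e::euclidean_space) mfd \<Rightarrow> 'a vfield set"
  where "vector_fields M = {X. (\<forall>p\<in>carrier_of M. X p \<in> tangent_space M p) \<and>
    (\<forall>W. openin (mtop M) W \<longrightarrow> (\<forall>f\<in>smooth_funs M W. (\<lambda>p. X p f) \<in> smooth_funs M W))}"

definition lie_bracket ::
    "('a, 'e::euclidean_space) mfd \<Rightarrow> 'a vfield \<Rightarrow> 'a vfield \<Rightarrow> 'a vfield"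
  where "lie_bracket M X Y = (\<lambda>p f.
    if smooth_near M p f then X p (\<lambda>q. Y q f) - Y p (\<lambda>q. X q f) else 0)"

definition pushforward ::
    "('a, 'e::euclidean_space) mfd \<Rightarrow> ('b, 'd::euclidean_space) mfd \<Rightarrow> ('a \<Rightarrow> 'b) \<Rightarrow>
     'a \<Rightarrow> 'a tvec \<Rightarrow> 'b tvec"
  where "pushforward M N h p u = (\<lambda>f. if smooth_near N (h p) f then u (f \<circ> h) else 0)"

definition linear_map_on :: "'v::real_vector set \<Rightarrow> ('v \<Rightarrow> 'w::real_vector) \<Rightarrow> bool"
  where "linear_map_on S L \<longleftrightarrow> (\<forall>u\<in>S. \<forall>v\<in>S. \<forall>a. L (a *\<^sub>R u + v) = a *\<^sub>R L u + L v)"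

type_synonym 'a form1 = "'a \<Rightarrow> 'a tvec \<Rightarrow> real"
type_synonym 'a form2 = "'a \<Rightarrow> 'a tvec \<Rightarrow> 'a tvec \<Rightarrow> real"
type_synonym 'a endo = "'a \<Rightarrow> 'a tvec \<Rightarrow> 'a tvec"

definition one_form :: "('a, 'e::euclidean_space) mfd \<Rightarrow> 'a form1 \<Rightarrow> bool"
  where "one_form M \<eta> \<longleftrightarrow>
    (\<forall>p\<in>carrier_of M. linear_map_on (tangent_space M p) (\<eta> p)) \<and>
    (\<forall>X\<in>vector_fields M. (\<lambda>p. \<eta> p (X p)) \<in> smooth_funs M (carrier_of M))"

definition riemannian_metric :: "('a, 'e::euclidean_space) mfd \<Rightarrow> 'a form2 \<Rightarrow> bool"
  where "riemannian_metric M g \<longleftrightarrow>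
    (\<forall>p\<in>carrier_of M.
       (\<forall>u\<in>tangent_space M p. linear_map_on (tangent_space M p) (g p u)) \<and>
       (\<forall>u\<in>tangent_space M p. \<forall>v\<in>tangent_space M p. g p u v = g p v u) \<and>
       (\<forall>u\<in>tangent_space M p. u \<noteq> 0 \<longrightarrow> g p u u > 0)) \<and>
    (\<forall>X\<in>vector_fields M. \<forall>Y\<in>vector_fields M.
       (\<lambda>p. g p (X p) (Y p)) \<in> smooth_funs M (carrier_of M))"

definition app :: "'a endo \<Rightarrow> 'a vfield \<Rightarrow> 'a vfield"
  where "app \<phi> X = (\<lambda>p. \<phi> p (X p))"

definition endo_field :: "('a, 'e::euclidean_space) mfd \<Rightarrow> 'a endo \<Rightarrow> bool"
  where "endo_field M \<phi> \<longleftrightarrow>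
    (\<forall>p\<in>carrier_of M. linear_map_on (tangent_space M p) (\<phi> p) \<and>
       \<phi> p ` tangent_space M p \<subseteq> tangent_space M p) \<and>
    (\<forall>X\<in>vector_fields M. app \<phi> X \<in> vector_fields M)"

text \<open>Exterior derivatives by the invariant formula, without normalising factor.\<close>

definition ext_deriv1 ::
    "('a, 'e::euclidean_space) mfd \<Rightarrow> 'a form1 \<Rightarrow> 'a vfield \<Rightarrow> 'a vfield \<Rightarrow> 'a \<Rightarrow> real"
  where "ext_deriv1 M \<eta> X Y p =
    X p (\<lambda>q. \<eta> q (Y q)) - Y p (\<lambda>q. \<eta> q (X q)) - \<eta> p (lie_bracket M X Y p)"

definition ext_deriv2 ::
    "('a, 'e::euclidean_space) mfd \<Rightarrow> 'a form2 \<Rightarrow>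
     'a vfield \<Rightarrow> 'a vfield \<Rightarrow> 'a vfield \<Rightarrow> 'a \<Rightarrow> real"
  where "ext_deriv2 M \<omega> X Y Z p =
    X p (\<lambda>q. \<omega> q (Y q) (Z q)) - Y p (\<lambda>q. \<omega> q (X q) (Z q)) + Z p (\<lambda>q. \<omega> q (X q) (Y q))
    - \<omega> p (lie_bracket M X Y p) (Z p) + \<omega> p (lie_bracket M X Z p) (Y p)
    - \<omega> p (lie_bracket M Y Z p) (X p)"

definition closed_form1 :: "('a, 'e::euclidean_space) mfd \<Rightarrow> 'a form1 \<Rightarrow> bool"
  where "closed_form1 M \<eta> \<longleftrightarrow>
    (\<forall>X\<in>vector_fields M. \<forall>Y\<in>vector_fields M. \<forall>p\<in>carrier_of M. ext_deriv1 M \<eta> X Y p = 0)"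

definition closed_form2 :: "('a, 'e::euclidean_space) mfd \<Rightarrow> 'a form2 \<Rightarrow> bool"
  where "closed_form2 M \<omega> \<longleftrightarrow>
    (\<forall>X\<in>vector_fields M. \<forall>Y\<in>vector_fields M. \<forall>Z\<in>vector_fields M. \<forall>p\<in>carrier_of M.
       ext_deriv2 M \<omega> X Y Z p = 0)"

section \<open>The Levi-Civita connection\<close>

type_synonym 'a connection = "'a vfield \<Rightarrow> 'a vfield \<Rightarrow> 'a vfield"

definition affine_connection :: "('a, 'e::euclidean_space) mfd \<Rightarrow> 'a connection \<Rightarrow> bool"
  where "affine_connection M nabla \<longleftrightarrow>
    (\<forall>X\<in>vector_fields M. \<forall>Y\<in>vector_fields M. nabla X Y \<in> vector_fields M) \<and>
    (\<forall>X\<in>vector_fields M. \<forall>Y\<in>vector_fields M. \<forall>Z\<in>vector_fields M.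
       \<forall>f\<in>smooth_funs M (carrier_of M). \<forall>p\<in>carrier_of M.
         nabla (\<lambda>q. X q + Y q) Z p = nabla X Z p + nabla Y Z p \<and>
         nabla (\<lambda>q. f q *\<^sub>R X q) Z p = f p *\<^sub>R nabla X Z p \<and>
         nabla X (\<lambda>q. Y q + Z q) p = nabla X Y p + nabla X Z p \<and>
         nabla X (\<lambda>q. f q *\<^sub>R Y q) p = X p f *\<^sub>R Y p + f p *\<^sub>R nabla X Y p)"

definition levi_civita ::
    "('a, 'e::euclidean_space) mfd \<Rightarrow> 'a form2 \<Rightarrow> 'a connection \<Rightarrow> bool"
  where "levi_civita M g nabla \<longleftrightarrow> affine_connection M nabla \<and>
    (\<forall>X\<in>vector_fields M. \<forall>Y\<in>vector_fields M. \<forall>p\<in>carrier_of M.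
       nabla X Y p - nabla Y X p = lie_bracket M X Y p) \<and>
    (\<forall>X\<in>vector_fields M. \<forall>Y\<in>vector_fields M. \<forall>Z\<in>vector_fields M. \<forall>p\<in>carrier_of M.
       X p (\<lambda>q. g q (Y q) (Z q)) = g p (nabla X Y p) (Z p) + g p (Y p) (nabla X Z p))"

definition cov_deriv_endo ::
    "'a connection \<Rightarrow> 'a endo \<Rightarrow> 'a vfield \<Rightarrow> 'a vfield \<Rightarrow> 'a vfield"
  where "cov_deriv_endo nabla \<phi> X Y = (\<lambda>p. nabla X (app \<phi> Y) p - \<phi> p (nabla X Y p))"

section \<open>Submanifolds and distributions\<close>

text \<open>A submanifold is a manifold in its own right, on a subset with the subspace topology, such
  that the inclusion is a smooth immersion.\<close>

definition embedded_submanifold ::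
    "('a, 'e::euclidean_space) mfd \<Rightarrow> ('a, 'f::euclidean_space) mfd \<Rightarrow> bool"
  where "embedded_submanifold M N \<longleftrightarrow> smooth_manifold N \<and>
    carrier_of N \<subseteq> carrier_of M \<and> mtop N = subtopology (mtop M) (carrier_of N) \<and>
    smooth_map N M (\<lambda>x. x) \<and>
    (\<forall>p\<in>carrier_of N. inj_on (pushforward N M (\<lambda>x. x) p) (tangent_space N p))"

definition tangent_in ::
    "('a, 'e::euclidean_space) mfd \<Rightarrow> ('a, 'f::euclidean_space) mfd \<Rightarrow> 'a \<Rightarrow> 'a tvec set"
  where "tangent_in M N p = pushforward N M (\<lambda>x. x) p ` tangent_space N p"

definition orth_complement ::
    "('a, 'e::euclidean_space) mfd \<Rightarrow> 'a form2 \<Rightarrow> 'a \<Rightarrow> 'a tvec set \<Rightarrow> 'a tvec set"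
  where "orth_complement M g p S = {u \<in> tangent_space M p. \<forall>v\<in>S. g p u v = 0}"

definition normal_component ::
    "('a, 'e::euclidean_space) mfd \<Rightarrow> 'a form2 \<Rightarrow> ('a, 'f::euclidean_space) mfd \<Rightarrow>
     'a \<Rightarrow> 'a tvec \<Rightarrow> 'a tvec"
  where "normal_component M g N p u =
    (THE w. w \<in> orth_complement M g p (tangent_in M N p) \<and> u - w \<in> tangent_in M N p)"

text \<open>The second fundamental form is evaluated on vector fields of \<open>M\<close> that are tangent to \<open>N\<close>
  along \<open>N\<close> near the point. Such fields extending given tangent vectors of \<open>N\<close> always exist,
  whereas extensions tangent along all of \<open>N\<close> may not if \<open>N\<close> is not closed.\<close>

definition second_fundamental_form ::
    "('a, 'e::euclidean_space) mfd \<Rightarrow> 'a form2 \<Rightarrow> 'a connection \<Rightarrow>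
     ('a, 'f::euclidean_space) mfd \<Rightarrow> 'a vfield \<Rightarrow> 'a vfield \<Rightarrow> 'a vfield"
  where "second_fundamental_form M g nabla N X Y p = normal_component M g N p (nabla X Y p)"

definition tangent_near ::
    "('a, 'e::euclidean_space) mfd \<Rightarrow> ('a, 'f::euclidean_space) mfd \<Rightarrow> 'a \<Rightarrow> 'a vfield \<Rightarrow> bool"
  where "tangent_near M N p X \<longleftrightarrow>
    (\<exists>W. openin (mtop M) W \<and> p \<in> W \<and> (\<forall>q\<in>W \<inter> carrier_of N. X q \<in> tangent_in M N q))"

text \<open>Minimality is the vanishing of the trace of the second fundamental form, taken over fields
  \<open>E 0, E 1, \<dots>\<close> that are an orthonormal basis of the tangent space of \<open>N\<close> at the point.\<close>

definition minimal_submanifold ::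
    "('a, 'e::euclidean_space) mfd \<Rightarrow> 'a form2 \<Rightarrow> 'a connection \<Rightarrow>
     ('a, 'f::euclidean_space) mfd \<Rightarrow> bool"
  where "minimal_submanifold M g nabla N \<longleftrightarrow> embedded_submanifold M N \<and>
    (\<forall>p\<in>carrier_of N. \<forall>E :: nat \<Rightarrow> 'a vfield.
       (\<forall>i<DIM('f). E i \<in> vector_fields M \<and> tangent_near M N p (E i)) \<longrightarrow>
       (\<forall>i<DIM('f). \<forall>j<DIM('f). g p (E i p) (E j p) = (if i = j then 1 else 0)) \<longrightarrow>
       (\<Sum>i<DIM('f). second_fundamental_form M g nabla N (E i) (E i) p) = 0)"

definition sections :: "('a, 'e::euclidean_space) mfd \<Rightarrow> ('a \<Rightarrow> 'a tvec set) \<Rightarrow> 'a vfield set"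
  where "sections M H = {X \<in> vector_fields M. \<forall>p\<in>carrier_of M. X p \<in> H p}"

text \<open>Integrability: an integral manifold passes through every point. The type argument is the
  model space of the integral manifolds, so \<open>DIM('f)\<close> has to be the rank of \<open>H\<close>.\<close>

definition integrable_distribution ::
    "'f::euclidean_space itself \<Rightarrow> ('a, 'e::euclidean_space) mfd \<Rightarrow> ('a \<Rightarrow> 'a tvec set) \<Rightarrow> bool"
  where "integrable_distribution _ M H \<longleftrightarrow>
    (\<forall>p\<in>carrier_of M. \<exists>N :: ('a, 'f) mfd. embedded_submanifold M N \<and> p \<in> carrier_of N \<and>
       (\<forall>q\<in>carrier_of N. tangent_in M N q = H q))"

definition totally_geodesic_distribution ::
    "('a, 'e::euclidean_space) mfd \<Rightarrow> 'a connection \<Rightarrow> ('a \<Rightarrow> 'a tvec set) \<Rightarrow> bool"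
  where "totally_geodesic_distribution M nabla H \<longleftrightarrow>
    (\<forall>X\<in>sections M H. \<forall>Y\<in>sections M H. nabla X Y \<in> sections M H)"

section \<open>Almost contact metric and almost Hermitian structures\<close>

definition fundamental_form :: "'a form2 \<Rightarrow> 'a endo \<Rightarrow> 'a form2"
  where "fundamental_form g \<phi> = (\<lambda>p u v. g p u (\<phi> p v))"

text \<open>Dimension one is allowed; the structure then consists of \<open>\<phi> = 0\<close> and a unit field \<open>\<xi>\<close>.\<close>

definition almost_contact_metric ::
    "('a, 'e::euclidean_space) mfd \<Rightarrow> 'a endo \<Rightarrow> 'a vfield \<Rightarrow> 'a form1 \<Rightarrow> 'a form2 \<Rightarrow> bool"
  where "almost_contact_metric M \<phi> \<xi> \<eta> g \<longleftrightarrow>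
    smooth_manifold M \<and> odd DIM('e) \<and> riemannian_metric M g \<and>
    endo_field M \<phi> \<and> \<xi> \<in> vector_fields M \<and> one_form M \<eta> \<and>
    (\<forall>p\<in>carrier_of M. \<eta> p (\<xi> p) = 1 \<and>
       (\<forall>u\<in>tangent_space M p. \<phi> p (\<phi> p u) = - u + \<eta> p u *\<^sub>R \<xi> p) \<and>
       (\<forall>u\<in>tangent_space M p. \<forall>v\<in>tangent_space M p.
          g p (\<phi> p u) (\<phi> p v) = g p u v - \<eta> p u * \<eta> p v))"

definition almost_cosymplectic ::
    "('a, 'e::euclidean_space) mfd \<Rightarrow> 'a endo \<Rightarrow> 'a vfield \<Rightarrow> 'a form1 \<Rightarrow> 'a form2 \<Rightarrow> bool"
  where "almost_cosymplectic M \<phi> \<xi> \<eta> g \<longleftrightarrow> almost_contact_metric M \<phi> \<xi> \<eta> g \<and>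
    closed_form2 M (fundamental_form g \<phi>) \<and> closed_form1 M \<eta>"

definition almost_hermitian ::
    "('b, 'd::euclidean_space) mfd \<Rightarrow> 'b endo \<Rightarrow> 'b form2 \<Rightarrow> bool"
  where "almost_hermitian M' J g' \<longleftrightarrow>
    smooth_manifold M' \<and> riemannian_metric M' g' \<and> endo_field M' J \<and>
    (\<forall>p\<in>carrier_of M'.
       (\<forall>u\<in>tangent_space M' p. J p (J p u) = - u) \<and>
       (\<forall>u\<in>tangent_space M' p. \<forall>v\<in>tangent_space M' p. g' p (J p u) (J p v) = g' p u v))"

definition almost_kaehler ::
    "('b, 'd::euclidean_space) mfd \<Rightarrow> 'b endo \<Rightarrow> 'b form2 \<Rightarrow> bool"
  where "almost_kaehler M' J g' \<longleftrightarrow>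
    almost_hermitian M' J g' \<and> closed_form2 M' (fundamental_form g' J)"

definition nijenhuis ::
    "('a, 'e::euclidean_space) mfd \<Rightarrow> 'a endo \<Rightarrow> 'a vfield \<Rightarrow> 'a vfield \<Rightarrow> 'a vfield"
  where "nijenhuis M \<phi> X Y = (\<lambda>p.
    \<phi> p (\<phi> p (lie_bracket M X Y p)) + lie_bracket M (app \<phi> X) (app \<phi> Y) p
    - \<phi> p (lie_bracket M X (app \<phi> Y) p) - \<phi> p (lie_bracket M (app \<phi> X) Y p))"

text \<open>The structure induced on a submanifold \<open>N\<close>. A tangent vector of \<open>N\<close> is identified with its
  image under the differential of the inclusion, which is injective; \<open>\<phi>\<close> and \<open>\<xi>\<close> are pulled back
  by inverting that identification and are meaningful if they are tangent to \<open>N\<close>.\<close>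

definition pull_vec ::
    "('a, 'e::euclidean_space) mfd \<Rightarrow> ('a, 'f::euclidean_space) mfd \<Rightarrow> 'a \<Rightarrow> 'a tvec \<Rightarrow> 'a tvec"
  where "pull_vec M N p = inv_into (tangent_space N p) (pushforward N M (\<lambda>x. x) p)"

definition induced_endo ::
    "('a, 'e::euclidean_space) mfd \<Rightarrow> ('a, 'f::euclidean_space) mfd \<Rightarrow> 'a endo \<Rightarrow> 'a endo"
  where "induced_endo M N \<phi> = (\<lambda>p u. pull_vec M N p (\<phi> p (pushforward N M (\<lambda>x. x) p u)))"

definition induced_vfield ::
    "('a, 'e::euclidean_space) mfd \<Rightarrow> ('a, 'f::euclidean_space) mfd \<Rightarrow> 'a vfield \<Rightarrow> 'a vfield"
  where "induced_vfield M N \<xi> = (\<lambda>p. pull_vec M N p (\<xi> p))"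

definition induced_form1 ::
    "('a, 'e::euclidean_space) mfd \<Rightarrow> ('a, 'f::euclidean_space) mfd \<Rightarrow> 'a form1 \<Rightarrow> 'a form1"
  where "induced_form1 M N \<eta> = (\<lambda>p u. \<eta> p (pushforward N M (\<lambda>x. x) p u))"

definition induced_form2 ::
    "('a, 'e::euclidean_space) mfd \<Rightarrow> ('a, 'f::euclidean_space) mfd \<Rightarrow> 'a form2 \<Rightarrow> 'a form2"
  where "induced_form2 M N g =
    (\<lambda>p u v. g p (pushforward N M (\<lambda>x. x) p u) (pushforward N M (\<lambda>x. x) p v))"

section \<open>Contact-complex Riemannian submersions\<close>

definition vertical_space ::
    "('a, 'e::euclidean_space) mfd \<Rightarrow> ('b, 'd::euclidean_space) mfd \<Rightarrow> ('a \<Rightarrow> 'b) \<Rightarrow>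
     'a \<Rightarrow> 'a tvec set"
  where "vertical_space M M' \<pi> p = {u \<in> tangent_space M p. pushforward M M' \<pi> p u = 0}"

definition horizontal_space ::
    "('a, 'e::euclidean_space) mfd \<Rightarrow> 'a form2 \<Rightarrow> ('b, 'd::euclidean_space) mfd \<Rightarrow> ('a \<Rightarrow> 'b) \<Rightarrow>
     'a \<Rightarrow> 'a tvec set"
  where "horizontal_space M g M' \<pi> p = orth_complement M g p (vertical_space M M' \<pi> p)"

definition fibre ::
    "('a, 'e::euclidean_space) mfd \<Rightarrow> ('a \<Rightarrow> 'b) \<Rightarrow> 'b \<Rightarrow> 'a set"
  where "fibre M \<pi> b = {p \<in> carrier_of M. \<pi> p = b}"

definition riemannian_submersion ::
    "('a, 'e::euclidean_space) mfd \<Rightarrow> 'a form2 \<Rightarrow> ('b, 'd::euclidean_space) mfd \<Rightarrow> 'b form2 \<Rightarrow>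
     ('a \<Rightarrow> 'b) \<Rightarrow> bool"
  where "riemannian_submersion M g M' g' \<pi> \<longleftrightarrow>
    smooth_map M M' \<pi> \<and> \<pi> ` carrier_of M = carrier_of M' \<and>
    (\<forall>p\<in>carrier_of M.
       pushforward M M' \<pi> p ` tangent_space M p = tangent_space M' (\<pi> p) \<and>
       (\<forall>u\<in>horizontal_space M g M' \<pi> p. \<forall>v\<in>horizontal_space M g M' \<pi> p.
          g' (\<pi> p) (pushforward M M' \<pi> p u) (pushforward M M' \<pi> p v) = g p u v))"

definition contact_complex_submersion ::
    "('a, 'e::euclidean_space) mfd \<Rightarrow> 'a endo \<Rightarrow> 'a vfield \<Rightarrow> 'a form1 \<Rightarrow> 'a form2 \<Rightarrow>
     ('b, 'd::euclidean_space) mfd \<Rightarrow> 'b endo \<Rightarrow> 'b form2 \<Rightarrow> ('a \<Rightarrow> 'b) \<Rightarrow> bool"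
  where "contact_complex_submersion M \<phi> \<xi> \<eta> g M' J g' \<pi> \<longleftrightarrow>
    almost_contact_metric M \<phi> \<xi> \<eta> g \<and> almost_hermitian M' J g' \<and>
    riemannian_submersion M g M' g' \<pi> \<and>
    (\<forall>p\<in>carrier_of M. \<forall>u\<in>tangent_space M p.
       J (\<pi> p) (pushforward M M' \<pi> p u) = pushforward M M' \<pi> p (\<phi> p u))"

end

theory Submission
  imports Defs
begin

text \<open>
  \<^emph>\<open>The geometry.\<close> Put \<open>F(X; Y, Z) = g((\<nabla>\<^sub>X \<phi>)Y, Z)\<close>. It is skew in \<open>Y, Z\<close>, and \<open>d\<phi> = 0\<close> says
  that its cyclic sum vanishes (\<open>F_cyclic\<close>). Differentiating \<open>\<phi>\<^sup>2 = -I + \<eta> \<otimes> \<xi>\<close> gives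
  \<open>F(X; \<phi>Y, Z) - F(X; Y, \<phi>Z)\<close> in terms of \<open>\<nabla>\<xi>\<close> (\<open>F_\<phi>\<close>), and \<open>d\<eta> = 0\<close> says that \<open>g(\<nabla>\<^sub>X \<xi>, Y)\<close> is
  symmetric (\<open>nabla_\<xi>_symmetric\<close>). These three identities are evaluated on horizontal \<open>X, Y\<close> and
  vertical \<open>U, W\<close>.

  For \<open>\<alpha>(X, Y, U) = g(\<nabla>\<^sub>X Y, U)\<close> the submersion property makes \<open>\<alpha>\<close> skew in \<open>X, Y\<close>, and the cyclic sum
  for \<open>X, Y, U\<close> reduces to \<open>2 \<alpha>(X, Y, \<phi>U) = 0\<close>. Since \<open>\<alpha>(X, Y, \<xi>)\<close> is also symmetric, \<open>\<alpha>\<close> vanishes: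
  the horizontal distribution is totally geodesic (\<open>horizontal_totally_geodesic\<close>). In particular
  the horizontal lifts of coordinate fields of the base commute, and Frobenius' theorem yields
  integral manifolds (\<open>horizontal_integrable\<close>).

  For the second fundamental form \<open>\<beta>(X, U, W) = g(\<nabla>\<^sub>U W, X)\<close> of the fibres, the cyclic sum for
  \<open>X, U, W\<close> expresses \<open>F(X; U, W)\<close> by \<open>\<beta>\<close>, and inserting this into the identity for \<open>\<phi>\<^sup>2\<close> gives
  \<open>\<beta>(X, \<phi>U, \<phi>W) = - \<beta>(X, U, W)\<close> and \<open>\<beta>(X, U, \<xi>) = 0\<close>. Because \<open>\<phi>\<close> is an isometry orthogonally to
  \<open>\<xi>\<close>, the trace of \<open>\<beta>\<close> is its own negative (\<open>fibre_minimal\<close>). The same symmetries of \<open>\<beta>\<close> show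
  \<open>F(X; U, \<cdot>) = 0\<close>, and they compare both components of \<open>(\<nabla>\<^sub>U \<phi>)X\<close> with those of \<open>N\<^sub>\<phi>(X, \<phi>U)\<close>,
  the latter being written in terms of \<open>\<nabla>\<phi>\<close>. Finally \<open>\<phi>\<close> and \<open>\<eta>\<close> pull back to closed forms on the
  fibres, and \<open>d\<phi>\<close> on horizontal lifts is the pullback of \<open>d\<Omega>\<close> (\<open>base_almost_kaehler\<close>).

  \<^emph>\<open>The foundations.\<close> Tangent vectors are derivations, so coordinates enter through Hadamard's lemma
  (\<open>tangent_coordinates\<close>). Bump functions give local frames of global fields (\<open>local_frame\<close>), from
  which follow the tensoriality of function-linear operators (\<open>tensorial_cong\<close>), the smoothness of
  fields that are metrically dual to smooth 1-forms (\<open>metric_dual_smooth\<close>; it provides horizontal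
  lifts, projections and the induced structure of the fibres) and the invariance of closedness under
  pullbacks. Frobenius' theorem is proved for total differential equations in Euclidean space
  (\<open>frobenius_total_differential\<close>) by solving a radial integral equation.
\<close>

section \<open>Calculus of smooth maps between Euclidean spaces\<close>

lemma Ck_on_subset: "Ck_on k S f \<Longrightarrow> T \<subseteq> S \<Longrightarrow> Ck_on k T f"
  by (induction k arbitrary: f) (auto intro: continuous_on_subset)

lemma frechet_derivative_has_derivative:
  "(f has_derivative D) (at x) \<Longrightarrow> frechet_derivative f (at x) = D"
  using frechet_derivative_at by fastforce

lemma Ck_on_cong_imp:
  assumes "open S" "\<And>x. x \<in> S \<Longrightarrow> f x = h x" "Ck_on k S f"
  shows "Ck_on k S h"
  using assms(2,3)
proof (induction k arbitrary: f h)
  case 0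
  then show ?case by (simp cong: continuous_on_cong)
next
  case (Suc k)
  have D: "(h has_derivative frechet_derivative f (at x)) (at x)" if "x \<in> S" for x
  proof (rule has_derivative_transform_within_open[OF _ assms(1) that])
    show "(f has_derivative frechet_derivative f (at x)) (at x)"
      using Suc.prems that by (simp add: frechet_derivative_works)
  qed (use Suc.prems in auto)
  have E: "frechet_derivative h (at x) = frechet_derivative f (at x)" if "x \<in> S" for x
    by (rule frechet_derivative_has_derivative[OF D[OF that]])
  have "Ck_on k S (\<lambda>x. frechet_derivative h (at x) v)" for v
    by (rule Suc.IH[of "\<lambda>x. frechet_derivative f (at x) v"]) (use E Suc.prems in auto)
  with D show ?case by (auto simp: differentiable_def)
qed

lemma Ck_on_cong:
  assumes "open S" "\<And>x. x \<in> S \<Longrightarrow> f x = h x"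
  shows "Ck_on k S f \<longleftrightarrow> Ck_on k S h"
  using Ck_on_cong_imp[OF assms(1), of f h k] Ck_on_cong_imp[OF assms(1), of h f k] assms(2) by auto

lemma Ck_on_SucI:
  assumes "open S" "\<And>x. x \<in> S \<Longrightarrow> (f has_derivative F x) (at x)"
    and "\<And>v. Ck_on k S (\<lambda>x. F x v)"
  shows "Ck_on (Suc k) S f"
proof -
  have "Ck_on k S (\<lambda>x. frechet_derivative f (at x) v)" for v
    by (rule Ck_on_cong_imp[OF assms(1) _ assms(3)[of v]])
       (simp add: frechet_derivative_has_derivative[OF assms(2)])
  then show ?thesis using assms(2) by (auto simp: differentiable_def)
qed

lemma Ck_on_SucD_deriv:
  "Ck_on (Suc k) S f \<Longrightarrow> x \<in> S \<Longrightarrow> (f has_derivative frechet_derivative f (at x)) (at x)"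
  by (simp add: frechet_derivative_works)

lemma Ck_on_SucD: "Ck_on (Suc k) S f \<Longrightarrow> Ck_on k S f"
proof (induction k arbitrary: f)
  case 0
  then show ?case
    by (auto intro!: continuous_at_imp_continuous_on differentiable_imp_continuous_within)
next
  case (Suc k)
  then show ?case by (metis Ck_on.simps(2))
qed

lemma Ck_on_imp_continuous_on: "Ck_on k S f \<Longrightarrow> continuous_on S f"
  by (induction k) (auto dest: Ck_on_SucD simp del: Ck_on.simps(2))

lemma Ck_on_const: "Ck_on k S (\<lambda>x. c)"
  by (induction k arbitrary: c) auto

lemma Ck_on_bounded_linear:
  assumes "bounded_linear f" "open S" shows "Ck_on k S f"
proof (cases k)
  case 0
  then show ?thesis by (simp add: assms linear_continuous_on)
next
  case (Suc j)
  show ?thesis unfolding Suc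
    by (rule Ck_on_SucI[where F="\<lambda>_. f"])
       (auto simp: assms Ck_on_const intro: bounded_linear.has_derivative[OF assms(1)] bounded_linear_imp_has_derivative)
qed

lemma Ck_on_add:
  assumes "open S" "Ck_on k S f" "Ck_on k S h"
  shows "Ck_on k S (\<lambda>x. f x + h x)"
  using assms(2,3)
proof (induction k arbitrary: f h)
  case 0 then show ?case by (auto intro: continuous_intros)
next
  case (Suc k)
  show ?case
    by (rule Ck_on_SucI[OF assms(1),
          where F="\<lambda>x v. frechet_derivative f (at x) v + frechet_derivative h (at x) v"])
       (use Suc in \<open>auto intro!: has_derivative_add Ck_on_SucD_deriv Suc.IH\<close>)
qed

lemma Ck_on_bilinear:
  assumes B: "bounded_bilinear B" and "open S" "Ck_on k S f" "Ck_on k S h"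
  shows "Ck_on k S (\<lambda>x. B (f x) (h x))"
  using assms(3,4)
proof (induction k arbitrary: f h)
  case 0 then show ?case by (auto intro: bounded_bilinear.continuous_on[OF B])
next
  case (Suc k)
  show ?case
  proof (rule Ck_on_SucI[OF assms(2), where F="\<lambda>x v. B (f x) (frechet_derivative h (at x) v) + B (frechet_derivative f (at x) v) (h x)"])
    fix x assume "x \<in> S"
    with Suc show "((\<lambda>x. B (f x) (h x)) has_derivative
      (\<lambda>v. B (f x) (frechet_derivative h (at x) v) + B (frechet_derivative f (at x) v) (h x))) (at x)"
      by (intro bounded_bilinear.FDERIV[OF B] Ck_on_SucD_deriv)
  next
    fix v
    show "Ck_on k S (\<lambda>x. B (f x) (frechet_derivative h (at x) v) + B (frechet_derivative f (at x) v) (h x))"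
      using Suc.prems by (intro Ck_on_add[OF assms(2)] Suc.IH) (auto dest: Ck_on_SucD simp del: Ck_on.simps(2), auto)
  qed
qed

lemma Ck_on_sum:
  assumes "open S" "\<And>i. i \<in> I \<Longrightarrow> Ck_on k S (f i)"
  shows "Ck_on k S (\<lambda>x. \<Sum>i\<in>I. f i x)"
  using assms(2) by (induction I rule: infinite_finite_induct) (auto intro: Ck_on_const Ck_on_add[OF assms(1)])

lemma linear_sum_Basis:
  assumes "linear (L :: 'e::euclidean_space \<Rightarrow> 'f::real_vector)"
  shows "L v = (\<Sum>b\<in>Basis. (v \<bullet> b) *\<^sub>R L b)"
proof -
  have "L v = L (\<Sum>b\<in>Basis. (v \<bullet> b) *\<^sub>R b)" by (simp add: euclidean_representation)
  also have "\<dots> = (\<Sum>b\<in>Basis. (v \<bullet> b) *\<^sub>R L b)"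
    by (simp add: linear_sum[OF assms] linear_cmul[OF assms])
  finally show ?thesis .
qed

text \<open>The chain rule is expanded in a basis: the derivative of \<open>f \<circ> h\<close> then is a sum of products of
  derivatives of \<open>h\<close> with functions \<open>Df(\<cdot>)b \<circ> h\<close>, to which the induction hypothesis applies.\<close>

lemma Ck_on_compose:
  fixes f :: "'e::euclidean_space \<Rightarrow> 'f::real_normed_vector"
    and h :: "'c::euclidean_space \<Rightarrow> 'e"
  assumes S: "open S" and T: "open T" and hS: "h ` S \<subseteq> T" and "Ck_on k S h" "Ck_on k T f"
  shows "Ck_on k S (\<lambda>x. f (h x))"
  using assms(4,5)
proof (induction k arbitrary: f)
  case 0
  then show ?case using hS by (auto intro: continuous_on_compose2)
next
  case (Suc k)
  have Df: "(f has_derivative frechet_derivative f (at y)) (at y)" if "y \<in> T" for y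
    using Suc.prems(2) that by (rule Ck_on_SucD_deriv)
  have Dh: "(h has_derivative frechet_derivative h (at x)) (at x)" if "x \<in> S" for x
    using Suc.prems(1) that by (rule Ck_on_SucD_deriv)
  show ?case
  proof (rule Ck_on_SucI[OF S, where F="\<lambda>x v. \<Sum>b\<in>Basis. (frechet_derivative h (at x) v \<bullet> b) *\<^sub>R frechet_derivative f (at (h x)) b"])
    fix x assume x: "x \<in> S"
    then have hx: "h x \<in> T" using hS by auto
    have "linear (frechet_derivative f (at (h x)))" using Df[OF hx] has_derivative_linear by blast
    note lin = this
    have eq: "(\<Sum>b\<in>Basis. (frechet_derivative h (at x) v \<bullet> b) *\<^sub>R frechet_derivative f (at (h x)) b)
       = frechet_derivative f (at (h x)) (frechet_derivative h (at x) v)" for v by (rule linear_sum_Basis[OF lin, symmetric])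
    show "((\<lambda>x. f (h x)) has_derivative (\<lambda>v. \<Sum>b\<in>Basis. (frechet_derivative h (at x) v \<bullet> b) *\<^sub>R frechet_derivative f (at (h x)) b)) (at x)"
      unfolding eq by (rule has_derivative_compose[OF Dh[OF x] Df[OF hx]])
  next
    fix v
    have "Ck_on k S (\<lambda>x. frechet_derivative h (at x) v \<bullet> b)" for b
      using Suc.prems(1) by (intro Ck_on_bilinear[OF bounded_bilinear_inner S] Ck_on_const) auto
    moreover have "Ck_on k S (\<lambda>x. frechet_derivative f (at (h x)) b)" for b
      using Suc.prems by (intro Suc.IH Ck_on_SucD[OF Suc.prems(1)]) auto
    ultimately show "Ck_on k S (\<lambda>x. \<Sum>b\<in>Basis. (frechet_derivative h (at x) v \<bullet> b) *\<^sub>R frechet_derivative f (at (h x)) b)"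
      by (intro Ck_on_sum[OF S] Ck_on_bilinear[OF bounded_bilinear_scaleR S])
  qed
qed

lemma Ck_on_local:
  assumes "\<And>x. x \<in> S \<Longrightarrow> \<exists>T. open T \<and> x \<in> T \<and> Ck_on k T f"
  shows "Ck_on k S f"
  using assms
proof (induction k arbitrary: f)
  case 0
  show ?case unfolding Ck_on.simps
    by (rule continuous_at_imp_continuous_on) (use 0 continuous_on_eq_continuous_at in fastforce)
next
  case (Suc k)
  show ?case unfolding Ck_on.simps
  proof (intro conjI ballI allI)
    fix x assume "x \<in> S"
    then show "f differentiable (at x)" using Suc.prems by fastforce
  next
    fix v
    show "Ck_on k S (\<lambda>x. frechet_derivative f (at x) v)"
      by (rule Suc.IH) (use Suc.prems in fastforce)
  qed
qed

lemma Ck_on_inverse: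
  fixes f :: "'e::euclidean_space \<Rightarrow> real"
  assumes "open S" "\<And>x. x \<in> S \<Longrightarrow> f x \<noteq> 0" "Ck_on k S f"
  shows "Ck_on k S (\<lambda>x. inverse (f x))"
  using assms(3)
proof (induction k)
  case 0
  then show ?case using assms(2) by (auto intro!: continuous_intros)
next
  case (Suc k)
  note mult = Ck_on_bilinear[OF bounded_bilinear_mult assms(1)]
  show ?case
  proof (rule Ck_on_SucI[OF assms(1), where F="\<lambda>x v. (-1) * (inverse (f x) * (frechet_derivative f (at x) v * inverse (f x)))"])
    fix x assume x: "x \<in> S"
    have "((\<lambda>x. inverse (f x)) has_derivative (\<lambda>v. - (inverse (f x) * frechet_derivative f (at x) v * inverse (f x)))) (at x)"
      by (rule Deriv.has_derivative_inverse[OF assms(2)[OF x] Ck_on_SucD_deriv[OF Suc.prems x]])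
    then show "((\<lambda>x. inverse (f x)) has_derivative (\<lambda>v. (-1) * (inverse (f x) * (frechet_derivative f (at x) v * inverse (f x))))) (at x)"
      by (simp add: mult.assoc)
  next
    fix v
    have "Ck_on k S (\<lambda>x. inverse (f x))" by (rule Suc.IH[OF Ck_on_SucD[OF Suc.prems]])
    then show "Ck_on k S (\<lambda>x. (-1) * (inverse (f x) * (frechet_derivative f (at x) v * inverse (f x))))"
      using Suc.prems by (intro mult Ck_on_const) auto
  qed
qed

lemma smooth_on_subset: "smooth_on S f \<Longrightarrow> T \<subseteq> S \<Longrightarrow> smooth_on T f"
  by (auto simp: smooth_on_def intro: Ck_on_subset)

lemma smooth_on_cong:
  "open S \<Longrightarrow> (\<And>x. x \<in> S \<Longrightarrow> f x = h x) \<Longrightarrow> smooth_on S f \<longleftrightarrow> smooth_on S h"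
  unfolding smooth_on_def using Ck_on_cong by blast

lemma smooth_on_local:
  "(\<And>x. x \<in> S \<Longrightarrow> \<exists>T. open T \<and> x \<in> T \<and> smooth_on T f) \<Longrightarrow> smooth_on S f"
  unfolding smooth_on_def by (intro allI Ck_on_local) blast

lemma smooth_on_const [simp]: "smooth_on S (\<lambda>x. c)"
  by (simp add: smooth_on_def Ck_on_const)

lemma smooth_on_bounded_linear: "bounded_linear f \<Longrightarrow> open S \<Longrightarrow> smooth_on S f"
  by (simp add: smooth_on_def Ck_on_bounded_linear)

lemma smooth_on_add:
  "open S \<Longrightarrow> smooth_on S f \<Longrightarrow> smooth_on S h \<Longrightarrow> smooth_on S (\<lambda>x. f x + h x)"
  by (simp add: smooth_on_def Ck_on_add)

lemma smooth_on_bilinear: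
  "bounded_bilinear B \<Longrightarrow> open S \<Longrightarrow> smooth_on S f \<Longrightarrow> smooth_on S h \<Longrightarrow> smooth_on S (\<lambda>x. B (f x) (h x))"
  by (simp add: smooth_on_def Ck_on_bilinear)

lemmas smooth_on_mult = smooth_on_bilinear[OF bounded_bilinear_mult]
lemmas smooth_on_scaleR = smooth_on_bilinear[OF bounded_bilinear_scaleR]
lemmas smooth_on_inner = smooth_on_bilinear[OF bounded_bilinear_inner]

lemma smooth_on_sum:
  "open S \<Longrightarrow> (\<And>i. i \<in> I \<Longrightarrow> smooth_on S (f i)) \<Longrightarrow> smooth_on S (\<lambda>x. \<Sum>i\<in>I. f i x)"
  by (simp add: smooth_on_def Ck_on_sum)

lemma smooth_on_inverse:
  fixes f :: "'e::euclidean_space \<Rightarrow> real"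
  shows "open S \<Longrightarrow> (\<And>x. x \<in> S \<Longrightarrow> f x \<noteq> 0) \<Longrightarrow> smooth_on S f \<Longrightarrow> smooth_on S (\<lambda>x. inverse (f x))"
  by (simp add: smooth_on_def Ck_on_inverse)

lemma smooth_on_compose:
  fixes f :: "'e::euclidean_space \<Rightarrow> 'f::real_normed_vector" and h :: "'c::euclidean_space \<Rightarrow> 'e"
  assumes "open S" "open T" "h ` S \<subseteq> T" "smooth_on S h" "smooth_on T f"
  shows "smooth_on S (\<lambda>x. f (h x))"
  using assms by (auto simp: smooth_on_def intro: Ck_on_compose)

lemma smooth_on_has_derivative:
  "smooth_on S f \<Longrightarrow> x \<in> S \<Longrightarrow> (f has_derivative frechet_derivative f (at x)) (at x)"
  unfolding smooth_on_def using Ck_on_SucD_deriv by blast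

lemma smooth_on_frechet_derivative:
  "smooth_on S f \<Longrightarrow> smooth_on S (\<lambda>x. frechet_derivative f (at x) v)"
  unfolding smooth_on_def by (metis Ck_on.simps(2))

lemma smooth_on_imp_continuous_on: "smooth_on S f \<Longrightarrow> continuous_on S f"
  unfolding smooth_on_def using Ck_on_imp_continuous_on by blast

text \<open>The family \<open>exp (-1/x) / x^n\<close> (extended by 0) is closed under differentiation, up to linear
  combinations; this gives smoothness of all of its members by one induction.\<close>

definition flat :: "nat \<Rightarrow> real \<Rightarrow> real"
  where "flat n x = (if x > 0 then exp (- inverse x) * inverse x ^ n else 0)"

lemma flat_tendsto_0: "(flat n \<longlongrightarrow> 0) (at 0)"
proof -
  have "((\<lambda>y::real. y ^ n / exp y) \<longlongrightarrow> 0) at_top" by (rule tendsto_power_div_exp_0)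
  then have "((\<lambda>x::real. inverse x ^ n / exp (inverse x)) \<longlongrightarrow> 0) (at_right 0)"
    by (rule filterlim_compose[OF _ filterlim_inverse_at_top_right])
  then have r: "(flat n \<longlongrightarrow> 0) (at_right 0)"
    by (rule Lim_transform_eventually)
       (auto simp: eventually_at_right_field flat_def exp_minus divide_simps intro!: exI[of _ 1])
  have l: "(flat n \<longlongrightarrow> 0) (at_left 0)"
    by (rule tendsto_eventually) (auto simp: eventually_at_left_field flat_def intro!: exI[of _ "-1"])
  show ?thesis using l r by (simp add: filterlim_at_split)
qed

lemma flat_has_derivative:
  "(flat n has_real_derivative - real n * flat (Suc n) x + flat (Suc (Suc n)) x) (at x)"
proof -
  consider "x > 0" | "x < 0" | "x = 0" by linarith
  then show ?thesis
  proof cases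
    case 1
    have "((\<lambda>x. exp (- inverse x) * inverse x ^ n) has_real_derivative
        - real n * flat (Suc n) x + flat (Suc (Suc n)) x) (at x)"
      using 1 by (auto intro!: derivative_eq_intros simp: flat_def field_simps power2_eq_square) 
         (cases n; simp add: field_simps)
    then show ?thesis
      by (rule has_field_derivative_transform_within_open[OF _ open_greaterThan[of 0]])
         (use 1 in \<open>auto simp: flat_def\<close>)
  next
    case 2
    have "((\<lambda>x. 0) has_real_derivative - real n * flat (Suc n) x + flat (Suc (Suc n)) x) (at x)"
      using 2 by (simp add: flat_def)
    then show ?thesis
      by (rule has_field_derivative_transform_within_open[OF _ open_lessThan[of 0]])
         (use 2 in \<open>auto simp: flat_def\<close>)
  next
    case 3
    have "((\<lambda>h. flat (Suc n) h) \<longlongrightarrow> 0) (at 0)" by (rule flat_tendsto_0)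
    then have "((\<lambda>h. (flat n (0 + h) - flat n 0) / h) \<longlongrightarrow> 0) (at 0)"
      by (rule Lim_transform_eventually)
         (auto simp: eventually_at flat_def field_simps intro!: exI[of _ 1])
    then show ?thesis using 3 by (simp add: DERIV_def flat_def)
  qed
qed

lemma smooth_on_flat: "smooth_on UNIV (flat n)"
proof -
  have "Ck_on k UNIV (flat n)" for k
  proof (induction k arbitrary: n)
    case 0
    show ?case unfolding Ck_on.simps
      using DERIV_isCont[OF flat_has_derivative] by (auto intro: continuous_at_imp_continuous_on)
  next
    case (Suc k)
    note mult = Ck_on_bilinear[OF bounded_bilinear_mult open_UNIV]
    show ?case
    proof (rule Ck_on_SucI[OF open_UNIV, where F="\<lambda>x v. (- real n * flat (Suc n) x + flat (Suc (Suc n)) x) * v"])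
      show "(flat n has_derivative (\<lambda>v. (- real n * flat (Suc n) x + flat (Suc (Suc n)) x) * v)) (at x)" for x
        using flat_has_derivative[of n x] by (simp add: has_field_derivative_def)
    next
      show "Ck_on k UNIV (\<lambda>x. (- real n * flat (Suc n) x + flat (Suc (Suc n)) x) * v)" for v
        by (intro mult Ck_on_add Ck_on_const Suc) auto
    qed
  qed
  then show ?thesis by (simp add: smooth_on_def)
qed

text \<open>With \<open>u\<close> positive inside the ball of radius \<open>r\<close> and \<open>w\<close> positive outside the ball of radius \<open>r/2\<close>,
  at least one of them is positive everywhere, so that \<open>u / (u + w)\<close> is smooth.\<close>

lemma smooth_bump_exists:
  fixes a :: "'e::euclidean_space"
  assumes "r > 0"
  obtains B :: "'e \<Rightarrow> real" where "smooth_on UNIV B" "\<And>x. dist a x \<le> r / 2 \<Longrightarrow> B x = 1"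
    "\<And>x. dist a x \<ge> r \<Longrightarrow> B x = 0"
proof -
  define u where "u x = flat 0 (r\<^sup>2 - (x - a) \<bullet> (x - a))" for x
  define w where "w x = flat 0 ((x - a) \<bullet> (x - a) + - (r\<^sup>2 / 4))" for x
  have d: "(x - a) \<bullet> (x - a) = (dist a x)\<^sup>2" for x
    by (simp add: dot_square_norm dist_norm norm_minus_commute)
  have su: "smooth_on UNIV (\<lambda>x. (x - a) \<bullet> (x - a))"
  proof -
    have "smooth_on UNIV (\<lambda>x. x + (- a))"
      by (intro smooth_on_add smooth_on_const smooth_on_bounded_linear) auto
    then show ?thesis by (intro smooth_on_inner) auto
  qed
  have "smooth_on UNIV (\<lambda>x. r\<^sup>2 + (-1) * ((x - a) \<bullet> (x - a)))"
    by (intro smooth_on_add smooth_on_mult su) auto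
  then have 1: "smooth_on UNIV u"
    unfolding u_def by (intro smooth_on_compose[OF _ _ _ _ smooth_on_flat]) auto
  have 2: "smooth_on UNIV w"
    unfolding w_def by (intro smooth_on_compose[OF _ _ _ _ smooth_on_flat] smooth_on_add su) auto
  have nn: "u x \<ge> 0" "w x \<ge> 0" for x by (auto simp: u_def w_def flat_def)
  have pos: "u x + w x > 0" for x
  proof (cases "(dist a x)\<^sup>2 < r\<^sup>2")
    case True
    then have "u x > 0" by (simp add: u_def flat_def d)
    with nn(2)[of x] show ?thesis by linarith
  next
    case False
    moreover have "r\<^sup>2 > 0" using assms by simp
    ultimately have "r\<^sup>2 / 4 < (dist a x)\<^sup>2" by linarith
    then have "w x > 0" unfolding w_def flat_def d by simp
    with nn(1)[of x] show ?thesis by linarith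
  qed
  show ?thesis
  proof (rule that[of "\<lambda>x. u x * inverse (u x + w x)"])
    show "smooth_on UNIV (\<lambda>x. u x * inverse (u x + w x))"
      by (intro smooth_on_mult smooth_on_inverse smooth_on_add 1 2) (use pos in \<open>auto simp: less_le\<close>)
  next
    fix x assume "dist a x \<le> r / 2"
    then have "(dist a x)\<^sup>2 \<le> (r/2)\<^sup>2" by (intro power_mono) auto
    then have "w x = 0" by (simp add: w_def flat_def d power2_eq_square)
    then show "u x * inverse (u x + w x) = 1" using pos[of x] by simp
  next
    fix x assume "dist a x \<ge> r"
    then have "(dist a x)\<^sup>2 \<ge> r\<^sup>2" using assms by (intro power_mono) auto
    then show "u x * inverse (u x + w x) = 0" by (simp add: u_def flat_def d)
  qed
qed

lemma segment_in_ball: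
  fixes a :: "'e::real_normed_vector"
  assumes "x \<in> ball a r" "t \<in> {0..1}" shows "a + t *\<^sub>R (x - a) \<in> ball a r"
proof -
  have "norm (t *\<^sub>R (x - a)) \<le> norm (x - a)" using assms by (auto simp: mult_left_le_one_le)
  then show ?thesis using assms by (auto simp: dist_norm norm_minus_commute)
qed

lemma continuous_on_segment_compose:
  fixes a :: "'e::real_normed_vector"
  assumes "continuous_on (ball a r) f"
  shows "continuous_on (ball a r \<times> cbox 0 (1::real)) (\<lambda>p. f (a + snd p *\<^sub>R (fst p - a)))"
  by (rule continuous_on_compose2[OF assms])
     (auto intro!: continuous_intros segment_in_ball simp: cbox_interval simp del: mem_ball)

text \<open>The remainders in Hadamard's lemma are averages of partial derivatives over the segments to the
  centre. The derivative of such an average is an average with one more factor \<open>t\<close>; this is why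
  the weight \<open>t ^ m\<close> is needed for the induction.\<close>

lemma Ck_on_segment_average:
  fixes f :: "'e::euclidean_space \<Rightarrow> real"
  assumes "Ck_on k (ball a r) f"
  shows "Ck_on k (ball a r) (\<lambda>x. integral {0..1} (\<lambda>t. t ^ m * f (a + t *\<^sub>R (x - a))))"
  using assms
proof (induction k arbitrary: f m)
  case (0 f m)
  have "continuous_on (ball a r \<times> cbox 0 (1::real)) (\<lambda>(x,t). t ^ m * f (a + t *\<^sub>R (x - a)))"
    unfolding case_prod_beta using 0 by (intro continuous_intros continuous_on_segment_compose) auto
  then show ?case
    using integral_continuous_on_param[of "ball a r" 0 1 "\<lambda>x t. t ^ m * f (a + t *\<^sub>R (x - a))"]
    by (simp add: cbox_interval)
next
  case (Suc k f m)
  note seg = segment_in_ball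
  let ?D = "\<lambda>b y. frechet_derivative f (at y) b"
  have cD: "continuous_on (ball a r) (?D b)" for b
    using Suc.prems by (auto intro: Ck_on_imp_continuous_on)
  define fx where "fx x t = (\<Sum>b\<in>Basis. (t ^ Suc m * ?D b (a + t *\<^sub>R (x - a))) *\<^sub>R blinfun_inner_left b)" for x t
  have fxv: "blinfun_apply (fx x t) v = t ^ Suc m * ?D v (a + t *\<^sub>R (x - a))" if "x \<in> ball a r" "t \<in> {0..1}" for x t v
  proof -
    have "linear (frechet_derivative f (at (a + t *\<^sub>R (x - a))))"
      using Ck_on_SucD_deriv[OF Suc.prems seg[OF that]] has_derivative_linear by blast
    from linear_sum_Basis[OF this, of v] show ?thesis
      by (simp add: fx_def blinfun.sum_left blinfun.scaleR_left sum_distrib_left inner_commute mult_ac)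
  qed
  have cfx: "continuous_on (ball a r \<times> cbox 0 1) (\<lambda>(x,t). fx x t)"
    unfolding case_prod_beta fx_def by (intro continuous_intros continuous_on_segment_compose cD)
  have cf: "continuous_on (ball a r) f" using Suc.prems Ck_on_imp_continuous_on by blast
  have L: "((\<lambda>x. integral (cbox 0 1) (\<lambda>t. t ^ m * f (a + t *\<^sub>R (x - a)))) has_derivative
      integral (cbox 0 1) (fx x)) (at x within ball a r)" if x: "x \<in> ball a r" for x
  proof (rule leibniz_rule[OF _ _ cfx x convex_ball])
    fix x t assume xt: "x \<in> ball a r" "t \<in> cbox 0 (1::real)"
    have "((\<lambda>x. f (a + t *\<^sub>R (x - a))) has_derivative (\<lambda>v. frechet_derivative f (at (a + t *\<^sub>R (x - a))) (t *\<^sub>R v))) (at x within ball a r)"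
    proof (rule has_derivative_compose[where f="\<lambda>x. a + t *\<^sub>R (x - a)" and g=f])
      show "((\<lambda>x. a + t *\<^sub>R (x - a)) has_derivative (\<lambda>v. t *\<^sub>R v)) (at x within ball a r)"
        by (auto intro!: derivative_eq_intros)
      show "(f has_derivative frechet_derivative f (at (a + t *\<^sub>R (x - a)))) (at (a + t *\<^sub>R (x - a)))"
        by (rule Ck_on_SucD_deriv[OF Suc.prems seg]) (use xt in \<open>auto simp: cbox_interval\<close>)
    qed
    then have *: "((\<lambda>x. t ^ m * f (a + t *\<^sub>R (x - a))) has_derivative (\<lambda>v. t ^ m * frechet_derivative f (at (a + t *\<^sub>R (x - a))) (t *\<^sub>R v))) (at x within ball a r)"
      by (intro derivative_intros)
    have "linear (frechet_derivative f (at (a + t *\<^sub>R (x - a))))"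
      using Ck_on_SucD_deriv[OF Suc.prems seg] xt has_derivative_linear by fastforce
    then show "((\<lambda>x. t ^ m * f (a + t *\<^sub>R (x - a))) has_derivative blinfun_apply (fx x t)) (at x within ball a r)"
    proof -
      have "x \<in> ball a r" "t \<in> {0..1}" using xt by (auto simp: cbox_interval)
      then have "blinfun_apply (fx x t) = (\<lambda>v. t ^ m * frechet_derivative f (at (a + t *\<^sub>R (x - a))) (t *\<^sub>R v))"
        using \<open>linear _\<close> by (intro ext) (simp only: fxv linear_cmul, simp)
      then show ?thesis using * by simp
    qed
  next
    fix x assume "x \<in> ball a r"
    then have "continuous_on (cbox 0 1) (\<lambda>t. t ^ m * f (a + t *\<^sub>R (x - a)))"
      by (intro continuous_intros continuous_on_compose2[OF cf])
         (auto intro!: seg simp: cbox_interval simp del: mem_ball)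
    then show "(\<lambda>t. t ^ m * f (a + t *\<^sub>R (x - a))) integrable_on cbox 0 1"
      by (rule integrable_continuous)
  qed
  show ?case
  proof (rule Ck_on_SucI[OF open_ball, where F="\<lambda>x v. integral {0..1} (\<lambda>t. t ^ Suc m * ?D v (a + t *\<^sub>R (x - a)))"])
    fix x assume x: "x \<in> ball a r"
    have "continuous_on (cbox 0 1) (\<lambda>t. (\<lambda>(x,t). fx x t) (x, t))"
      by (rule continuous_on_compose2[OF cfx]) (use x in \<open>auto intro!: continuous_intros\<close>)
    then have "continuous_on (cbox 0 1) (fx x)" by simp
    then have "fx x integrable_on cbox 0 1" by (rule integrable_continuous)
    note fint = this
    have "blinfun_apply (integral (cbox 0 1) (fx x)) v = integral {0..1} (\<lambda>t. t ^ Suc m * ?D v (a + t *\<^sub>R (x - a)))" for v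
      by (subst blinfun_apply_integral[OF fint]) (unfold cbox_interval, intro integral_cong fxv[OF x])
    then have fxE: "blinfun_apply (integral (cbox 0 1) (fx x)) = (\<lambda>v. integral {0..1} (\<lambda>t. t ^ Suc m * ?D v (a + t *\<^sub>R (x - a))))"
      by auto
    moreover have "at x within ball a r = at x" using x by (simp add: at_within_open[OF _ open_ball])
    ultimately show "((\<lambda>x. integral {0..1} (\<lambda>t. t ^ m * f (a + t *\<^sub>R (x - a)))) has_derivative
        (\<lambda>v. integral {0..1} (\<lambda>t. t ^ Suc m * ?D v (a + t *\<^sub>R (x - a))))) (at x)"
      using L[OF x] unfolding fxE by (simp add: cbox_interval)
  next
    fix v
    show "Ck_on k (ball a r) (\<lambda>x. integral {0..1} (\<lambda>t. t ^ Suc m * ?D v (a + t *\<^sub>R (x - a))))"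
      by (rule Suc.IH) (use Suc.prems in auto)
  qed
qed

text \<open>The fundamental theorem of calculus along the segment from the centre to \<open>x\<close>.\<close>

lemma hadamard:
  fixes f :: "'e::euclidean_space \<Rightarrow> real"
  assumes f: "smooth_on (ball a r) f" and r: "r > 0"
  obtains h where "\<And>b. smooth_on (ball a r) (h b)" "\<And>b. h b a = frechet_derivative f (at a) b"
    "\<And>x. x \<in> ball a r \<Longrightarrow> f x = f a + (\<Sum>b\<in>Basis. ((x - a) \<bullet> b) * h b x)"
proof -
  let ?D = "\<lambda>b y. frechet_derivative f (at y) b"
  define h where "h b x = integral {0..1} (\<lambda>t. t ^ 0 * ?D b (a + t *\<^sub>R (x - a)))" for b x
  show ?thesis
  proof (rule that[of h])
    show "smooth_on (ball a r) (h b)" for b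
      using smooth_on_frechet_derivative[OF f, of b]
      unfolding smooth_on_def h_def by (intro allI Ck_on_segment_average) blast
    show "h b a = frechet_derivative f (at a) b" for b by (simp add: h_def)
    fix x assume x: "x \<in> ball a r"
    note seg = segment_in_ball[OF x]
    have int: "(\<lambda>t. ?D b (a + t *\<^sub>R (x - a))) integrable_on {0..1}" for b
    proof -
      have "continuous_on (ball a r) (?D b)"
        using smooth_on_imp_continuous_on[OF smooth_on_frechet_derivative[OF f]] .
      then have "continuous_on {0..1} (\<lambda>t. ?D b (a + t *\<^sub>R (x - a)))"
        by (rule continuous_on_compose2) (auto intro!: continuous_intros seg simp del: mem_ball)
      then show ?thesis by (rule integrable_continuous_interval)
    qed
    have "((\<lambda>t. ?D (x - a) (a + t *\<^sub>R (x - a))) has_integral f (a + 1 *\<^sub>R (x - a)) - f (a + 0 *\<^sub>R (x - a))) {0..1}"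
    proof (rule fundamental_theorem_of_calculus)
      fix t :: real assume t: "t \<in> {0..1}"
      have "((\<lambda>t. f (a + t *\<^sub>R (x - a))) has_derivative (\<lambda>s. ?D (s *\<^sub>R (x - a)) (a + t *\<^sub>R (x - a)))) (at t within {0..1})"
        by (rule has_derivative_compose[where f="\<lambda>t. a + t *\<^sub>R (x - a)" and g=f and x=t, OF _ smooth_on_has_derivative[OF f seg[OF t]]])
           (auto intro!: derivative_eq_intros)
      moreover have "linear (frechet_derivative f (at (a + t *\<^sub>R (x - a))))"
        using smooth_on_has_derivative[OF f seg[OF t]] has_derivative_linear by blast
      ultimately show "((\<lambda>t. f (a + t *\<^sub>R (x - a))) has_vector_derivative ?D (x - a) (a + t *\<^sub>R (x - a))) (at t within {0..1})"
        by (simp add: has_vector_derivative_def linear_cmul)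
    qed auto
    then have "f x - f a = integral {0..1} (\<lambda>t. ?D (x - a) (a + t *\<^sub>R (x - a)))"
      by (simp add: integral_unique)
    also have "\<dots> = integral {0..1} (\<lambda>t. \<Sum>b\<in>Basis. ((x - a) \<bullet> b) * ?D b (a + t *\<^sub>R (x - a)))"
    proof (rule integral_cong)
      fix t :: real assume t: "t \<in> {0..1}"
      have "linear (frechet_derivative f (at (a + t *\<^sub>R (x - a))))"
        using smooth_on_has_derivative[OF f seg[OF t]] has_derivative_linear by blast
      from linear_sum_Basis[OF this, of "x - a"]
      show "?D (x - a) (a + t *\<^sub>R (x - a)) = (\<Sum>b\<in>Basis. ((x - a) \<bullet> b) * ?D b (a + t *\<^sub>R (x - a)))"
        by simp
    qed
    also have "\<dots> = (\<Sum>b\<in>Basis. ((x - a) \<bullet> b) * h b x)"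
      using int by (simp add: integral_sum integrable_on_mult_right h_def)
    finally show "f x = f a + (\<Sum>b\<in>Basis. ((x - a) \<bullet> b) * h b x)" by simp
  qed
qed

section \<open>Total differential equations\<close>

lemma norm_Basis_combination_le:
  fixes T :: "'d::euclidean_space \<Rightarrow> 'e::real_normed_vector"
  assumes "\<And>b. b \<in> Basis \<Longrightarrow> norm (T b) \<le> k b * X"
  shows "norm (\<Sum>b\<in>Basis. (v \<bullet> b) *\<^sub>R T b) \<le> (\<Sum>b\<in>Basis. k b) * X * norm v"
proof -
  have "norm (\<Sum>b\<in>Basis. (v \<bullet> b) *\<^sub>R T b) \<le> (\<Sum>b\<in>Basis. norm v * (k b * X))"
  proof (rule sum_norm_le)
    fix b :: 'd assume b: "b \<in> Basis"
    have "norm ((v \<bullet> b) *\<^sub>R T b) = \<bar>v \<bullet> b\<bar> * norm (T b)" by simp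
    also have "\<dots> \<le> norm v * (k b * X)"
      by (rule mult_mono) (use assms b Basis_le_norm in auto)
    finally show "norm ((v \<bullet> b) *\<^sub>R T b) \<le> norm v * (k b * X)" .
  qed
  also have "\<dots> = (\<Sum>b\<in>Basis. k b) * X * norm v"
    by (simp add: sum_distrib_left sum_distrib_right mult_ac)
  finally show ?thesis .
qed

lemma smooth_on_derivative_bound:
  fixes f :: "'e::euclidean_space \<Rightarrow> 'f::real_normed_vector"
  assumes f: "smooth_on S f" and K: "compact K" "K \<subseteq> S"
  obtains L where "L \<ge> 0" "\<And>u w. u \<in> K \<Longrightarrow> norm (frechet_derivative f (at u) w) \<le> L * norm w"
proof -
  have "\<exists>k\<ge>0. \<forall>u\<in>K. norm (frechet_derivative f (at u) b) \<le> k" for b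
  proof -
    have "continuous_on K (\<lambda>u. frechet_derivative f (at u) b)"
      using smooth_on_imp_continuous_on[OF smooth_on_frechet_derivative[OF f]] K(2) continuous_on_subset by blast
    then have "bounded ((\<lambda>u. frechet_derivative f (at u) b) ` K)"
      using K(1) compact_continuous_image compact_imp_bounded by blast
    then show ?thesis unfolding bounded_pos by (auto intro: less_imp_le)
  qed
  then obtain k where k: "\<And>b. k b \<ge> 0" "\<And>b u. u \<in> K \<Longrightarrow> norm (frechet_derivative f (at u) b) \<le> k b"
    by metis
  show ?thesis
  proof (rule that[of "\<Sum>b\<in>Basis. k b"])
    show "(\<Sum>b\<in>Basis. k b) \<ge> 0" using k by (simp add: sum_nonneg)
    fix u w assume u: "u \<in> K"
    then have "linear (frechet_derivative f (at u))"
      using smooth_on_has_derivative[OF f] K has_derivative_linear by blast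
    from linear_sum_Basis[OF this, of w]
    show "norm (frechet_derivative f (at u) w) \<le> (\<Sum>b\<in>Basis. k b) * norm w"
      using norm_Basis_combination_le[of "frechet_derivative f (at u)" k 1 w] k u by simp
  qed
qed

lemma smooth_on_lipschitz:
  fixes f :: "'e::euclidean_space \<Rightarrow> 'f::real_normed_vector"
  assumes f: "smooth_on S f" and K: "compact K" "convex K" "K \<subseteq> S"
  obtains L where "L \<ge> 0" "\<And>u v. u \<in> K \<Longrightarrow> v \<in> K \<Longrightarrow> norm (f v - f u) \<le> L * norm (v - u)"
proof -
  obtain L where L: "L \<ge> 0" "\<And>u w. u \<in> K \<Longrightarrow> norm (frechet_derivative f (at u) w) \<le> L * norm w"
    using smooth_on_derivative_bound[OF f K(1,3)] by blast
  show ?thesis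
  proof (rule that[OF L(1)])
    fix u v assume "u \<in> K" "v \<in> K"
    then show "norm (f v - f u) \<le> L * norm (v - u)"
    proof (intro differentiable_bound[OF K(2)])
      fix x assume x: "x \<in> K"
      show "(f has_derivative frechet_derivative f (at x)) (at x within K)"
        using smooth_on_has_derivative[OF f] x K has_derivative_at_withinI by blast
      show "onorm (frechet_derivative f (at x)) \<le> L" by (rule onorm_bound[OF L(1) L(2)[OF x]])
    qed
  qed
qed

text \<open>The derivative is Lipschitz continuous, which bounds the remainder of the linearisation along the
  segment between the two points.\<close>

lemma smooth_on_taylor2:
  fixes f :: "'e::euclidean_space \<Rightarrow> 'f::real_normed_vector"
  assumes f: "smooth_on S f" and K: "compact K" "convex K" "K \<subseteq> S"
  obtains C where "C \<ge> 0" "\<And>u v. u \<in> K \<Longrightarrow> v \<in> K \<Longrightarrow>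
     norm (f v - f u - frechet_derivative f (at u) (v - u)) \<le> C * (norm (v - u))\<^sup>2"
proof -
  have "\<exists>k\<ge>0. \<forall>u\<in>K. \<forall>v\<in>K. norm (frechet_derivative f (at v) b - frechet_derivative f (at u) b) \<le> k * norm (v - u)" for b
    by (rule smooth_on_lipschitz[OF smooth_on_frechet_derivative[OF f] K, of b]) blast
  then obtain k where k: "\<And>b. k b \<ge> 0"
    "\<And>b u v. u \<in> K \<Longrightarrow> v \<in> K \<Longrightarrow> norm (frechet_derivative f (at v) b - frechet_derivative f (at u) b) \<le> k b * norm (v - u)"
    by metis
  define C where "C = (\<Sum>b\<in>(Basis::'e set). k b)"
  have C0: "C \<ge> 0" using k by (simp add: C_def sum_nonneg)
  have der: "(f has_derivative frechet_derivative f (at x)) (at x)" if "x \<in> K" for x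
    using smooth_on_has_derivative[OF f] that K by blast
  have D: "norm ((frechet_derivative f (at v) - frechet_derivative f (at u)) w) \<le> C * norm (v - u) * norm w"
    if uv: "u \<in> K" "v \<in> K" for u v w
  proof -
    have "linear (frechet_derivative f (at v))" "linear (frechet_derivative f (at u))"
      using der uv has_derivative_linear by blast+
    note lin = this[THEN linear_sum_Basis, of w]
    have "(frechet_derivative f (at v) - frechet_derivative f (at u)) w
       = (\<Sum>b\<in>Basis. (w \<bullet> b) *\<^sub>R (frechet_derivative f (at v) b - frechet_derivative f (at u) b))"
      using lin by (simp add: scaleR_diff_right sum_subtractf)
    then show ?thesis unfolding C_def
      using norm_Basis_combination_le[of "\<lambda>b. frechet_derivative f (at v) b - frechet_derivative f (at u) b" k "norm (v - u)" w] k(2)[OF uv]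
      by simp
  qed
  show ?thesis
  proof (rule that[OF C0])
    fix u v assume uv: "u \<in> K" "v \<in> K"
    have seg: "closed_segment u v \<subseteq> K" using uv K(2) by (simp add: closed_segment_subset)
    have "norm (f v - f u - frechet_derivative f (at u) (v - u)) \<le> norm (v - u) * (C * norm (v - u))"
    proof (rule differentiable_bound_linearization[where S="closed_segment u v"])
      show "u + t *\<^sub>R (v - u) \<in> closed_segment u v" if "t \<in> {0..1}" for t
        using that by (auto simp: in_segment algebra_simps intro!: exI[of _ t])
      show "(f has_derivative frechet_derivative f (at x)) (at x within closed_segment u v)"
        if "x \<in> closed_segment u v" for x
        using der seg that has_derivative_at_withinI by blast
      show "onorm (frechet_derivative f (at x) - frechet_derivative f (at u)) \<le> C * norm (v - u)"
        if x: "x \<in> closed_segment u v" for x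
      proof (rule onorm_bound)
        fix w :: 'e
        have "norm (x - u) \<le> norm (v - u)" using segment_bound1[OF x] .
        then have "C * norm (x - u) * norm w \<le> C * norm (v - u) * norm w"
          using C0 by (intro mult_right_mono mult_left_mono) auto
        with D[of u x w] uv x seg
        show "norm ((frechet_derivative f (at x) - frechet_derivative f (at u)) w) \<le> C * norm (v - u) * norm w"
          by fastforce
      qed (use C0 in simp)
    qed auto
    then show "norm (f v - f u - frechet_derivative f (at u) (v - u)) \<le> C * (norm (v - u))\<^sup>2"
      by (simp add: power2_eq_square mult_ac)
  qed
qed

text \<open>The solution of a total differential equation satisfies the radial integral equation below.
  It is solved in the space of bounded continuous functions of the parameter, on all rays at once, so
  that continuity in the direction of the ray is part of the result; the projection to the ball makes
  the integral operator total and bounded.\<close>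

lemma radial_integral_equation:
  fixes a :: "'d::euclidean_space \<Rightarrow> 'e::euclidean_space \<Rightarrow> 'e"
  defines "A \<equiv> \<lambda>q v. \<Sum>b\<in>Basis. (v \<bullet> b) *\<^sub>R a b q"
  assumes cont: "\<And>b. b \<in> Basis \<Longrightarrow> continuous_on UNIV (a b)"
    and M: "\<And>q v. norm (A q v) \<le> M * norm v"
    and L: "\<And>q q' v. norm (A q v - A q' v) \<le> L * norm (q - q') * norm v"
    and \<delta>: "\<delta> > 0" "\<delta> * L \<le> 1/2" and L0: "L \<ge> 0" and M0: "M \<ge> 0"
  obtains s where "continuous_on UNIV s"
    "\<And>x. x \<in> cball 0 \<delta> \<Longrightarrow> s x = q0 + integral {0..1} (\<lambda>t. A (s (t *\<^sub>R x)) x)"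
proof -
  define P where "P = closest_point (cball (0::'d) \<delta>)"
  have ne: "cball (0::'d) \<delta> \<noteq> {}" using \<delta> by simp
  have cP: "continuous_on UNIV P"
    unfolding P_def by (rule continuous_on_closest_point[OF convex_cball closed_cball ne])
  have nP: "norm (P x) \<le> \<delta>" for x
    using closest_point_in_set[OF closed_cball ne, of x] by (simp add: P_def)
  have cA: "continuous_on X (\<lambda>p. A (h p) (k p))" if "continuous_on X h" "continuous_on X k"
    for h :: "'z::topological_space \<Rightarrow> 'e" and k X
    unfolding A_def using that by (intro continuous_intros continuous_on_compose2[OF cont]) auto
  let ?F = "\<lambda>u x t. A (apply_bcontfun u (t *\<^sub>R P x)) (P x)"
  have cF: "continuous_on X (\<lambda>p. ?F u (fst p) (snd p))" for u X
    by (intro cA continuous_on_compose2[OF continuous_on_apply_bcontfun[of UNIV u]]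
        continuous_on_compose2[OF cP] continuous_intros) auto
  have ct: "continuous_on {0..1} (?F u x)" for u x
    by (intro cA continuous_on_compose2[OF continuous_on_apply_bcontfun[of UNIV u]] continuous_intros) auto
  define T where "T u x = q0 + integral {0..1} (?F u x)" for u x
  have Tb: "T u \<in> bcontfun" for u
  proof (rule bcontfun_normI)
    have "continuous_on UNIV (\<lambda>x. integral (cbox 0 1) (?F u x))"
      by (rule integral_continuous_on_param) (use cF in \<open>simp add: case_prod_beta\<close>)
    then show "continuous_on UNIV (T u)"
      unfolding T_def by (intro continuous_intros) (simp add: cbox_interval)
    fix x
    have "norm (integral {0..1} (?F u x)) \<le> (M * \<delta>) * (1 - 0)"
    proof (rule integral_bound[OF _ ct])
      fix t :: real
      have "norm (?F u x t) \<le> M * norm (P x)" by (rule M)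
      also have "\<dots> \<le> M * \<delta>" using nP M0 by (rule mult_left_mono)
      finally show "norm (?F u x t) \<le> M * \<delta>" .
    qed simp
    then show "norm (T u x) \<le> norm q0 + M * \<delta>"
      unfolding T_def by (intro norm_triangle_le) simp
  qed
  define TT where "TT u = Bcontfun (T u)" for u
  have TT: "apply_bcontfun (TT u) x = T u x" for u x
    unfolding TT_def using Bcontfun_inverse[OF Tb] by simp
  have "\<exists>!u. TT u = u"
  proof (rule banach_fix_type[of "1/2"])
    show "\<forall>u w. dist (TT u) (TT w) \<le> 1/2 * dist u w"
    proof (intro allI dist_bound)
      fix u w :: "'d \<Rightarrow>\<^sub>C 'e" and x
      have "T u x - T w x = integral {0..1} (\<lambda>t. ?F u x t - ?F w x t)"
        unfolding T_def
        by (subst Henstock_Kurzweil_Integration.integral_diff)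
           (auto intro: integrable_continuous_interval ct)
      also have "norm \<dots> \<le> (1/2 * dist u w) * (1 - 0)"
      proof (rule integral_bound)
        fix t :: real
        have "norm (?F u x t - ?F w x t) \<le> L * norm (apply_bcontfun u (t *\<^sub>R P x) - apply_bcontfun w (t *\<^sub>R P x)) * norm (P x)"
          by (rule L)
        also have "\<dots> \<le> L * dist u w * \<delta>"
          using nP L0 \<delta> dist_bounded[of u "t *\<^sub>R P x" w]
          by (intro mult_mono mult_left_mono mult_nonneg_nonneg) (auto simp: dist_norm)
        also have "\<dots> = \<delta> * L * dist u w" by simp
        also have "\<dots> \<le> 1/2 * dist u w" using \<delta> by (intro mult_right_mono) auto
        finally show "norm (?F u x t - ?F w x t) \<le> 1/2 * dist u w" .
      qed (auto intro!: continuous_intros ct)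
      finally show "dist (apply_bcontfun (TT u) x) (apply_bcontfun (TT w) x) \<le> 1/2 * dist u w"
        by (simp add: TT dist_norm)
    qed
  qed auto
  then obtain u where u: "TT u = u" by auto
  show ?thesis
  proof (rule that[of "apply_bcontfun u"])
    show "continuous_on UNIV (apply_bcontfun u)" by simp
    fix x :: 'd assume "x \<in> cball 0 \<delta>"
    then have "P x = x" by (simp add: P_def closest_point_self)
    then show "apply_bcontfun u x = q0 + integral {0..1} (\<lambda>t. A (apply_bcontfun u (t *\<^sub>R x)) x)"
      using TT[of u x] by (simp add: u T_def)
  qed
qed

text \<open>Rescaling the ray turns the radial equation at \<open>tx\<close> into an integral equation on \<open>{0..t}\<close>, which can
  be differentiated.\<close>

lemma radial_solution_derivative:
  fixes s :: "'d::euclidean_space \<Rightarrow> 'e::euclidean_space"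
  assumes s: "\<And>x. x \<in> cball 0 \<delta> \<Longrightarrow> s x = q0 + integral {0..1} (\<lambda>t. A (s (t *\<^sub>R x)) x)"
    and lin: "\<And>q. linear (A q)" and x: "x \<in> cball 0 \<delta>"
    and c: "continuous_on {0..1} (\<lambda>t. A (s (t *\<^sub>R x)) x)" and \<tau>: "\<tau> \<in> {0..1}"
  shows "((\<lambda>t. s (t *\<^sub>R x)) has_vector_derivative A (s (\<tau> *\<^sub>R x)) x) (at \<tau> within {0..1})"
proof -
  have eq: "s (t *\<^sub>R x) = q0 + integral {0..t} (\<lambda>t. A (s (t *\<^sub>R x)) x)" if t: "t \<in> {0..1}" for t
  proof (cases "t = 0")
    case True
    have "0 \<in> cball (0::'d) \<delta>" using x by (simp, smt (verit) norm_ge_zero)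
    then show ?thesis using True s[of 0] by (simp add: linear_0[OF lin])
  next
    case False
    have "norm (t *\<^sub>R x) \<le> norm x" using t by (auto simp: mult_left_le_one_le)
    then have "t *\<^sub>R x \<in> cball 0 \<delta>" using x by simp
    then have 1: "s (t *\<^sub>R x) = q0 + integral {0..1} (\<lambda>r. t *\<^sub>R A (s ((t * r) *\<^sub>R x)) x)"
      using s[of "t *\<^sub>R x"] by (simp add: linear_cmul[OF lin] mult.commute)
    have "continuous_on {0..t} (\<lambda>t. A (s (t *\<^sub>R x)) x)"
      using c by (rule continuous_on_subset) (use t in auto)
    then have "((\<lambda>t. A (s (t *\<^sub>R x)) x) has_integral integral {0..t} (\<lambda>t. A (s (t *\<^sub>R x)) x)) {0..t}"
      by (intro integrable_integral integrable_continuous_interval)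
    from has_integral_stretch_real[OF this False]
    have "((\<lambda>r. A (s ((t * r) *\<^sub>R x)) x) has_integral (1/t) *\<^sub>R integral {0..t} (\<lambda>t. A (s (t *\<^sub>R x)) x)) {0..1}"
      using t False by (simp add: image_divide_atLeastAtMost)
    from has_integral_cmul[OF this, of t]
    have "integral {0..1} (\<lambda>r. t *\<^sub>R A (s ((t * r) *\<^sub>R x)) x) = integral {0..t} (\<lambda>t. A (s (t *\<^sub>R x)) x)"
      using False by (intro integral_unique) simp
    with 1 show ?thesis by simp
  qed
  have "((\<lambda>t. q0 + integral {0..t} (\<lambda>t. A (s (t *\<^sub>R x)) x)) has_vector_derivative A (s (\<tau> *\<^sub>R x)) x) (at \<tau> within {0..1})"
    using integral_has_vector_derivative[OF c \<tau>] has_vector_derivative_add[OF has_vector_derivative_const] by fastforce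
  then show ?thesis
    by (rule has_vector_derivative_transform[OF \<tau>, rotated]) (simp add: eq)
qed


text \<open>Frobenius' theorem in the form of a total differential equation \<open>D\<sigma>(x)v = A(\<sigma> x)v\<close>. Its
  solution is defined by the radial equation only. Differentiability at \<open>x\<close> follows by comparing the
  ray \<open>\<sigma> (t(x + h))\<close> with its expected first order expansion \<open>\<sigma> (tx) + t A(\<sigma> (tx))h\<close>: by the
  compatibility condition the latter solves the equation of the former up to \<open>O(|h|\<^sup>2)\<close>, so that the
  two differ by \<open>O(|h|\<^sup>2)\<close>. Higher smoothness is read off the equation.\<close>

theorem frobenius_total_differential:
  fixes a :: "'d::euclidean_space \<Rightarrow> 'e::euclidean_space \<Rightarrow> 'e"
  assumes S: "open S" "q0 \<in> S"
    and sm: "\<And>b. b \<in> Basis \<Longrightarrow> smooth_on S (a b)"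
    and compat: "\<And>q b c. q \<in> S \<Longrightarrow> b \<in> Basis \<Longrightarrow> c \<in> Basis \<Longrightarrow>
      frechet_derivative (a c) (at q) (a b q) = frechet_derivative (a b) (at q) (a c q)"
  obtains \<delta> \<sigma> where "\<delta> > 0" "\<sigma> 0 = q0" "\<sigma> ` ball 0 \<delta> \<subseteq> S" "smooth_on (ball 0 \<delta>) \<sigma>"
    "\<And>x. x \<in> ball 0 \<delta> \<Longrightarrow> (\<sigma> has_derivative (\<lambda>v. \<Sum>b\<in>Basis. (v \<bullet> b) *\<^sub>R a b (\<sigma> x))) (at x)"
proof -
  obtain r where r: "r > 0" "cball q0 r \<subseteq> S" using S open_contains_cball by blast
  define K where "K = cball q0 r"
  have K: "compact K" "convex K" "K \<subseteq> S" "K \<noteq> {}" "closed K" using r by (auto simp: K_def)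
  define Q where "Q = closest_point K"
  have cQ: "continuous_on UNIV Q" unfolding Q_def by (rule continuous_on_closest_point) (use K in auto)
  have QK: "Q x \<in> K" for x unfolding Q_def by (rule closest_point_in_set) (use K in auto)
  have Qid: "Q x = x" if "x \<in> K" for x using that by (simp add: Q_def closest_point_self)
  have Ql: "norm (Q x - Q y) \<le> norm (x - y)" for x y
    using closest_point_lipschitz[of K x y] K by (simp add: Q_def dist_norm)
  define A where "A q v = (\<Sum>b\<in>Basis. (v \<bullet> b) *\<^sub>R a b q)" for q v
  define DA where "DA q w v = (\<Sum>b\<in>Basis. (v \<bullet> b) *\<^sub>R frechet_derivative (a b) (at q) w)" for q w v
  have blinA: "bounded_linear (A q)" for q
    unfolding A_def by (intro bounded_linear_sum bounded_linear_scaleR_const bounded_linear_inner_left)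
  have linA: "linear (A q)" for q using blinA by (simp add: bounded_linear.linear)
  have linDA: "linear (DA q w)" for q w
    unfolding DA_def by (intro bounded_linear.linear bounded_linear_sum bounded_linear_scaleR_const bounded_linear_inner_left)
  have der: "(a b has_derivative frechet_derivative (a b) (at q)) (at q)" if "b \<in> Basis" "q \<in> S" for b q
    using smooth_on_has_derivative[OF sm] that by blast
  have linD: "linear (frechet_derivative (a b) (at q))" if "b \<in> Basis" "q \<in> S" for b q
    using der[OF that] has_derivative_linear by blast

  \<comment> \<open>\<open>M\<close> bounds \<open>A\<close>, \<open>L\<close> its derivative and Lipschitz constant, \<open>C\<close> its second order remainder on \<open>K\<close>\<close>
  have "\<exists>m\<ge>0. \<forall>u\<in>K. norm (a b u) \<le> m" if "b \<in> Basis" for b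
  proof -
    have "continuous_on K (a b)"
      using smooth_on_imp_continuous_on[OF sm[OF that]] K(3) continuous_on_subset by blast
    then have "bounded (a b ` K)" using K(1) compact_continuous_image compact_imp_bounded by blast
    then show ?thesis unfolding bounded_pos by (auto intro: less_imp_le)
  qed
  then obtain m where m: "\<And>b. b \<in> Basis \<Longrightarrow> m b \<ge> 0" "\<And>b u. b \<in> Basis \<Longrightarrow> u \<in> K \<Longrightarrow> norm (a b u) \<le> m b"
    by metis
  have "\<exists>l\<ge>0. \<forall>u\<in>K. \<forall>w. norm (frechet_derivative (a b) (at u) w) \<le> l * norm w" if "b \<in> Basis" for b
    by (rule smooth_on_derivative_bound[OF sm[OF that] K(1,3)]) blast
  then obtain l where l: "\<And>b. b \<in> Basis \<Longrightarrow> l b \<ge> 0" "\<And>b u w. b \<in> Basis \<Longrightarrow> u \<in> K \<Longrightarrow>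
      norm (frechet_derivative (a b) (at u) w) \<le> l b * norm w"
    by metis
  have "\<exists>l\<ge>0. \<forall>u\<in>K. \<forall>v\<in>K. norm (a b v - a b u) \<le> l * norm (v - u)" if "b \<in> Basis" for b
    by (rule smooth_on_lipschitz[OF sm[OF that] K(1,2,3)]) blast
  then obtain l' where l': "\<And>b. b \<in> Basis \<Longrightarrow> l' b \<ge> 0" "\<And>b u v. b \<in> Basis \<Longrightarrow> u \<in> K \<Longrightarrow> v \<in> K \<Longrightarrow>
      norm (a b v - a b u) \<le> l' b * norm (v - u)"
    by metis
  have "\<exists>c\<ge>0. \<forall>u\<in>K. \<forall>v\<in>K. norm (a b v - a b u - frechet_derivative (a b) (at u) (v - u)) \<le> c * (norm (v - u))\<^sup>2"
    if "b \<in> Basis" for b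
    by (rule smooth_on_taylor2[OF sm[OF that] K(1,2,3)]) blast
  then obtain c where c: "\<And>b. b \<in> Basis \<Longrightarrow> c b \<ge> 0" "\<And>b u v. b \<in> Basis \<Longrightarrow> u \<in> K \<Longrightarrow> v \<in> K \<Longrightarrow>
      norm (a b v - a b u - frechet_derivative (a b) (at u) (v - u)) \<le> c b * (norm (v - u))\<^sup>2"
    by metis
  define M where "M = (\<Sum>b\<in>(Basis::'d set). m b)"
  define L where "L = (\<Sum>b\<in>(Basis::'d set). l b) + (\<Sum>b\<in>(Basis::'d set). l' b)"
  define C where "C = (\<Sum>b\<in>(Basis::'d set). c b)"
  have pos: "M \<ge> 0" "L \<ge> 0" "C \<ge> 0" "(\<Sum>b\<in>(Basis::'d set). l b) \<ge> 0" "(\<Sum>b\<in>(Basis::'d set). l' b) \<ge> 0"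
    unfolding M_def L_def C_def using m(1) l(1) l'(1) c(1) by (auto intro!: add_nonneg_nonneg sum_nonneg)
  have AM: "norm (A q v) \<le> M * norm v" if "q \<in> K" for q v
    unfolding A_def M_def using norm_Basis_combination_le[of "\<lambda>b. a b q" m 1 v] m(2) that by simp
  have AL: "norm (A q v - A q' v) \<le> L * norm (q - q') * norm v" if "q \<in> K" "q' \<in> K" for q q' v
  proof -
    have "A q v - A q' v = (\<Sum>b\<in>Basis. (v \<bullet> b) *\<^sub>R (a b q - a b q'))"
      by (simp add: A_def scaleR_diff_right sum_subtractf)
    also have "norm \<dots> \<le> (\<Sum>b\<in>(Basis::'d set). l' b) * norm (q - q') * norm v"
      using l'(2) that by (intro norm_Basis_combination_le) auto
    also have "\<dots> \<le> L * norm (q - q') * norm v"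
      using pos by (intro mult_right_mono) (auto simp: L_def)
    finally show ?thesis .
  qed
  have DAL: "norm (DA q w v) \<le> L * norm w * norm v" if "q \<in> K" for q w v
  proof -
    have "norm (DA q w v) \<le> (\<Sum>b\<in>(Basis::'d set). l b) * norm w * norm v"
      unfolding DA_def using l(2) that by (intro norm_Basis_combination_le) auto
    also have "\<dots> \<le> L * norm w * norm v"
      using pos by (intro mult_right_mono) (auto simp: L_def)
    finally show ?thesis .
  qed
  have DAC: "norm (A q' v - A q v - DA q (q' - q) v) \<le> C * (norm (q' - q))\<^sup>2 * norm v" if "q \<in> K" "q' \<in> K" for q q' v
  proof -
    have "A q' v - A q v - DA q (q' - q) v = (\<Sum>b\<in>Basis. (v \<bullet> b) *\<^sub>R (a b q' - a b q - frechet_derivative (a b) (at q) (q' - q)))"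
      by (simp add: A_def DA_def scaleR_diff_right sum_subtractf)
    also have "norm \<dots> \<le> C * (norm (q' - q))\<^sup>2 * norm v"
      unfolding C_def using c(2) that by (intro norm_Basis_combination_le) auto
    finally show ?thesis .
  qed
  have sym: "DA q (A q w) v = DA q (A q v) w" if "q \<in> S" for q v w
  proof -
    have 1: "DA q (A q w) v = (\<Sum>b\<in>Basis. \<Sum>c\<in>Basis. ((v \<bullet> b) * (w \<bullet> c)) *\<^sub>R frechet_derivative (a b) (at q) (a c q))" for v w
      unfolding DA_def A_def
      by (intro sum.cong refl) (simp add: linear_sum[OF linD] linear_cmul[OF linD] that scaleR_sum_right)
    have "DA q (A q w) v = (\<Sum>c\<in>Basis. \<Sum>b\<in>Basis. ((v \<bullet> b) * (w \<bullet> c)) *\<^sub>R frechet_derivative (a b) (at q) (a c q))"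
      unfolding 1 by (rule sum.swap)
    also have "\<dots> = DA q (A q v) w"
      unfolding 1 by (intro sum.cong refl) (simp add: compat[OF that] mult.commute)
    finally show ?thesis .
  qed
  have derA: "((\<lambda>q. A q v) has_derivative (\<lambda>w. DA q w v)) (at q)" if "q \<in> S" for q v
    unfolding A_def DA_def by (intro has_derivative_sum has_derivative_scaleR_right der that)

  \<comment> \<open>\<open>\<delta> L \<le> 1/2\<close> makes the integral operator a contraction and absorbs the error in the comparison below;
    \<open>M \<delta> \<le> r/2\<close> keeps the solution in half of the ball, which leaves room for the comparison curve\<close>
  define \<delta> where "\<delta> = min (1 / (2 * (L + 1))) (r / (2 * (M + 1)))"
  have \<delta>: "\<delta> > 0" "\<delta> * L \<le> 1/2" "M * \<delta> \<le> r / 2"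
  proof -
    show "\<delta> > 0" using pos r by (auto simp: \<delta>_def)
    have "\<delta> * L \<le> 1 / (2 * (L + 1)) * L" using pos by (intro mult_right_mono) (auto simp: \<delta>_def)
    also have "\<dots> \<le> 1/2" using pos by (simp add: divide_simps)
    finally show "\<delta> * L \<le> 1/2" .
    have "M * \<delta> \<le> M * (r / (2 * (M + 1)))" using pos by (intro mult_left_mono) (auto simp: \<delta>_def)
    also have "\<dots> \<le> r / 2" using pos r by (simp add: divide_simps)
    finally show "M * \<delta> \<le> r / 2" .
  qed
  have "\<exists>\<sigma>. continuous_on UNIV \<sigma> \<and> (\<forall>x\<in>cball 0 \<delta>. \<sigma> x = q0 + integral {0..1} (\<lambda>t. A (Q (\<sigma> (t *\<^sub>R x))) x))"
  proof (rule radial_integral_equation[of "\<lambda>b q. a b (Q q)" M L \<delta> q0, folded A_def])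
    show "continuous_on UNIV (\<lambda>q. a b (Q q))" if "b \<in> Basis" for b
      using QK K(3) by (intro continuous_on_compose2[OF smooth_on_imp_continuous_on[OF sm[OF that]] cQ]) auto
    show "norm (A (Q q) v) \<le> M * norm v" for q v by (rule AM[OF QK])
    show "norm (A (Q q) v - A (Q q') v) \<le> L * norm (q - q') * norm v" for q q' v
    proof -
      have "norm (A (Q q) v - A (Q q') v) \<le> L * norm (Q q - Q q') * norm v" by (rule AL[OF QK QK])
      also have "\<dots> \<le> L * norm (q - q') * norm v"
        using pos Ql by (intro mult_right_mono mult_left_mono) auto
      finally show ?thesis .
    qed
  qed (use \<delta> pos in auto)
  then obtain \<sigma> where c\<sigma>: "continuous_on UNIV \<sigma>"
    and \<sigma>Q: "\<And>x. x \<in> cball 0 \<delta> \<Longrightarrow> \<sigma> x = q0 + integral {0..1} (\<lambda>t. A (Q (\<sigma> (t *\<^sub>R x))) x)" by auto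
  have cA: "continuous_on X (\<lambda>t. A (f t) v)" if "continuous_on X f" "f ` X \<subseteq> S" for X :: "real set" and f v
    unfolding A_def using that
    by (intro continuous_intros continuous_on_compose2[OF smooth_on_imp_continuous_on[OF sm]])
  have \<sigma>K: "norm (\<sigma> x - q0) \<le> r/2" if x: "x \<in> cball 0 \<delta>" for x
  proof -
    have "norm (integral {0..1} (\<lambda>t. A (Q (\<sigma> (t *\<^sub>R x))) x)) \<le> M * \<delta> * (1 - 0)"
    proof (rule integral_bound)
      show "continuous_on {0..1} (\<lambda>t. A (Q (\<sigma> (t *\<^sub>R x))) x)"
        by (intro cA continuous_on_compose2[OF cQ] continuous_on_compose2[OF c\<sigma>] continuous_intros) (use QK K in auto)
      fix t :: real
      have "norm (A (Q (\<sigma> (t *\<^sub>R x))) x) \<le> M * norm x" by (rule AM[OF QK])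
      also have "\<dots> \<le> M * \<delta>" using x pos by (intro mult_left_mono) auto
      finally show "norm (A (Q (\<sigma> (t *\<^sub>R x))) x) \<le> M * \<delta>" .
    qed simp
    then show ?thesis using \<sigma>Q[OF x] \<delta>(3) by simp
  qed
  have \<sigma>inK: "\<sigma> x \<in> K" if "x \<in> cball 0 \<delta>" for x
    using \<sigma>K[OF that] r by (simp add: K_def dist_norm norm_minus_commute)
  have scal: "t *\<^sub>R x \<in> cball 0 \<delta>" if "x \<in> cball 0 \<delta>" "t \<in> {0..1}" for t and x :: 'd
  proof -
    have "norm (t *\<^sub>R x) \<le> norm x" using that by (auto simp: mult_left_le_one_le)
    then show ?thesis using that by simp
  qed
  have ray: "((\<lambda>t. \<sigma> (t *\<^sub>R x)) has_vector_derivative A (\<sigma> (\<tau> *\<^sub>R x)) x) (at \<tau> within {0..1})"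
    if x: "x \<in> cball 0 \<delta>" and \<tau>: "\<tau> \<in> {0..1}" for x \<tau>
  proof (rule radial_solution_derivative[OF _ linA x _ \<tau>])
    fix x :: 'd assume x: "x \<in> cball 0 \<delta>"
    show "\<sigma> x = q0 + integral {0..1} (\<lambda>t. A (\<sigma> (t *\<^sub>R x)) x)"
      unfolding \<sigma>Q[OF x] by (intro arg_cong2[where f="(+)"] integral_cong refl) (simp only: Qid[OF \<sigma>inK[OF scal[OF x]]])
  next
    show "continuous_on {0..1} (\<lambda>t. A (\<sigma> (t *\<^sub>R x)) x)"
      using x by (intro cA continuous_on_compose2[OF c\<sigma>] continuous_intros) (use \<sigma>inK scal K in blast)+
  qed
  have \<sigma>0: "\<sigma> 0 = q0" using \<sigma>Q[of 0] \<delta>(1) by (simp add: linear_0[OF linA])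

  \<comment> \<open>\<open>w\<close> is the difference of the ray through \<open>x + h\<close> and its expected expansion; with \<open>W\<close> the maximum of
    \<open>|w|\<close>, the bound \<open>|w'| \<le> W/2 + C'|h|\<^sup>2\<close> and \<open>w 0 = 0\<close> yield \<open>W \<le> 2C'|h|\<^sup>2\<close>\<close>
  define C' where "C' = C * M\<^sup>2 * \<delta> + L * M"
  have C'0: "C' \<ge> 0" using pos \<delta> by (simp add: C'_def)
  have approx: "norm (\<sigma> (x + h) - \<sigma> x - A (\<sigma> x) h) \<le> 2 * C' * (norm h)\<^sup>2"
    if x: "x \<in> cball 0 \<delta>" and xh: "x + h \<in> cball 0 \<delta>" and h: "M * norm h \<le> r / 2" for x h
  proof -
    let ?u = "\<lambda>t. \<sigma> (t *\<^sub>R x)" and ?z = "\<lambda>t. \<sigma> (t *\<^sub>R (x + h))"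
    let ?v = "\<lambda>t. ?u t + t *\<^sub>R A (?u t) h"
    define w where "w t = ?z t - ?v t" for t
    have uK: "?u t \<in> K" and zK: "?z t \<in> K" if "t \<in> {0..1}" for t
      using \<sigma>inK scal x xh that by blast+
    have tle: "norm (t *\<^sub>R y) \<le> norm y" if "t \<in> {0..1}" for t and y :: 'e
      using that by (auto simp: mult_left_le_one_le)
    have vK: "?v t \<in> K" if t: "t \<in> {0..1}" for t
    proof -
      have "norm (?v t - q0) \<le> norm (?u t - q0) + norm (t *\<^sub>R A (?u t) h)"
        using norm_triangle_ineq[of "?u t - q0" "t *\<^sub>R A (?u t) h"] by (simp add: algebra_simps)
      also have "\<dots> \<le> r/2 + M * norm h"
        using \<sigma>K[OF scal[OF x t]] tle[OF t, of "A (?u t) h"] AM[OF uK[OF t], of h] by linarith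
      finally show ?thesis using h by (simp add: K_def dist_norm norm_minus_commute)
    qed
    define w' where "w' t = A (?z t) (x + h) - (A (?u t) x + (t *\<^sub>R DA (?u t) (A (?u t) x) h + A (?u t) h))" for t
    have dw: "(w has_vector_derivative w' t) (at t within {0..1})" if t: "t \<in> {0..1}" for t
    proof -
      have "((\<lambda>t. A (?u t) h) has_vector_derivative DA (?u t) (A (?u t) x) h) (at t within {0..1})"
      proof -
        have lw: "linear (\<lambda>w. DA (?u t) w h)" using derA[of "?u t" h] uK[OF t] K has_derivative_linear by blast
        moreover have "((\<lambda>t. A (?u t) h) has_derivative (\<lambda>y. DA (?u t) (y *\<^sub>R A (?u t) x) h)) (at t within {0..1})"
          by (rule has_derivative_compose[where f="?u" and g="\<lambda>q. A q h" and x=t])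
             (use ray[OF x t] derA uK[OF t] K in \<open>auto simp: has_vector_derivative_def\<close>)
        ultimately show ?thesis by (simp add: has_vector_derivative_def linear_cmul[OF lw])
      qed
      from has_vector_derivative_scaleR[OF DERIV_ident this]
      have "((\<lambda>t. t *\<^sub>R A (?u t) h) has_vector_derivative (t *\<^sub>R DA (?u t) (A (?u t) x) h + A (?u t) h)) (at t within {0..1})"
        by simp
      then show ?thesis unfolding w_def[abs_def] w'_def
        by (intro has_vector_derivative_diff has_vector_derivative_add ray x xh t)
    qed
    have cw: "continuous_on {0..1} w"
      unfolding continuous_on_eq_continuous_within
      by (intro ballI has_vector_derivative_continuous[OF dw])
    then have "continuous_on {0..1} (\<lambda>t. norm (w t))" by (intro continuous_intros)
    then obtain t0 where t0: "t0 \<in> {0..1}" "\<And>t. t \<in> {0..1} \<Longrightarrow> norm (w t) \<le> norm (w t0)"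
      using continuous_attains_sup[of "{0..1::real}" "\<lambda>t. norm (w t)"] by auto
    define W where "W = norm (w t0)"
    have bound: "norm (w' t) \<le> W / 2 + C' * (norm h)\<^sup>2" if t: "t \<in> {0..1}" for t
    proof -
      let ?k = "t *\<^sub>R A (?u t) h"
      have lin2: "linear (\<lambda>w. DA (?u t) w (x + h))" using derA[of "?u t" "x + h"] uK[OF t] K has_derivative_linear by blast
      have "A (?u t) (x + h) = A (?u t) x + A (?u t) h" by (rule linear_add[OF linA])
      moreover have "DA (?u t) ?k (x + h) = t *\<^sub>R DA (?u t) (A (?u t) x) h + t *\<^sub>R DA (?u t) (A (?u t) h) h"
        using linear_cmul[OF lin2, of t "A (?u t) h"] linear_add[OF linDA, of "?u t" "A (?u t) h" x h]
          sym[of "?u t" h x] uK[OF t] K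
        by (auto simp: scaleR_add_right)
      ultimately have eq: "w' t = (A (?z t) (x + h) - A (?v t) (x + h))
          + ((A (?v t) (x + h) - A (?u t) (x + h) - DA (?u t) ?k (x + h)) + t *\<^sub>R DA (?u t) (A (?u t) h) h)"
        unfolding w'_def by (simp add: algebra_simps)
      have nxh: "norm (x + h) \<le> \<delta>" using xh by simp
      have "norm (A (?z t) (x + h) - A (?v t) (x + h)) \<le> L * norm (?z t - ?v t) * norm (x + h)"
        by (rule AL[OF zK[OF t] vK[OF t]])
      also have "\<dots> \<le> L * W * \<delta>"
        using t0(2)[OF t] nxh pos by (intro mult_mono mult_left_mono mult_nonneg_nonneg) (auto simp: W_def w_def)
      also have "\<dots> = (\<delta> * L) * W" by simp
      also have "\<dots> \<le> 1/2 * W" using \<delta>(2) by (intro mult_right_mono) (auto simp: W_def)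
      finally have 1: "norm (A (?z t) (x + h) - A (?v t) (x + h)) \<le> W / 2" by simp
      have nk: "norm ?k \<le> M * norm h" using tle[OF t, of "A (?u t) h"] AM[OF uK[OF t], of h] by linarith
      have "norm (A (?v t) (x + h) - A (?u t) (x + h) - DA (?u t) (?v t - ?u t) (x + h)) \<le> C * (norm (?v t - ?u t))\<^sup>2 * norm (x + h)"
        by (rule DAC[OF uK[OF t] vK[OF t]])
      also have "\<dots> \<le> C * (M * norm h)\<^sup>2 * \<delta>"
        using nk nxh pos by (intro mult_mono mult_left_mono mult_nonneg_nonneg power_mono) auto
      finally have 2: "norm (A (?v t) (x + h) - A (?u t) (x + h) - DA (?u t) ?k (x + h)) \<le> C * M\<^sup>2 * \<delta> * (norm h)\<^sup>2"
        by (simp add: power_mult_distrib mult_ac)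
      have "norm (t *\<^sub>R DA (?u t) (A (?u t) h) h) \<le> norm (DA (?u t) (A (?u t) h) h)" by (rule tle[OF t])
      also have "\<dots> \<le> L * norm (A (?u t) h) * norm h" by (rule DAL[OF uK[OF t]])
      also have "\<dots> \<le> L * (M * norm h) * norm h"
        using AM[OF uK[OF t], of h] pos by (intro mult_right_mono mult_left_mono) auto
      finally have 3: "norm (t *\<^sub>R DA (?u t) (A (?u t) h) h) \<le> L * M * (norm h)\<^sup>2"
        by (simp add: power2_eq_square mult_ac)
      have "norm (w' t) \<le> W / 2 + (C * M\<^sup>2 * \<delta> * (norm h)\<^sup>2 + L * M * (norm h)\<^sup>2)"
        unfolding eq by (intro norm_triangle_le add_mono 1 2 3)
      then show ?thesis by (simp add: C'_def algebra_simps)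
    qed
    have w0: "w 0 = 0" by (simp add: w_def)
    have W0: "W \<ge> 0" by (simp add: W_def)
    have "norm (w t0 - w 0) \<le> (W / 2 + C' * (norm h)\<^sup>2) * norm (t0 - 0)"
    proof (rule differentiable_bound[of "{0..1}" w "\<lambda>t y. y *\<^sub>R w' t"])
      show "(w has_derivative (\<lambda>y. y *\<^sub>R w' t)) (at t within {0..1})" if "t \<in> {0..1}" for t
        using dw[OF that] by (simp add: has_vector_derivative_def)
      show "onorm (\<lambda>y. y *\<^sub>R w' t) \<le> W / 2 + C' * (norm h)\<^sup>2" if "t \<in> {0..1}" for t
        using bound[OF that] W0 C'0
        by (intro onorm_bound) (auto simp: mult.commute[of _ "norm (w' t)"] intro!: mult_right_mono)
    qed (use t0 in auto)
    also have "\<dots> \<le> (W / 2 + C' * (norm h)\<^sup>2) * 1"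
      using t0(1) W0 C'0 by (intro mult_left_mono) auto
    finally have "W \<le> 2 * C' * (norm h)\<^sup>2" by (simp add: w0 W_def)
    moreover have "norm (w 1) \<le> W" using t0(2)[of 1] by (simp add: W_def)
    ultimately show ?thesis by (simp add: w_def diff_diff_eq)
  qed
  have d\<sigma>: "(\<sigma> has_derivative A (\<sigma> x)) (at x)" if x: "x \<in> ball 0 \<delta>" for x
    unfolding has_derivative_at
  proof (intro conjI blinA)
    \<comment> \<open>increments below \<open>e\<close> stay in the ball and satisfy the smallness condition of \<open>approx\<close>\<close>
    define e where "e = min (\<delta> - norm x) (r / (2 * (M + 1)))"
    have e: "e > 0" using x r pos by (auto simp: e_def)
    have "eventually (\<lambda>h. norm (norm (\<sigma> (x + h) - \<sigma> x - A (\<sigma> x) h) / norm h) \<le> 2 * C' * norm h) (at 0)"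
      unfolding eventually_at
    proof (intro exI[of _ e] conjI e ballI impI)
      fix h :: 'd assume h: "h \<noteq> 0 \<and> dist h 0 < e"
      then have he: "norm h \<le> e" "norm h > 0" by auto
      have "norm (x + h) \<le> \<delta>" using norm_triangle_ineq[of x h] he by (simp add: e_def)
      moreover have "M * norm h \<le> r / 2"
      proof -
        have "M * norm h \<le> M * (r / (2 * (M + 1)))" using he pos by (intro mult_left_mono) (auto simp: e_def)
        also have "\<dots> \<le> r / 2" using pos r by (simp add: divide_simps)
        finally show ?thesis .
      qed
      ultimately have "norm (\<sigma> (x + h) - \<sigma> x - A (\<sigma> x) h) \<le> 2 * C' * (norm h)\<^sup>2"
        using x by (intro approx) auto
      then show "norm (norm (\<sigma> (x + h) - \<sigma> x - A (\<sigma> x) h) / norm h) \<le> 2 * C' * norm h"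
        using he by (simp add: divide_simps power2_eq_square mult_ac)
    qed
    moreover have "((\<lambda>h::'d. 2 * C' * norm h) \<longlongrightarrow> 0) (at 0)"
      by (rule tendsto_eq_intros | simp)+
    ultimately show "((\<lambda>h. norm (\<sigma> (x + h) - \<sigma> x - A (\<sigma> x) h) / norm h) \<longlongrightarrow> 0) (at 0)"
      by (rule Lim_null_comparison)
  qed
  have \<sigma>S: "\<sigma> ` ball 0 \<delta> \<subseteq> S" using \<sigma>inK K(3) by fastforce
  have "Ck_on k (ball 0 \<delta>) \<sigma>" for k
  proof (induction k)
    case 0
    then show ?case using c\<sigma> continuous_on_subset by auto
  next
    case (Suc k)
    show ?case
    proof (rule Ck_on_SucI[OF open_ball d\<sigma>])
      fix v
      have "Ck_on k S (a b)" if "b \<in> Basis" for b using sm[OF that] by (simp add: smooth_on_def)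
      then have "Ck_on k (ball 0 \<delta>) (\<lambda>x. a b (\<sigma> x))" if "b \<in> Basis" for b
        using that by (intro Ck_on_compose[OF open_ball S(1) \<sigma>S Suc]) auto
      then show "Ck_on k (ball 0 \<delta>) (\<lambda>x. A (\<sigma> x) v)"
        unfolding A_def by (intro Ck_on_sum Ck_on_bilinear[OF bounded_bilinear_scaleR] Ck_on_const open_ball)
    qed
  qed
  then have "smooth_on (ball 0 \<delta>) \<sigma>" by (simp add: smooth_on_def)
  then show ?thesis using that[of \<delta> \<sigma>] \<delta>(1) \<sigma>0 \<sigma>S d\<sigma> by (simp add: A_def[abs_def])
qed

section \<open>Smooth functions on manifolds\<close>

lemma chart_facts:
  assumes M: "smooth_manifold M" and Uc: "(U, c) \<in> atlas M"
  shows chart_openin: "openin (mtop M) U" and chart_image_open: "open (c ` U)"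
    and chart_subset: "U \<subseteq> carrier_of M"
    and chart_homeo: "homeomorphic_map (subtopology (mtop M) U) (top_of_set (c ` U)) c"
proof -
  show "openin (mtop M) U" "open (c ` U)"
    "homeomorphic_map (subtopology (mtop M) U) (top_of_set (c ` U)) c"
    using M Uc unfolding smooth_manifold_def by fast+
  then show "U \<subseteq> carrier_of M" unfolding carrier_of_def by (simp add: openin_subset)
qed

lemma chart_inj:
  assumes "smooth_manifold M" "(U, c) \<in> atlas M" shows "inj_on c U"
proof -
  have "topspace (subtopology (mtop M) U) = U"
    using chart_subset[OF assms] by (auto simp: carrier_of_def)
  then show ?thesis using homeomorphic_imp_injective_map[OF chart_homeo[OF assms]] by simp
qed

lemma chart_inv [simp]:
  assumes "smooth_manifold M" "(U, c) \<in> atlas M" "q \<in> U" shows "inv_into U c (c q) = q"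
  using chart_inj[OF assms(1,2)] assms(3) by simp

lemma chart_at:
  assumes "smooth_manifold M" "p \<in> carrier_of M"
  obtains U c where "(U, c) \<in> atlas M" "p \<in> U"
  using assms unfolding smooth_manifold_def by fastforce

lemma chart_transition:
  assumes "smooth_manifold M" "(U, c) \<in> atlas M" "(V, d) \<in> atlas M"
  shows "smooth_on (c ` (U \<inter> V)) (d \<circ> inv_into U c)"
  using assms unfolding smooth_manifold_def by fast

lemma chart_image_openin:
  assumes M: "smooth_manifold M" and Uc: "(U, c) \<in> atlas M" and W: "openin (mtop M) W"
  shows "open (c ` (U \<inter> W))"
proof -
  have "openin (subtopology (mtop M) U) (U \<inter> W)" using W by (simp add: openin_subtopology_Int2)
  then have "openin (top_of_set (c ` U)) (c ` (U \<inter> W))"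
    using homeomorphic_imp_open_map[OF chart_homeo[OF M Uc]] by (auto simp: open_map_def)
  then show ?thesis using chart_image_open[OF M Uc] openin_open_trans by blast
qed

lemma chart_preimage_openin:
  assumes M: "smooth_manifold M" and Uc: "(U, c) \<in> atlas M" and S: "open S"
  shows "openin (mtop M) {q \<in> U. c q \<in> S}"
proof -
  have "continuous_map (subtopology (mtop M) U) (top_of_set (c ` U)) c"
    using chart_homeo[OF M Uc] by (rule homeomorphic_imp_continuous_map)
  then have "continuous_map (subtopology (mtop M) U) euclidean c"
    using continuous_map_in_subtopology by blast
  then have "openin (subtopology (mtop M) U) {q \<in> topspace (subtopology (mtop M) U). c q \<in> S}"
    using openin_continuous_map_preimage[of _ euclidean c S] S by (metis open_openin)
  moreover have "topspace (subtopology (mtop M) U) = U"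
    using chart_subset[OF M Uc] by (auto simp: carrier_of_def)
  ultimately show ?thesis using chart_openin[OF M Uc] openin_trans_full by fastforce
qed

lemma chart_inv_continuous:
  assumes M: "smooth_manifold M" and Uc: "(U, c) \<in> atlas M"
  shows "continuous_map (top_of_set (c ` U)) (mtop M) (inv_into U c)"
proof -
  obtain k where k: "homeomorphic_maps (subtopology (mtop M) U) (top_of_set (c ` U)) c k"
    using chart_homeo[OF M Uc] homeomorphic_map_maps by blast
  have T: "topspace (subtopology (mtop M) U) = U"
    using chart_subset[OF M Uc] by (auto simp: carrier_of_def)
  have "k y = inv_into U c y" if "y \<in> c ` U" for y
    using k that chart_inv[OF M Uc] T unfolding homeomorphic_maps_def by force
  moreover have "continuous_map (top_of_set (c ` U)) (mtop M) k"
    using k unfolding homeomorphic_maps_def by (meson continuous_map_in_subtopology)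
  ultimately show ?thesis by (rule continuous_map_eq[rotated]) simp
qed

lemma openin_carrier [simp]: "openin (mtop M) (carrier_of M)"
  by (simp add: carrier_of_def)

lemma openin_mtop_subset: "openin (mtop M) W \<Longrightarrow> W \<subseteq> carrier_of M"
  by (simp add: carrier_of_def openin_subset)

lemma smooth_funsD:
  "f \<in> smooth_funs M W \<Longrightarrow> (U, c) \<in> atlas M \<Longrightarrow> smooth_on (c ` (U \<inter> W)) (f \<circ> inv_into U c)"
  unfolding smooth_funs_def by fast

text \<open>By the smoothness of the transition maps, smoothness can be tested in one chart near each
  point.\<close>

lemma smooth_funs_chartI:
  assumes M: "smooth_manifold M"
    and loc: "\<And>p. p \<in> W \<Longrightarrow> p \<in> carrier_of M \<Longrightarrow> \<exists>U c W'. (U, c) \<in> atlas M \<and> openin (mtop M) W' \<and> p \<in> U \<and> p \<in> W' \<and>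
       smooth_on (c ` (U \<inter> W')) (f \<circ> inv_into U c)"
  shows "f \<in> smooth_funs M W"
  unfolding smooth_funs_def
proof (intro CollectI ballI, clarify)
  fix V d assume V: "(V, d) \<in> atlas M"
  show "smooth_on (d ` (V \<inter> W)) (f \<circ> inv_into V d)"
  proof (rule smooth_on_local)
    fix y assume "y \<in> d ` (V \<inter> W)"
    then obtain q where q: "q \<in> V" "q \<in> W" "y = d q" by auto
    then have "q \<in> carrier_of M" using chart_subset[OF M V] by auto
    from loc[OF q(2) this] obtain U c W' where U: "(U, c) \<in> atlas M" "openin (mtop M) W'" "q \<in> U" "q \<in> W'"
      "smooth_on (c ` (U \<inter> W')) (f \<circ> inv_into U c)" by blast
    define T where "T = d ` (V \<inter> (U \<inter> W'))"
    have T: "open T" unfolding T_def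
      using chart_openin[OF M U(1)] U(2) by (intro chart_image_openin[OF M V]) auto
    have "smooth_on T (\<lambda>z. (f \<circ> inv_into U c) ((c \<circ> inv_into V d) z))"
    proof (rule smooth_on_compose[OF T chart_image_openin[OF M U(1,2)] _ _ U(5)])
      show "(c \<circ> inv_into V d) ` T \<subseteq> c ` (U \<inter> W')" using chart_inv[OF M V] by (auto simp: T_def)
      show "smooth_on T (c \<circ> inv_into V d)"
        by (rule smooth_on_subset[OF chart_transition[OF M V U(1)]]) (auto simp: T_def)
    qed
    moreover have "(f \<circ> inv_into U c) ((c \<circ> inv_into V d) z) = (f \<circ> inv_into V d) z" if "z \<in> T" for z
      using that chart_inv[OF M V] chart_inv[OF M U(1)] by (auto simp: T_def)
    ultimately have "smooth_on T (f \<circ> inv_into V d)"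
      using smooth_on_cong[OF T, of "\<lambda>z. (f \<circ> inv_into U c) ((c \<circ> inv_into V d) z)" "f \<circ> inv_into V d"] by simp
    then show "\<exists>T. open T \<and> y \<in> T \<and> smooth_on T (f \<circ> inv_into V d)"
      using T q U by (auto simp: T_def)
  qed
qed

lemma smooth_funs_localI:
  assumes M: "smooth_manifold M"
    and "\<And>p. p \<in> W \<Longrightarrow> p \<in> carrier_of M \<Longrightarrow> \<exists>W'. openin (mtop M) W' \<and> p \<in> W' \<and> f \<in> smooth_funs M W'"
  shows "f \<in> smooth_funs M W"
proof (rule smooth_funs_chartI[OF M])
  fix p assume p: "p \<in> W" "p \<in> carrier_of M"
  obtain U c where "(U, c) \<in> atlas M" "p \<in> U" using chart_at[OF M p(2)] .
  with assms(2)[OF p] show "\<exists>U c W'. (U, c) \<in> atlas M \<and> openin (mtop M) W' \<and> p \<in> U \<and> p \<in> W' \<and>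
       smooth_on (c ` (U \<inter> W')) (f \<circ> inv_into U c)" using smooth_funsD by blast
qed

lemma smooth_funs_subset: "f \<in> smooth_funs M W \<Longrightarrow> W' \<subseteq> W \<Longrightarrow> f \<in> smooth_funs M W'"
  unfolding smooth_funs_def by (auto intro: smooth_on_subset)

lemma smooth_funs_cong:
  assumes M: "smooth_manifold M" and W: "openin (mtop M) W" and "\<And>q. q \<in> W \<Longrightarrow> f q = h q"
    and f: "f \<in> smooth_funs M W"
  shows "h \<in> smooth_funs M W"
proof (rule smooth_funs_chartI[OF M])
  fix p assume p: "p \<in> W" "p \<in> carrier_of M"
  obtain U c where U: "(U, c) \<in> atlas M" "p \<in> U" using chart_at[OF M p(2)] .
  have "smooth_on (c ` (U \<inter> W)) (h \<circ> inv_into U c)"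
    by (rule smooth_on_cong[OF chart_image_openin[OF M U(1) W], THEN iffD1, OF _ smooth_funsD[OF f U(1)]])
       (auto simp: chart_inv[OF M U(1)] assms(3))
  then show "\<exists>U c W'. (U, c) \<in> atlas M \<and> openin (mtop M) W' \<and> p \<in> U \<and> p \<in> W' \<and>
       smooth_on (c ` (U \<inter> W')) (h \<circ> inv_into U c)" using U W p by blast
qed

lemma smooth_funs_const [simp]: "(\<lambda>x. a) \<in> smooth_funs M W"
  unfolding smooth_funs_def by (auto simp: o_def)

lemma smooth_funs_add:
  assumes "smooth_manifold M" "openin (mtop M) W" "f \<in> smooth_funs M W" "h \<in> smooth_funs M W"
  shows "(\<lambda>x. f x + h x) \<in> smooth_funs M W"
  unfolding smooth_funs_def o_def
proof (intro CollectI ballI, clarify)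
  fix U c assume U: "(U, c) \<in> atlas M"
  show "smooth_on (c ` (U \<inter> W)) (\<lambda>x. f (inv_into U c x) + h (inv_into U c x))"
    using assms(3,4)[THEN smooth_funsD, OF U] chart_image_openin[OF assms(1) U assms(2)]
    by (intro smooth_on_add) (auto simp: o_def)
qed

lemma smooth_funs_mult:
  assumes "smooth_manifold M" "openin (mtop M) W" "f \<in> smooth_funs M W" "h \<in> smooth_funs M W"
  shows "(\<lambda>x. f x * h x) \<in> smooth_funs M W"
  unfolding smooth_funs_def o_def
proof (intro CollectI ballI, clarify)
  fix U c assume U: "(U, c) \<in> atlas M"
  show "smooth_on (c ` (U \<inter> W)) (\<lambda>x. f (inv_into U c x) * h (inv_into U c x))"
    using assms(3,4)[THEN smooth_funsD, OF U] chart_image_openin[OF assms(1) U assms(2)]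
    by (intro smooth_on_mult) (auto simp: o_def)
qed

lemma smooth_funs_diff:
  assumes "smooth_manifold M" "openin (mtop M) W" "f \<in> smooth_funs M W" "h \<in> smooth_funs M W"
  shows "(\<lambda>x. f x - h x) \<in> smooth_funs M W"
proof -
  have "(\<lambda>x. f x + (-1) * h x) \<in> smooth_funs M W"
    using assms by (intro smooth_funs_add smooth_funs_mult) auto
  then show ?thesis by simp
qed

lemma smooth_funs_sum:
  assumes "smooth_manifold M" "openin (mtop M) W" "\<And>i. i \<in> I \<Longrightarrow> f i \<in> smooth_funs M W"
  shows "(\<lambda>x. \<Sum>i\<in>I. f i x) \<in> smooth_funs M W"
  using assms(3) by (induction I rule: infinite_finite_induct) (auto intro: smooth_funs_add[OF assms(1,2)])

lemma smooth_funs_inverse: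
  assumes "smooth_manifold M" "openin (mtop M) W" "f \<in> smooth_funs M W" "\<And>q. q \<in> W \<Longrightarrow> f q \<noteq> 0"
  shows "(\<lambda>x. inverse (f x)) \<in> smooth_funs M W"
  unfolding smooth_funs_def o_def
proof (intro CollectI ballI, clarify)
  fix U c assume U: "(U, c) \<in> atlas M"
  show "smooth_on (c ` (U \<inter> W)) (\<lambda>x. inverse (f (inv_into U c x)))"
    using assms(3)[THEN smooth_funsD, OF U] chart_image_openin[OF assms(1) U assms(2)] assms(4) chart_inv[OF assms(1) U]
    by (intro smooth_on_inverse) (auto simp: o_def)
qed

lemma smooth_nearI: "openin (mtop M) W \<Longrightarrow> p \<in> W \<Longrightarrow> f \<in> smooth_funs M W \<Longrightarrow> smooth_near M p f"
  unfolding smooth_near_def by blast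

lemma smooth_near_const [simp]: "p \<in> carrier_of M \<Longrightarrow> smooth_near M p (\<lambda>x. a)"
  by (rule smooth_nearI[of _ "carrier_of M"]) auto

lemma smooth_near_carrier: "smooth_near M p f \<Longrightarrow> p \<in> carrier_of M"
  unfolding smooth_near_def using openin_mtop_subset by fastforce

lemma smooth_near_common:
  assumes "smooth_near M p f" "smooth_near M p h"
  obtains W where "openin (mtop M) W" "p \<in> W" "f \<in> smooth_funs M W" "h \<in> smooth_funs M W"
proof -
  obtain W1 W2 where "openin (mtop M) W1" "p \<in> W1" "f \<in> smooth_funs M W1"
    "openin (mtop M) W2" "p \<in> W2" "h \<in> smooth_funs M W2"
    using assms unfolding smooth_near_def by blast
  then show ?thesis using that[of "W1 \<inter> W2"] smooth_funs_subset[of f M W1 "W1 \<inter> W2"] smooth_funs_subset[of h M W2 "W1 \<inter> W2"]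
    by auto
qed

lemma smooth_near_add:
  assumes "smooth_manifold M" "smooth_near M p f" "smooth_near M p h"
  shows "smooth_near M p (\<lambda>x. f x + h x)"
  using smooth_near_common[OF assms(2,3)] smooth_funs_add[OF assms(1)] smooth_nearI by metis

lemma smooth_near_mult:
  assumes "smooth_manifold M" "smooth_near M p f" "smooth_near M p h"
  shows "smooth_near M p (\<lambda>x. f x * h x)"
  using smooth_near_common[OF assms(2,3)] smooth_funs_mult[OF assms(1)] smooth_nearI by metis

lemma smooth_near_diff:
  assumes "smooth_manifold M" "smooth_near M p f" "smooth_near M p h"
  shows "smooth_near M p (\<lambda>x. f x - h x)"
  using smooth_near_common[OF assms(2,3)] smooth_funs_diff[OF assms(1)] smooth_nearI by metis

lemma smooth_near_sum:
  assumes "smooth_manifold M" "p \<in> carrier_of M" "\<And>i. i \<in> I \<Longrightarrow> smooth_near M p (f i)"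
  shows "smooth_near M p (\<lambda>x. \<Sum>i\<in>I. f i x)"
  using assms(3) by (induction I rule: infinite_finite_induct) (auto intro: smooth_near_add[OF assms(1)] simp: assms(2))

lemma smooth_near_open:
  assumes "smooth_near M p f"
  obtains W where "openin (mtop M) W" "p \<in> W" "\<And>q. q \<in> W \<Longrightarrow> smooth_near M q f"
  using assms unfolding smooth_near_def by blast

lemma smooth_near_cong:
  assumes "smooth_manifold M" "smooth_near M p f" "openin (mtop M) W" "p \<in> W" "\<And>q. q \<in> W \<Longrightarrow> f q = h q"
  shows "smooth_near M p h"
proof -
  obtain W' where W': "openin (mtop M) W'" "p \<in> W'" "f \<in> smooth_funs M W'"
    using assms(2) unfolding smooth_near_def by blast
  have "h \<in> smooth_funs M (W \<inter> W')"
    by (rule smooth_funs_cong[OF assms(1), of _ f])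
       (use assms W' in \<open>auto intro: smooth_funs_subset\<close>)
  then show ?thesis using assms W' by (intro smooth_nearI[of _ "W \<inter> W'"]) auto
qed

lemma smooth_near_chart:
  assumes M: "smooth_manifold M" and f: "smooth_near M p f" and U: "(U, c) \<in> atlas M" "p \<in> U"
  obtains S where "open S" "c p \<in> S" "S \<subseteq> c ` U" "smooth_on S (f \<circ> inv_into U c)"
proof -
  obtain W where "openin (mtop M) W" "p \<in> W" "f \<in> smooth_funs M W"
    using f unfolding smooth_near_def by blast
  then show ?thesis
    using that[of "c ` (U \<inter> W)"] chart_image_openin[OF M U(1)] smooth_funsD U by blast
qed

lemma smooth_near_chart_derivative:
  assumes "smooth_manifold M" "smooth_near M p f" "(U, c) \<in> atlas M" "p \<in> U"
  shows "((f \<circ> inv_into U c) has_derivative frechet_derivative (f \<circ> inv_into U c) (at (c p))) (at (c p))"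
  by (rule smooth_near_chart[OF assms]) (blast intro: smooth_on_has_derivative)

lemma smooth_funs_chartI1:
  assumes M: "smooth_manifold M" and U: "(U, c) \<in> atlas M" and W: "openin (mtop M) W" "W \<subseteq> U"
    and "smooth_on (c ` W) (f \<circ> inv_into U c)"
  shows "f \<in> smooth_funs M W"
proof (rule smooth_funs_chartI[OF M])
  have "U \<inter> W = W" using W by auto
  then show "\<exists>U c W'. (U, c) \<in> atlas M \<and> openin (mtop M) W' \<and> p \<in> U \<and> p \<in> W' \<and>
       smooth_on (c ` (U \<inter> W')) (f \<circ> inv_into U c)" if "p \<in> W" for p
    using assms that by (intro exI[of _ U] exI[of _ c] exI[of _ W]) auto
qed

lemma smooth_funs_chart_comp:
  assumes M: "smooth_manifold M" and U: "(U, c) \<in> atlas M" and S: "open S" and k: "smooth_on S k"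
  shows "(\<lambda>q. k (c q)) \<in> smooth_funs M {q \<in> U. c q \<in> S}"
proof (rule smooth_funs_chartI1[OF M U chart_preimage_openin[OF M U S]])
  have o: "open (c ` {q \<in> U. c q \<in> S})"
    using chart_image_openin[OF M U chart_preimage_openin[OF M U S]] by (simp add: Int_def)
  have "smooth_on (c ` {q \<in> U. c q \<in> S}) k" by (rule smooth_on_subset[OF k]) auto
  then show "smooth_on (c ` {q \<in> U. c q \<in> S}) ((\<lambda>q. k (c q)) \<circ> inv_into U c)"
    by (rule smooth_on_cong[OF o, THEN iffD1, rotated]) (auto simp: chart_inv[OF M U])
qed auto

lemma smooth_funs_coordinate:
  assumes "smooth_manifold M" "(U, c) \<in> atlas M"
  shows "(\<lambda>q. c q \<bullet> b) \<in> smooth_funs M U"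
  using smooth_funs_chart_comp[OF assms open_UNIV, of "\<lambda>y. y \<bullet> b"]
  by (simp add: smooth_on_bounded_linear bounded_linear_inner_left)

lemma smooth_near_coordinate:
  assumes "smooth_manifold M" "(U, c) \<in> atlas M" "p \<in> U"
  shows "smooth_near M p (\<lambda>q. c q \<bullet> b)"
  using smooth_nearI[OF chart_openin assms(3) smooth_funs_coordinate] assms by blast

section \<open>Tangent vectors and vector fields\<close>

lemma tangent_lin:
  "D \<in> tangent_space M p \<Longrightarrow> smooth_near M p f \<Longrightarrow> smooth_near M p h \<Longrightarrow> D (\<lambda>x. a * f x + h x) = a * D f + D h"
  unfolding tangent_space_def by blast

lemma tangent_add:
  "D \<in> tangent_space M p \<Longrightarrow> smooth_near M p f \<Longrightarrow> smooth_near M p h \<Longrightarrow> D (\<lambda>x. f x + h x) = D f + D h"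
  using tangent_lin[of D M p f h 1] by simp

lemma tangent_leibniz:
  "D \<in> tangent_space M p \<Longrightarrow> smooth_near M p f \<Longrightarrow> smooth_near M p h \<Longrightarrow> D (\<lambda>x. f x * h x) = f p * D h + h p * D f"
  unfolding tangent_space_def by blast

lemma tangent_not_smooth: "D \<in> tangent_space M p \<Longrightarrow> \<not> smooth_near M p f \<Longrightarrow> D f = 0"
  unfolding tangent_space_def by blast

lemma tangent_const:
  assumes "D \<in> tangent_space M p" "p \<in> carrier_of M" shows "D (\<lambda>x. a) = 0"
proof -
  have 1: "D (\<lambda>x. 1) = 0" using tangent_leibniz[OF assms(1), of "\<lambda>x. 1" "\<lambda>x. 1"] assms(2) by simp
  have 0: "D (\<lambda>x. 0) = 0" using tangent_add[OF assms(1), of "\<lambda>x. 0" "\<lambda>x. 0"] assms(2) by simp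
  show ?thesis using tangent_lin[OF assms(1), of "\<lambda>x. 1" "\<lambda>x. 0" a] assms(2) 0 1 by simp
qed

lemma tangent_diff:
  assumes "D \<in> tangent_space M p" "smooth_near M p f" "smooth_near M p h"
  shows "D (\<lambda>x. f x - h x) = D f - D h"
  using tangent_lin[OF assms(1,3,2), of "-1"] by simp

lemma tangent_sum:
  assumes "smooth_manifold M" "D \<in> tangent_space M p" "p \<in> carrier_of M" "\<And>i. i \<in> I \<Longrightarrow> smooth_near M p (f i)"
  shows "D (\<lambda>x. \<Sum>i\<in>I. f i x) = (\<Sum>i\<in>I. D (f i))"
  using assms(4)
  by (induction I rule: infinite_finite_induct)
     (auto simp: tangent_const[OF assms(2,3)] tangent_add[OF assms(2)] smooth_near_sum[OF assms(1,3)])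

text \<open>Derivations depend on germs only: since functions are total, the indicator function of a
  neighbourhood is smooth near the point and can be used in place of a bump function.\<close>

lemma tangent_cong:
  assumes M: "smooth_manifold M" and D: "D \<in> tangent_space M p" and W: "openin (mtop M) W" "p \<in> W"
    and eq: "\<And>q. q \<in> W \<Longrightarrow> f q = h q"
  shows "D f = D h"
proof (cases "smooth_near M p f")
  case True
  have p: "p \<in> carrier_of M" using smooth_near_carrier[OF True] .
  have h: "smooth_near M p h" by (rule smooth_near_cong[OF M True W eq])
  let ?i = "\<lambda>x. if x \<in> W then 1 else 0 :: real" and ?k = "\<lambda>x. f x - h x"
  have i: "smooth_near M p ?i"
    by (rule smooth_near_cong[OF M smooth_near_const[OF p, of 1] W]) auto
  have k: "smooth_near M p ?k" by (rule smooth_near_diff[OF M True h])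
  have "(\<lambda>x. ?i x * ?k x) = (\<lambda>x. 0)" using eq by auto
  then have "D (\<lambda>x. ?i x * ?k x) = 0" using tangent_const[OF D p] by simp
  then have "D ?k = 0" using tangent_leibniz[OF D i k] W eq by simp
  then show ?thesis using tangent_diff[OF D True h] by simp
next
  case False
  moreover have "\<not> smooth_near M p h"
    using False smooth_near_cong[OF M _ W, of h f] eq by auto
  ultimately show ?thesis using tangent_not_smooth[OF D] by simp
qed

lemma tangent_space_zero [simp]: "0 \<in> tangent_space M p"
  by (simp add: tangent_space_def)

lemma tangent_space_add:
  "D \<in> tangent_space M p \<Longrightarrow> E \<in> tangent_space M p \<Longrightarrow> D + E \<in> tangent_space M p"
  unfolding tangent_space_def by (auto simp: algebra_simps)

lemma tangent_space_scaleR: "D \<in> tangent_space M p \<Longrightarrow> a *\<^sub>R D \<in> tangent_space M p"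
  unfolding tangent_space_def by (auto simp: scaleR_fun_def algebra_simps)

lemma tangent_space_subspace: "subspace (tangent_space M p)"
  by (auto intro!: subspaceI tangent_space_add tangent_space_scaleR)

lemma tangent_space_diff:
  "D \<in> tangent_space M p \<Longrightarrow> E \<in> tangent_space M p \<Longrightarrow> D - E \<in> tangent_space M p"
  using subspace_diff[OF tangent_space_subspace] .

lemma tangent_space_uminus: "D \<in> tangent_space M p \<Longrightarrow> - D \<in> tangent_space M p"
  using subspace_neg[OF tangent_space_subspace] .

lemma tangent_space_sum: "(\<And>i. i \<in> I \<Longrightarrow> D i \<in> tangent_space M p) \<Longrightarrow> (\<Sum>i\<in>I. D i) \<in> tangent_space M p"
  using subspace_sum[OF tangent_space_subspace] .

lemma sum_fun_apply: "(\<Sum>i\<in>I. D i) f = (\<Sum>i\<in>I. D i f)"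
  by (induction I rule: infinite_finite_induct) auto

lemma scaleR_fun_apply [simp]: "(a *\<^sub>R D) f = a *\<^sub>R D f"
  by (simp add: scaleR_fun_def)

text \<open>The image of \<open>v\<close> under the differential of the inverse chart, as a derivation.\<close>

definition coord_vec :: "('a, 'e::euclidean_space) mfd \<Rightarrow> 'a set \<Rightarrow> ('a \<Rightarrow> 'e) \<Rightarrow> 'a \<Rightarrow> 'e \<Rightarrow> 'a tvec"
  where "coord_vec M U c p v = (\<lambda>f. if smooth_near M p f
     then frechet_derivative (f \<circ> inv_into U c) (at (c p)) v else 0)"

lemma coord_vec_tangent:
  assumes M: "smooth_manifold M" and U: "(U, c) \<in> atlas M" "p \<in> U"
  shows "coord_vec M U c p v \<in> tangent_space M p"
  unfolding tangent_space_def
proof (intro CollectI conjI allI impI)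
  fix f h :: "'a \<Rightarrow> real" and a :: real assume f: "smooth_near M p f" and h: "smooth_near M p h"
  note df = smooth_near_chart_derivative[OF M f U] and dh = smooth_near_chart_derivative[OF M h U]
  have "smooth_near M p (\<lambda>x. a * f x + h x)"
    using f h smooth_near_carrier[OF f] by (intro smooth_near_add[OF M] smooth_near_mult[OF M]) auto
  moreover have "((\<lambda>x. a * f x + h x) \<circ> inv_into U c has_derivative
     (\<lambda>v. a * frechet_derivative (f \<circ> inv_into U c) (at (c p)) v + frechet_derivative (h \<circ> inv_into U c) (at (c p)) v)) (at (c p))"
    using has_derivative_add[OF has_derivative_mult_right[OF df] dh, of a] by (simp add: o_def)
  ultimately show "coord_vec M U c p v (\<lambda>x. a * f x + h x) = a * coord_vec M U c p v f + coord_vec M U c p v h"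
    using f h by (simp add: coord_vec_def frechet_derivative_has_derivative)
  have "smooth_near M p (\<lambda>x. f x * h x)" by (rule smooth_near_mult[OF M f h])
  moreover have "((\<lambda>x. f x * h x) \<circ> inv_into U c has_derivative
     (\<lambda>v. f p * frechet_derivative (h \<circ> inv_into U c) (at (c p)) v + frechet_derivative (f \<circ> inv_into U c) (at (c p)) v * h p)) (at (c p))"
    using has_derivative_mult[OF df dh] chart_inv[OF M U] by (simp add: o_def)
  ultimately show "coord_vec M U c p v (\<lambda>x. f x * h x) = f p * coord_vec M U c p v h + h p * coord_vec M U c p v f"
    using f h by (simp add: coord_vec_def frechet_derivative_has_derivative mult.commute)
qed (simp add: coord_vec_def)

text \<open>Hadamard's lemma writes a function as a constant plus products of functions vanishing at the
  point with smooth functions, so that a derivation is determined by its values on coordinates.\<close>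

lemma tangent_coordinates:
  assumes M: "smooth_manifold M" and U: "(U, c) \<in> atlas M" "p \<in> U"
    and D: "D \<in> tangent_space M p" and f: "smooth_near M p f"
  shows "D f = (\<Sum>b\<in>Basis. D (\<lambda>q. c q \<bullet> b) * frechet_derivative (f \<circ> inv_into U c) (at (c p)) b)"
proof -
  have p: "p \<in> carrier_of M" using smooth_near_carrier[OF f] .
  obtain S where S: "open S" "c p \<in> S" "S \<subseteq> c ` U" "smooth_on S (f \<circ> inv_into U c)"
    using smooth_near_chart[OF M f U] .
  obtain r where r: "r > 0" "ball (c p) r \<subseteq> S" using S openE by blast
  have sm: "smooth_on (ball (c p) r) (f \<circ> inv_into U c)" using S(4) r(2) smooth_on_subset by blast
  obtain h where h: "\<And>b. smooth_on (ball (c p) r) (h b)"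
    "\<And>b. h b (c p) = frechet_derivative (f \<circ> inv_into U c) (at (c p)) b"
    "\<And>x. x \<in> ball (c p) r \<Longrightarrow> (f \<circ> inv_into U c) x = (f \<circ> inv_into U c) (c p) + (\<Sum>b\<in>Basis. ((x - c p) \<bullet> b) * h b x)"
    using hadamard[OF sm r(1)] by blast
  define W where "W = {q \<in> U. c q \<in> ball (c p) r}"
  have W: "openin (mtop M) W" "p \<in> W"
    using chart_preimage_openin[OF M U(1) open_ball] r U by (auto simp: W_def)
  have H: "smooth_near M p (\<lambda>q. h b (c q))" for b
    using smooth_nearI[OF W] smooth_funs_chart_comp[OF M U(1) open_ball h(1)] by (simp add: W_def)
  have X: "smooth_near M p (\<lambda>q. c q \<bullet> b)" for b by (rule smooth_near_coordinate[OF M U])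
  have Xp: "smooth_near M p (\<lambda>q. c q \<bullet> b - c p \<bullet> b)" for b
    by (intro smooth_near_diff[OF M] X smooth_near_const p)
  have DX: "D (\<lambda>q. c q \<bullet> b - c p \<bullet> b) = D (\<lambda>q. c q \<bullet> b)" for b
    using tangent_diff[OF D X smooth_near_const[OF p]] tangent_const[OF D p] by simp
  have "D f = D (\<lambda>q. f p + (\<Sum>b\<in>Basis. (c q \<bullet> b - c p \<bullet> b) * h b (c q)))"
  proof (rule tangent_cong[OF M D W])
    fix q assume "q \<in> W"
    then show "f q = f p + (\<Sum>b\<in>Basis. (c q \<bullet> b - c p \<bullet> b) * h b (c q))"
      using h(3)[of "c q"] chart_inv[OF M U(1)] U(2) by (auto simp: W_def inner_diff_left)
  qed
  also have "\<dots> = D (\<lambda>q. f p) + D (\<lambda>q. \<Sum>b\<in>Basis. (c q \<bullet> b - c p \<bullet> b) * h b (c q))"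
    by (intro tangent_add[OF D] smooth_near_const[OF p] smooth_near_sum[OF M p] smooth_near_mult[OF M] Xp H)
  also have "\<dots> = (\<Sum>b\<in>Basis. D (\<lambda>q. (c q \<bullet> b - c p \<bullet> b) * h b (c q)))"
    by (simp add: tangent_const[OF D p] tangent_sum[OF M D p] smooth_near_mult[OF M] Xp H)
  also have "\<dots> = (\<Sum>b\<in>Basis. D (\<lambda>q. c q \<bullet> b) * frechet_derivative (f \<circ> inv_into U c) (at (c p)) b)"
    by (intro sum.cong refl) (simp add: tangent_leibniz[OF D Xp H] DX h(2))
  finally show ?thesis .
qed

lemma tangent_frechet:
  assumes M: "smooth_manifold M" and U: "(U, c) \<in> atlas M" "p \<in> U"
    and D: "D \<in> tangent_space M p" and f: "smooth_near M p f"
  shows "D f = frechet_derivative (f \<circ> inv_into U c) (at (c p)) (\<Sum>b\<in>Basis. D (\<lambda>q. c q \<bullet> b) *\<^sub>R b)"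
proof -
  have lin: "linear (frechet_derivative (f \<circ> inv_into U c) (at (c p)))"
    using smooth_near_chart_derivative[OF M f U] has_derivative_linear by blast
  show ?thesis
    unfolding tangent_coordinates[OF M U D f] linear_sum[OF lin] linear_cmul[OF lin] by simp
qed

lemma coord_vec_coordinate:
  assumes M: "smooth_manifold M" and U: "(U, c) \<in> atlas M" "p \<in> U"
  shows "coord_vec M U c p v (\<lambda>q. c q \<bullet> b) = v \<bullet> b"
proof -
  have "((\<lambda>y. y \<bullet> b) has_derivative (\<lambda>v. v \<bullet> b)) (at (c p))" by (auto intro!: derivative_eq_intros)
  then have "((\<lambda>q. c q \<bullet> b) \<circ> inv_into U c has_derivative (\<lambda>v. v \<bullet> b)) (at (c p))"
    by (rule has_derivative_transform_within_open[OF _ chart_image_open[OF M U(1)]])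
       (use U in \<open>auto simp: chart_inv[OF M U(1)]\<close>)
  then show ?thesis
    using smooth_near_coordinate[OF M U] by (simp add: coord_vec_def frechet_derivative_has_derivative)
qed

lemma coord_vec_expand:
  assumes M: "smooth_manifold M" and U: "(U, c) \<in> atlas M" "p \<in> U" and D: "D \<in> tangent_space M p"
  shows "D = (\<Sum>b\<in>Basis. D (\<lambda>q. c q \<bullet> b) *\<^sub>R coord_vec M U c p b)"
proof
  fix f
  show "D f = (\<Sum>b\<in>Basis. D (\<lambda>q. c q \<bullet> b) *\<^sub>R coord_vec M U c p b) f"
    using tangent_coordinates[OF M U D, of f] tangent_not_smooth[OF D, of f]
    by (cases "smooth_near M p f") (simp_all add: sum_fun_apply coord_vec_def)
qed

lemma vector_fields_tangent: "X \<in> vector_fields M \<Longrightarrow> p \<in> carrier_of M \<Longrightarrow> X p \<in> tangent_space M p"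
  unfolding vector_fields_def by blast

lemma vector_fields_smooth:
  "X \<in> vector_fields M \<Longrightarrow> openin (mtop M) W \<Longrightarrow> f \<in> smooth_funs M W \<Longrightarrow> (\<lambda>p. X p f) \<in> smooth_funs M W"
  unfolding vector_fields_def by blast

lemma vector_fields_smooth_near:
  "X \<in> vector_fields M \<Longrightarrow> smooth_near M p f \<Longrightarrow> smooth_near M p (\<lambda>q. X q f)"
  unfolding smooth_near_def using vector_fields_smooth by blast

text \<open>Applied to a function, a field is the sum of its components times partial derivatives; hence smooth
  components with respect to one chart near each point suffice.\<close>

lemma vector_fieldsI:
  assumes M: "smooth_manifold M" and T: "\<And>p. p \<in> carrier_of M \<Longrightarrow> X p \<in> tangent_space M p"
    and loc: "\<And>p. p \<in> carrier_of M \<Longrightarrow> \<exists>U c W. (U, c) \<in> atlas M \<and> p \<in> U \<and> openin (mtop M) W \<and> p \<in> W \<and>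
       (\<forall>b\<in>Basis. (\<lambda>q. X q (\<lambda>x. c x \<bullet> b)) \<in> smooth_funs M W)"
  shows "X \<in> vector_fields M"
  unfolding vector_fields_def
proof (intro CollectI conjI ballI allI impI T)
  fix W f assume W: "openin (mtop M) W" and f: "f \<in> smooth_funs M W"
  show "(\<lambda>p. X p f) \<in> smooth_funs M W"
  proof (rule smooth_funs_localI[OF M])
    fix p assume p: "p \<in> W" "p \<in> carrier_of M"
    obtain U c W' where U: "(U, c) \<in> atlas M" "p \<in> U" and W': "openin (mtop M) W'" "p \<in> W'"
      and X: "\<And>b. b \<in> Basis \<Longrightarrow> (\<lambda>q. X q (\<lambda>x. c x \<bullet> b)) \<in> smooth_funs M W'" using loc[OF p(2)] by blast
    define V where "V = U \<inter> W \<inter> W'"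
    have V: "openin (mtop M) V" "p \<in> V" "V \<subseteq> U" "V \<subseteq> W" "V \<subseteq> W'"
      using chart_openin[OF M U(1)] W W' U p by (auto simp: V_def)
    have "(\<lambda>q. \<Sum>b\<in>Basis. X q (\<lambda>x. c x \<bullet> b) * frechet_derivative (f \<circ> inv_into U c) (at (c q)) b) \<in> smooth_funs M V"
    proof (intro smooth_funs_sum[OF M V(1)] smooth_funs_mult[OF M V(1)])
      fix b :: 'b assume "b \<in> Basis"
      then show "(\<lambda>q. X q (\<lambda>x. c x \<bullet> b)) \<in> smooth_funs M V" using X V smooth_funs_subset by blast
      have "smooth_on (c ` (U \<inter> W)) (\<lambda>y. frechet_derivative (f \<circ> inv_into U c) (at y) b)"
        by (rule smooth_on_frechet_derivative[OF smooth_funsD[OF f U(1)]])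
      from smooth_funs_chart_comp[OF M U(1) chart_image_openin[OF M U(1) W] this]
      show "(\<lambda>q. frechet_derivative (f \<circ> inv_into U c) (at (c q)) b) \<in> smooth_funs M V"
        by (rule smooth_funs_subset) (auto simp: V_def)
    qed
    then have "(\<lambda>p. X p f) \<in> smooth_funs M V"
    proof (rule smooth_funs_cong[OF M V(1), rotated])
      fix q assume q: "q \<in> V"
      then have "q \<in> W" "q \<in> U" using V by auto
      then have "smooth_near M q f" "q \<in> carrier_of M" "q \<in> U"
        using smooth_nearI[OF W _ f] openin_mtop_subset[OF W] by auto
      then show "(\<Sum>b\<in>Basis. X q (\<lambda>x. c x \<bullet> b) * frechet_derivative (f \<circ> inv_into U c) (at (c q)) b) = X q f"
        using tangent_coordinates[OF M U(1) _ T] by simp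
    qed
    then show "\<exists>W'. openin (mtop M) W' \<and> p \<in> W' \<and> (\<lambda>p. X p f) \<in> smooth_funs M W'" using V by blast
  qed
qed

lemma vector_fields_add:
  assumes "smooth_manifold M" "X \<in> vector_fields M" "Y \<in> vector_fields M"
  shows "(\<lambda>q. X q + Y q) \<in> vector_fields M"
  using assms unfolding vector_fields_def by (auto intro!: tangent_space_add smooth_funs_add)

lemma vector_fields_scaleR:
  assumes "smooth_manifold M" "X \<in> vector_fields M" "f \<in> smooth_funs M (carrier_of M)"
  shows "(\<lambda>q. f q *\<^sub>R X q) \<in> vector_fields M"
  using assms unfolding vector_fields_def
  by (auto intro!: tangent_space_scaleR smooth_funs_mult intro: smooth_funs_subset[OF assms(3) openin_mtop_subset])

lemma vector_fields_zero: "(\<lambda>q. 0) \<in> vector_fields M"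
  unfolding vector_fields_def by auto

lemma vector_fields_sum:
  assumes "smooth_manifold M" "\<And>i. i \<in> I \<Longrightarrow> X i \<in> vector_fields M"
  shows "(\<lambda>q. \<Sum>i\<in>I. X i q) \<in> vector_fields M"
  using assms(2) by (induction I rule: infinite_finite_induct) (auto simp: vector_fields_zero intro: vector_fields_add[OF assms(1)])

lemma vector_fields_diff:
  assumes "smooth_manifold M" "X \<in> vector_fields M" "Y \<in> vector_fields M"
  shows "(\<lambda>q. X q - Y q) \<in> vector_fields M"
proof -
  have "(\<lambda>q. X q + (\<lambda>q. -1) q *\<^sub>R Y q) \<in> vector_fields M"
    using assms by (intro vector_fields_add vector_fields_scaleR) auto
  then show ?thesis by simp
qed

lemma lie_bracket_apply:
  "smooth_near M p f \<Longrightarrow> lie_bracket M X Y p f = X p (\<lambda>q. Y q f) - Y p (\<lambda>q. X q f)"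
  by (simp add: lie_bracket_def)

text \<open>In the commutator the products of first derivatives, which spoil the Leibniz rule for the
  composition of two fields, are symmetric and cancel.\<close>

lemma lie_bracket_tangent:
  assumes M: "smooth_manifold M" and X: "X \<in> vector_fields M" and Y: "Y \<in> vector_fields M"
    and p: "p \<in> carrier_of M"
  shows "lie_bracket M X Y p \<in> tangent_space M p"
proof -
  have lin: "X p (\<lambda>q. Y q (\<lambda>x. a * f x + h x)) = a * X p (\<lambda>q. Y q f) + X p (\<lambda>q. Y q h)"
    and leib: "X p (\<lambda>q. Y q (\<lambda>x. f x * h x)) = f p * X p (\<lambda>q. Y q h) + Y p h * X p f
       + (h p * X p (\<lambda>q. Y q f) + Y p f * X p h)"
    if X: "X \<in> vector_fields M" and Y: "Y \<in> vector_fields M" and f: "smooth_near M p f" and h: "smooth_near M p h"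
    for X Y f h and a :: real
  proof -
    obtain W where W: "openin (mtop M) W" "p \<in> W" "f \<in> smooth_funs M W" "h \<in> smooth_funs M W"
      using smooth_near_common[OF f h] .
    have Wn: "smooth_near M q f" "smooth_near M q h" "Y q \<in> tangent_space M q" if "q \<in> W" for q
      using W that vector_fields_tangent[OF Y] openin_mtop_subset[OF W(1)] by (auto intro: smooth_nearI)
    note Xp = vector_fields_tangent[OF X p]
    note Yf = vector_fields_smooth_near[OF Y f] and Yh = vector_fields_smooth_near[OF Y h]
    have "X p (\<lambda>q. Y q (\<lambda>x. a * f x + h x)) = X p (\<lambda>q. a * Y q f + Y q h)"
      by (rule tangent_cong[OF M Xp W(1,2)]) (rule tangent_lin[OF Wn(3,1,2)])
    then show "X p (\<lambda>q. Y q (\<lambda>x. a * f x + h x)) = a * X p (\<lambda>q. Y q f) + X p (\<lambda>q. Y q h)"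
      using tangent_lin[OF Xp Yf Yh] by simp
    have "X p (\<lambda>q. Y q (\<lambda>x. f x * h x)) = X p (\<lambda>q. f q * Y q h + h q * Y q f)"
      by (rule tangent_cong[OF M Xp W(1,2)]) (rule tangent_leibniz[OF Wn(3,1,2)])
    also have "\<dots> = X p (\<lambda>q. f q * Y q h) + X p (\<lambda>q. h q * Y q f)"
      by (intro tangent_add[OF Xp] smooth_near_mult[OF M] f h Yf Yh)
    finally show "X p (\<lambda>q. Y q (\<lambda>x. f x * h x)) = f p * X p (\<lambda>q. Y q h) + Y p h * X p f
       + (h p * X p (\<lambda>q. Y q f) + Y p f * X p h)"
      using tangent_leibniz[OF Xp f Yh] tangent_leibniz[OF Xp h Yf] by simp
  qed
  show ?thesis unfolding tangent_space_def
  proof (intro CollectI conjI allI impI)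
    fix f h :: "'a \<Rightarrow> real" and a :: real assume f: "smooth_near M p f" and h: "smooth_near M p h"
    have "smooth_near M p (\<lambda>x. a * f x + h x)"
      using f h p by (intro smooth_near_add[OF M] smooth_near_mult[OF M]) auto
    then show "lie_bracket M X Y p (\<lambda>x. a * f x + h x) = a * lie_bracket M X Y p f + lie_bracket M X Y p h"
      using f h lin[OF X Y f h] lin[OF Y X f h] by (simp add: lie_bracket_apply algebra_simps)
    have "smooth_near M p (\<lambda>x. f x * h x)" using f h by (intro smooth_near_mult[OF M])
    then show "lie_bracket M X Y p (\<lambda>x. f x * h x) = f p * lie_bracket M X Y p h + h p * lie_bracket M X Y p f"
      using f h leib[OF X Y f h] leib[OF Y X f h] by (simp add: lie_bracket_apply algebra_simps)
  qed (simp add: lie_bracket_def)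
qed

section \<open>Bump functions, local frames and tensoriality\<close>

lemma smooth_funs_extend_zero:
  assumes M: "smooth_manifold M" and K: "closedin (mtop M) K" "K \<subseteq> W" and W: "openin (mtop M) W"
    and f: "f \<in> smooth_funs M W" "\<And>q. q \<notin> K \<Longrightarrow> f q = 0"
  shows "f \<in> smooth_funs M (carrier_of M)"
proof (rule smooth_funs_localI[OF M])
  fix p assume p: "p \<in> carrier_of M"
  show "\<exists>W'. openin (mtop M) W' \<and> p \<in> W' \<and> f \<in> smooth_funs M W'"
  proof (cases "p \<in> K")
    case True then show ?thesis using W K f by blast
  next
    case False
    have o: "openin (mtop M) (carrier_of M - K)" using K by (simp add: carrier_of_def openin_diff)
    have "f \<in> smooth_funs M (carrier_of M - K)"
      by (rule smooth_funs_cong[OF M o _ smooth_funs_const[of 0]]) (use f in auto)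
    then show ?thesis using o p False by blast
  qed
qed

text \<open>A bump function of Euclidean space in a chart, extended by zero. Its support \<open>K\<close> is compact, hence
  closed because the manifold is a Hausdorff space, so the extension is smooth.\<close>

lemma manifold_bump_exists:
  assumes M: "smooth_manifold M" and U: "(U, c) \<in> atlas M" "p \<in> U"
    and W: "openin (mtop M) W" "p \<in> W"
  obtains \<kappa> V K where "\<kappa> \<in> smooth_funs M (carrier_of M)" "openin (mtop M) V" "p \<in> V" "V \<subseteq> K"
    "closedin (mtop M) K" "K \<subseteq> U \<inter> W" "\<And>q. q \<in> V \<Longrightarrow> \<kappa> q = 1" "\<And>q. q \<notin> K \<Longrightarrow> \<kappa> q = 0"
proof -
  have "open (c ` (U \<inter> W))" "c p \<in> c ` (U \<inter> W)" using chart_image_openin[OF M U(1) W(1)] U W by auto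
  then obtain r where r: "r > 0" "cball (c p) r \<subseteq> c ` (U \<inter> W)" using open_contains_cball by blast
  obtain B where B: "smooth_on UNIV B" "\<And>x. dist (c p) x \<le> r / 2 \<Longrightarrow> B x = 1" "\<And>x. dist (c p) x \<ge> r \<Longrightarrow> B x = (0::real)"
    using smooth_bump_exists[OF r(1)] by metis
  define K where "K = {q \<in> U. c q \<in> cball (c p) r}"
  define V where "V = {q \<in> U. c q \<in> ball (c p) (r/2)}"
  define \<kappa> where "\<kappa> q = (if q \<in> U then B (c q) else 0)" for q
  have "K = inv_into U c ` cball (c p) r"
  proof (intro equalityI subsetI)
    fix q assume "q \<in> K"
    then show "q \<in> inv_into U c ` cball (c p) r"
      using chart_inv[OF M U(1)] by (auto simp: K_def intro!: image_eqI[of _ _ "c q"])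
  next
    fix q assume "q \<in> inv_into U c ` cball (c p) r"
    then obtain y where y: "y \<in> cball (c p) r" "q = inv_into U c y" by auto
    then have "y \<in> c ` U" using r by auto
    then show "q \<in> K" using y by (auto simp: K_def f_inv_into_f inv_into_into simp del: mem_cball)
  qed
  moreover have "compactin (top_of_set (c ` U)) (cball (c p) r)"
    using r by (auto simp: compactin_subtopology)
  ultimately have "compactin (mtop M) K"
    using image_compactin chart_inv_continuous[OF M U(1)] by metis
  then have K: "closedin (mtop M) K"
    using M unfolding smooth_manifold_def by (simp add: compactin_imp_closedin)
  have KW: "K \<subseteq> U \<inter> W"
  proof
    fix q assume q: "q \<in> K"
    then obtain q' where "q' \<in> U \<inter> W" "c q = c q'" using r by (auto simp: K_def simp del: mem_cball)
    then show "q \<in> U \<inter> W" using q inj_onD[OF chart_inj[OF M U(1)], of q q'] by (auto simp: K_def)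
  qed
  show ?thesis
  proof (rule that[of \<kappa> V K])
    show "openin (mtop M) V" unfolding V_def by (rule chart_preimage_openin[OF M U(1) open_ball])
    show \<kappa>0: "\<kappa> q = 0" if "q \<notin> K" for q using that B(3)[of "c q"] by (auto simp: \<kappa>_def K_def)
    have "(\<lambda>q. B (c q)) \<in> smooth_funs M U"
      using smooth_funs_chart_comp[OF M U(1) open_UNIV B(1)] by simp
    then have "\<kappa> \<in> smooth_funs M U"
      by (rule smooth_funs_cong[OF M chart_openin[OF M U(1)], rotated]) (simp add: \<kappa>_def)
    then show "\<kappa> \<in> smooth_funs M (carrier_of M)"
      using smooth_funs_extend_zero[OF M K _ chart_openin[OF M U(1)]] KW \<kappa>0 by blast
  qed (use r U B K KW in \<open>auto simp: V_def K_def \<kappa>_def\<close>)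
qed

text \<open>Fields \<open>e b\<close> that are the coordinate fields of the functions \<open>x b\<close> on \<open>W\<close>, cut off by \<open>\<kappa>\<close>.
  The cut-off is squared in \<open>spread\<close>: one factor makes the fields global, one the coefficients.\<close>

locale local_frame =
  fixes M :: "('a, 'e::euclidean_space) mfd" and p :: 'a and W :: "'a set"
    and e :: "'e \<Rightarrow> 'a vfield" and x :: "'e \<Rightarrow> 'a \<Rightarrow> real" and \<kappa> :: "'a \<Rightarrow> real"
  assumes M: "smooth_manifold M"
    and W: "openin (mtop M) W" and pW: "p \<in> W"
    and e_field: "e b \<in> vector_fields M"
    and x_smooth: "x b \<in> smooth_funs M W"
    and e_x: "q \<in> W \<Longrightarrow> b \<in> Basis \<Longrightarrow> b' \<in> Basis \<Longrightarrow> e b q (x b') = (if b = b' then 1 else 0)"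
    and expand: "q \<in> W \<Longrightarrow> u \<in> tangent_space M q \<Longrightarrow> u = (\<Sum>b\<in>Basis. u (x b) *\<^sub>R e b q)"
    and \<kappa>_smooth: "\<kappa> \<in> smooth_funs M (carrier_of M)" and \<kappa>_p: "\<kappa> p = 1"
    and spread: "X \<in> vector_fields M \<Longrightarrow> \<exists>f. (\<forall>b. f b \<in> smooth_funs M (carrier_of M) \<and> f b p = X p (x b)) \<and>
      (\<forall>q. (\<kappa> q)\<^sup>2 *\<^sub>R X q = (\<Sum>b\<in>Basis. f b q *\<^sub>R e b q))"

lemma local_frame_exists:
  fixes M :: "('a, 'e::euclidean_space) mfd"
  assumes M: "smooth_manifold M" and p: "p \<in> carrier_of M"
  obtains W e x \<kappa> where "local_frame M p W e x \<kappa>"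
proof -
  obtain U c where U: "(U, c) \<in> atlas M" "p \<in> U" using chart_at[OF M p] .
  note Uo = chart_openin[OF M U(1)]
  obtain \<kappa> V K where \<kappa>: "\<kappa> \<in> smooth_funs M (carrier_of M)" and V: "openin (mtop M) V" "p \<in> V" "V \<subseteq> K"
    and K: "closedin (mtop M) K" "K \<subseteq> U" and \<kappa>1: "\<And>q. q \<in> V \<Longrightarrow> \<kappa> q = 1" and \<kappa>0: "\<And>q. q \<notin> K \<Longrightarrow> \<kappa> q = 0"
    using manifold_bump_exists[OF M U Uo U(2)] by (metis Int_absorb)
  have VU: "V \<subseteq> U" using V K by auto
  have \<kappa>U: "\<kappa> \<in> smooth_funs M U" using smooth_funs_subset[OF \<kappa> chart_subset[OF M U(1)]] .
  define e where "e b q = \<kappa> q *\<^sub>R coord_vec M U c q b" for b q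
  define x where "x b q = c q \<bullet> b" for b q
  have e_vf: "e b \<in> vector_fields M" for b
  proof (rule vector_fieldsI[OF M])
    fix q assume q: "q \<in> carrier_of M"
    show "e b q \<in> tangent_space M q"
    proof (cases "q \<in> U")
      case True
      then show ?thesis unfolding e_def by (intro tangent_space_scaleR coord_vec_tangent[OF M U(1)])
    next
      case False
      then have "\<kappa> q = 0" using \<kappa>0[of q] K by blast
      then show ?thesis unfolding e_def by (simp only: scaleR_zero_left tangent_space_zero)
    qed
    show "\<exists>U c W. (U, c) \<in> atlas M \<and> q \<in> U \<and> openin (mtop M) W \<and> q \<in> W \<and>
       (\<forall>b'\<in>Basis. (\<lambda>q. e b q (\<lambda>x. c x \<bullet> b')) \<in> smooth_funs M W)"
    proof (cases "q \<in> U")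
      case True
      have e0: "(\<lambda>q. \<kappa> q * (b \<bullet> b')) \<in> smooth_funs M U" for b'
        by (intro smooth_funs_mult[OF M Uo] \<kappa>U) simp
      have "(\<lambda>q. e b q (\<lambda>x. c x \<bullet> b')) \<in> smooth_funs M U" for b'
        by (rule smooth_funs_cong[OF M Uo _ e0[of b']]) (simp add: e_def coord_vec_coordinate[OF M U(1)])
      then show ?thesis using True U Uo by blast
    next
      case False
      obtain U' c' where U': "(U', c') \<in> atlas M" "q \<in> U'" using chart_at[OF M q] .
      have o: "openin (mtop M) (carrier_of M - K)" using K by (simp add: carrier_of_def openin_diff)
      have "(\<lambda>q. e b q (\<lambda>x. c' x \<bullet> b')) \<in> smooth_funs M (carrier_of M - K)" for b'
        by (rule smooth_funs_cong[OF M o _ smooth_funs_const[of 0]]) (use \<kappa>0 in \<open>auto simp: e_def\<close>)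
      then show ?thesis using U' o q False K by blast
    qed
  qed
  have xU: "x b \<in> smooth_funs M U" for b unfolding x_def by (rule smooth_funs_coordinate[OF M U(1)])
  have "local_frame M p V e x \<kappa>"
  proof
    fix X assume X: "X \<in> vector_fields M"
    have f: "(\<lambda>q. \<kappa> q * X q (x b)) \<in> smooth_funs M (carrier_of M)" for b
      by (rule smooth_funs_extend_zero[OF M K Uo])
         (use \<kappa>0 in \<open>auto intro!: smooth_funs_mult[OF M Uo] \<kappa>U vector_fields_smooth[OF X Uo] xU\<close>)
    have "(\<kappa> q)\<^sup>2 *\<^sub>R X q = (\<Sum>b\<in>Basis. (\<kappa> q * X q (x b)) *\<^sub>R e b q)" for q
    proof (cases "q \<in> U")
      case True
      then have "X q \<in> tangent_space M q" using vector_fields_tangent[OF X] chart_subset[OF M U(1)] by auto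
      from coord_vec_expand[OF M U(1) True this]
      have "(\<kappa> q)\<^sup>2 *\<^sub>R X q = (\<kappa> q)\<^sup>2 *\<^sub>R (\<Sum>b\<in>Basis. X q (x b) *\<^sub>R coord_vec M U c q b)"
        by (simp add: x_def[abs_def])
      then show ?thesis by (simp add: e_def scaleR_sum_right power2_eq_square mult_ac)
    next
      case False
      then have "\<kappa> q = 0" using \<kappa>0[of q] K by blast
      then show ?thesis by simp
    qed
    then show "\<exists>f. (\<forall>b. f b \<in> smooth_funs M (carrier_of M) \<and> f b p = X p (x b)) \<and>
      (\<forall>q. (\<kappa> q)\<^sup>2 *\<^sub>R X q = (\<Sum>b\<in>Basis. f b q *\<^sub>R e b q))"
      using f \<kappa>1[OF V(2)] by (intro exI[of _ "\<lambda>b q. \<kappa> q * X q (x b)"]) simp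
  next
    fix q u assume q: "q \<in> V" and u: "u \<in> tangent_space M q"
    show "u = (\<Sum>b\<in>Basis. u (x b) *\<^sub>R e b q)"
      using coord_vec_expand[OF M U(1) _ u] q VU \<kappa>1[OF q] by (auto simp: e_def x_def[abs_def])
  next
    fix q and b b' :: 'e assume "q \<in> V" "b \<in> Basis" "b' \<in> Basis"
    then show "e b q (x b') = (if b = b' then 1 else 0)"
      using VU \<kappa>1[of q] coord_vec_coordinate[OF M U(1), of q b b'] by (auto simp: e_def x_def[abs_def] inner_Basis)
  qed (use M V \<kappa> \<kappa>1 e_vf smooth_funs_subset[OF xU VU] in auto)
  then show ?thesis by (rule that)
qed

context local_frame begin

lemma carrier: "q \<in> W \<Longrightarrow> q \<in> carrier_of M"
  using openin_mtop_subset[OF W] by auto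

lemma x_near: "q \<in> W \<Longrightarrow> smooth_near M q (x b)"
  using smooth_nearI[OF W _ x_smooth] by auto

lemma e_tangent: "q \<in> W \<Longrightarrow> e b q \<in> tangent_space M q"
  using vector_fields_tangent[OF e_field carrier] .

text \<open>Coordinate fields commute, because they map coordinates to constants.\<close>

lemma bracket_zero:
  assumes q: "q \<in> W" and b: "b \<in> Basis" "b' \<in> Basis" shows "lie_bracket M (e b) (e b') q = 0"
proof -
  have 0: "e b q (\<lambda>r. e b' r (x b'')) = 0" if "b \<in> Basis" "b' \<in> Basis" "b'' \<in> Basis" for b b' b''
  proof -
    have "e b q (\<lambda>r. e b' r (x b'')) = e b q (\<lambda>r. if b' = b'' then 1 else 0)"
      by (rule tangent_cong[OF M e_tangent[OF q] W q]) (use e_x that in simp)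
    then show ?thesis using tangent_const[OF e_tangent[OF q] carrier[OF q]] by simp
  qed
  have "lie_bracket M (e b) (e b') q (x b'') = 0" if "b'' \<in> Basis" for b''
    using lie_bracket_apply[OF x_near[OF q]] 0 b that by simp
  then show ?thesis
    using expand[OF q lie_bracket_tangent[OF M e_field e_field carrier[OF q], of b b']] by simp
qed

lemma field_through:
  assumes "u \<in> tangent_space M p"
  obtains X where "X \<in> vector_fields M" "X p = u"
proof (rule that[of "\<lambda>q. \<Sum>b\<in>Basis. (\<lambda>_. u (x b)) q *\<^sub>R e b q"])
  show "(\<lambda>q. \<Sum>b\<in>Basis. (\<lambda>_. u (x b)) q *\<^sub>R e b q) \<in> vector_fields M"
    by (intro vector_fields_sum[OF M] vector_fields_scaleR[OF M] e_field) simp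
qed (use expand[OF pW assms] in simp)

definition coords :: "'a tvec \<Rightarrow> 'e"
  where "coords u = (\<Sum>b\<in>Basis. u (x b) *\<^sub>R b)"

definition comb :: "'a \<Rightarrow> 'e \<Rightarrow> 'a tvec"
  where "comb q a = (\<Sum>b\<in>Basis. (a \<bullet> b) *\<^sub>R e b q)"

lemma comb_tangent: "q \<in> W \<Longrightarrow> comb q a \<in> tangent_space M q"
  unfolding comb_def by (intro tangent_space_sum tangent_space_scaleR e_tangent)

lemma coords_inner: "b \<in> Basis \<Longrightarrow> coords u \<bullet> b = u (x b)"
  by (simp add: coords_def)

lemma comb_x: "q \<in> W \<Longrightarrow> b \<in> Basis \<Longrightarrow> comb q a (x b) = a \<bullet> b"
  by (simp add: comb_def sum_fun_apply e_x if_distrib[of "\<lambda>x. _ * x"] cong: if_cong)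

lemma coords_comb: "q \<in> W \<Longrightarrow> coords (comb q a) = a"
  by (rule euclidean_eqI) (simp add: coords_inner comb_x)

lemma comb_coords:
  assumes "q \<in> W" "u \<in> tangent_space M q" shows "comb q (coords u) = u"
proof -
  have "comb q (coords u) = (\<Sum>b\<in>Basis. u (x b) *\<^sub>R e b q)"
    unfolding comb_def by (intro sum.cong refl) (simp add: coords_inner)
  then show ?thesis using expand[OF assms] by simp
qed

lemma coords_add: "coords (u + v) = coords u + coords v"
  by (simp add: coords_def scaleR_add_left sum.distrib)

lemma coords_scaleR: "coords (r *\<^sub>R u) = r *\<^sub>R coords u"
  by (simp add: coords_def scaleR_sum_right)

lemma comb_add: "comb q (a + b) = comb q a + comb q b"
  unfolding comb_def inner_add_left scaleR_add_left sum.distrib ..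

lemma comb_scaleR: "comb q (r *\<^sub>R a) = r *\<^sub>R comb q a"
  unfolding comb_def inner_scaleR_left scaleR_sum_right scaleR_scaleR ..

end

lemma field_through:
  assumes "smooth_manifold M" "p \<in> carrier_of M" "u \<in> tangent_space M p"
  obtains X where "X \<in> vector_fields M" "X p = u"
  using local_frame_exists[OF assms(1,2)] local_frame.field_through[OF _ assms(3)] by metis

text \<open>With the cut-off \<open>\<kappa>\<close> of a frame, \<open>X = (1 - \<kappa>\<^sup>2)X + (\<Sum>b. f b \<cdot> e b)\<close> holds everywhere, and all coefficients
  vanish at \<open>p\<close> if \<open>X\<close> does. A pointwise value therefore determines the value of a
  function-linear operator.\<close>

lemma tensorial_zero:
  fixes T :: "'a vfield \<Rightarrow> 'v::real_vector"
  assumes M: "smooth_manifold M" and p: "p \<in> carrier_of M"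
    and add: "\<And>X Y. X \<in> vector_fields M \<Longrightarrow> Y \<in> vector_fields M \<Longrightarrow> T (\<lambda>q. X q + Y q) = T X + T Y"
    and scale: "\<And>f X. f \<in> smooth_funs M (carrier_of M) \<Longrightarrow> X \<in> vector_fields M \<Longrightarrow> T (\<lambda>q. f q *\<^sub>R X q) = f p *\<^sub>R T X"
    and X: "X \<in> vector_fields M" "X p = 0"
  shows "T X = 0"
proof -
  obtain W e x \<kappa> where "local_frame M p W e x \<kappa>" using local_frame_exists[OF M p] .
  then interpret local_frame M p W e x \<kappa> .
  obtain f where f: "\<And>b. f b \<in> smooth_funs M (carrier_of M)" "\<And>b. f b p = X p (x b)"
    "\<And>q. (\<kappa> q)\<^sup>2 *\<^sub>R X q = (\<Sum>b\<in>Basis. f b q *\<^sub>R e b q)" using spread[OF X(1)] by blast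
  have fe: "(\<lambda>q. f b q *\<^sub>R e b q) \<in> vector_fields M" for b by (intro vector_fields_scaleR[OF M] e_field f)
  have T0: "T (\<lambda>q. 0) = 0" using scale[of "\<lambda>q. 0" X] X by simp
  have "T (\<lambda>q. \<Sum>b\<in>B. f b q *\<^sub>R e b q) = (\<Sum>b\<in>B. T (\<lambda>q. f b q *\<^sub>R e b q))" for B
    by (induction B rule: infinite_finite_induct)
       (simp_all only: simp_thms T0 sum.infinite sum.empty sum.insert add[OF fe vector_fields_sum[OF M fe]])
  moreover have "T (\<lambda>q. f b q *\<^sub>R e b q) = 0" for b
    using scale[OF f(1) e_field] f(2) X(2) by simp
  ultimately have Ts: "T (\<lambda>q. \<Sum>b\<in>Basis. f b q *\<^sub>R e b q) = 0" by simp
  have 1: "(\<lambda>q. 1 - \<kappa> q * \<kappa> q) \<in> smooth_funs M (carrier_of M)"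
    by (intro smooth_funs_diff[OF M] smooth_funs_mult[OF M] \<kappa>_smooth) auto
  have "X = (\<lambda>q. (1 - \<kappa> q * \<kappa> q) *\<^sub>R X q + (\<Sum>b\<in>Basis. f b q *\<^sub>R e b q))"
    unfolding f(3)[symmetric] power2_eq_square scaleR_left_diff_distrib by simp
  then have "T X = T (\<lambda>q. (1 - \<kappa> q * \<kappa> q) *\<^sub>R X q + (\<Sum>b\<in>Basis. f b q *\<^sub>R e b q))" by simp
  also have "\<dots> = T (\<lambda>q. (1 - \<kappa> q * \<kappa> q) *\<^sub>R X q) + T (\<lambda>q. \<Sum>b\<in>Basis. f b q *\<^sub>R e b q)"
    by (intro add vector_fields_scaleR[OF M X(1) 1] vector_fields_sum[OF M fe])
  finally show ?thesis using scale[OF 1 X(1)] Ts \<kappa>_p by simp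
qed

lemma tensorial_cong:
  fixes T :: "'a vfield \<Rightarrow> 'v::real_vector"
  assumes M: "smooth_manifold M" and p: "p \<in> carrier_of M"
    and add: "\<And>X Y. X \<in> vector_fields M \<Longrightarrow> Y \<in> vector_fields M \<Longrightarrow> T (\<lambda>q. X q + Y q) = T X + T Y"
    and scale: "\<And>f X. f \<in> smooth_funs M (carrier_of M) \<Longrightarrow> X \<in> vector_fields M \<Longrightarrow> T (\<lambda>q. f q *\<^sub>R X q) = f p *\<^sub>R T X"
    and X: "X \<in> vector_fields M" and Y: "Y \<in> vector_fields M" and eq: "X p = Y p"
  shows "T X = T Y"
proof -
  note d = vector_fields_diff[OF M X Y]
  have "T (\<lambda>q. X q - Y q) = 0" by (rule tensorial_zero[where T=T, OF M p add scale d]) (use eq in auto)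
  moreover have "T X = T (\<lambda>q. (X q - Y q) + Y q)" by simp
  ultimately show ?thesis using add[OF d Y] by simp
qed

lemma vector_fields_localI:
  assumes M: "smooth_manifold M" and T: "\<And>p. p \<in> carrier_of M \<Longrightarrow> X p \<in> tangent_space M p"
    and loc: "\<And>p. p \<in> carrier_of M \<Longrightarrow> \<exists>W e y. openin (mtop M) W \<and> p \<in> W \<and>
       (\<forall>b\<in>B. e b \<in> vector_fields M \<and> y b \<in> smooth_funs M W) \<and> (\<forall>q\<in>W. X q = (\<Sum>b\<in>B. y b q *\<^sub>R e b q))"
  shows "X \<in> vector_fields M"
  unfolding vector_fields_def
proof (intro CollectI conjI ballI allI impI T)
  fix W f assume W: "openin (mtop M) W" and f: "f \<in> smooth_funs M W"
  show "(\<lambda>p. X p f) \<in> smooth_funs M W"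
  proof (rule smooth_funs_localI[OF M])
    fix p assume p: "p \<in> W" "p \<in> carrier_of M"
    obtain W' e y where W': "openin (mtop M) W'" "p \<in> W'" and e: "\<And>b. b \<in> B \<Longrightarrow> e b \<in> vector_fields M"
      and y: "\<And>b. b \<in> B \<Longrightarrow> y b \<in> smooth_funs M W'" and X: "\<And>q. q \<in> W' \<Longrightarrow> X q = (\<Sum>b\<in>B. y b q *\<^sub>R e b q)"
      using loc[OF p(2)] by blast
    have V: "openin (mtop M) (W \<inter> W')" using W W' by auto
    have "(\<lambda>q. \<Sum>b\<in>B. y b q * e b q f) \<in> smooth_funs M (W \<inter> W')"
      using smooth_funs_subset[OF f, of "W \<inter> W'"] smooth_funs_subset[OF y, of _ "W \<inter> W'"]
      by (intro smooth_funs_sum[OF M V] smooth_funs_mult[OF M V] vector_fields_smooth[OF e V]) auto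
    then have "(\<lambda>p. X p f) \<in> smooth_funs M (W \<inter> W')"
      by (rule smooth_funs_cong[OF M V, rotated]) (auto simp: X sum_fun_apply)
    then show "\<exists>W'. openin (mtop M) W' \<and> p \<in> W' \<and> (\<lambda>p. X p f) \<in> smooth_funs M W'" using V p W' by blast
  qed
qed

section \<open>Metrics\<close>

lemma linear_map_onD:
  "linear_map_on S L \<Longrightarrow> u \<in> S \<Longrightarrow> v \<in> S \<Longrightarrow> L (a *\<^sub>R u + v) = a *\<^sub>R L u + L v"
  unfolding linear_map_on_def by blast

lemma linear_map_on_add: "linear_map_on S L \<Longrightarrow> u \<in> S \<Longrightarrow> v \<in> S \<Longrightarrow> L (u + v) = L u + L v"
  using linear_map_onD[of S L u v 1] by simp

lemma linear_map_on_zero: "linear_map_on S L \<Longrightarrow> 0 \<in> S \<Longrightarrow> L 0 = 0"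
  using linear_map_on_add[of S L 0 0] by simp

lemma linear_map_on_scaleR: "linear_map_on S L \<Longrightarrow> 0 \<in> S \<Longrightarrow> u \<in> S \<Longrightarrow> L (a *\<^sub>R u) = a *\<^sub>R L u"
  using linear_map_onD[of S L u 0 a] linear_map_on_zero[of S L] by simp

lemma linear_map_on_minus: "linear_map_on S L \<Longrightarrow> subspace S \<Longrightarrow> u \<in> S \<Longrightarrow> L (- u) = - L u"
  using linear_map_on_scaleR[of S L u "-1"] by (simp add: subspace_0)

lemma linear_map_on_diff:
  assumes "linear_map_on S L" "subspace S" "u \<in> S" "v \<in> S" shows "L (u - v) = L u - L v"
  using linear_map_on_add[OF assms(1,3) subspace_neg[OF assms(2,4)]] linear_map_on_minus[OF assms(1,2,4)] by simp

lemma linear_map_on_sum: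
  assumes "linear_map_on S L" "subspace S" "\<And>i. i \<in> I \<Longrightarrow> u i \<in> S"
  shows "L (\<Sum>i\<in>I. u i) = (\<Sum>i\<in>I. L (u i))"
  using assms(3)
  by (induction I rule: infinite_finite_induct)
     (auto simp: linear_map_on_zero[OF assms(1) subspace_0[OF assms(2)]] linear_map_on_add[OF assms(1)] subspace_sum[OF assms(2)])

text \<open>Common to metrics, which are symmetric, and fundamental forms, which are skew.\<close>

definition tensor2 :: "('a, 'e::euclidean_space) mfd \<Rightarrow> 'a form2 \<Rightarrow> bool"
  where "tensor2 M \<omega> \<longleftrightarrow>
    (\<forall>p\<in>carrier_of M. \<forall>u\<in>tangent_space M p. linear_map_on (tangent_space M p) (\<omega> p u) \<and>
       linear_map_on (tangent_space M p) (\<lambda>v. \<omega> p v u)) \<and>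
    (\<forall>X\<in>vector_fields M. \<forall>Y\<in>vector_fields M. (\<lambda>p. \<omega> p (X p) (Y p)) \<in> smooth_funs M (carrier_of M))"

lemma tensor2_linear:
  assumes "tensor2 M \<omega>" "p \<in> carrier_of M" "u \<in> tangent_space M p"
  shows "linear_map_on (tangent_space M p) (\<omega> p u)" "linear_map_on (tangent_space M p) (\<lambda>v. \<omega> p v u)"
  using assms unfolding tensor2_def by auto

lemma tensor2_smooth:
  "tensor2 M \<omega> \<Longrightarrow> X \<in> vector_fields M \<Longrightarrow> Y \<in> vector_fields M \<Longrightarrow> (\<lambda>p. \<omega> p (X p) (Y p)) \<in> smooth_funs M (carrier_of M)"
  unfolding tensor2_def by blast

lemma tensor2_expand:
  assumes \<omega>: "tensor2 M \<omega>" and p: "p \<in> carrier_of M"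
    and u: "\<And>i. i \<in> I \<Longrightarrow> u i \<in> tangent_space M p" and v: "\<And>j. j \<in> J \<Longrightarrow> v j \<in> tangent_space M p"
  shows "\<omega> p (\<Sum>i\<in>I. a i *\<^sub>R u i) (\<Sum>j\<in>J. b j *\<^sub>R v j) = (\<Sum>i\<in>I. \<Sum>j\<in>J. a i * b j * \<omega> p (u i) (v j))"
proof -
  note T = tangent_space_scaleR[OF u] tangent_space_scaleR[OF v]
  have "\<omega> p (\<Sum>i\<in>I. a i *\<^sub>R u i) (\<Sum>j\<in>J. b j *\<^sub>R v j) = (\<Sum>i\<in>I. \<omega> p (a i *\<^sub>R u i) (\<Sum>j\<in>J. b j *\<^sub>R v j))"
    by (rule linear_map_on_sum[OF tensor2_linear(2)[OF \<omega> p] tangent_space_subspace])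
       (auto intro: T tangent_space_sum)
  also have "\<dots> = (\<Sum>i\<in>I. \<Sum>j\<in>J. \<omega> p (a i *\<^sub>R u i) (b j *\<^sub>R v j))"
    by (intro sum.cong refl linear_map_on_sum[OF tensor2_linear(1)[OF \<omega> p] tangent_space_subspace] T)
  also have "\<dots> = (\<Sum>i\<in>I. \<Sum>j\<in>J. a i * b j * \<omega> p (u i) (v j))"
    using linear_map_on_scaleR[OF tensor2_linear(1)[OF \<omega> p T(1)] tangent_space_zero v]
      linear_map_on_scaleR[OF tensor2_linear(2)[OF \<omega> p v] tangent_space_zero u]
    by (intro sum.cong refl) simp
  finally show ?thesis .
qed

lemma metric_sym:
  "riemannian_metric M g \<Longrightarrow> p \<in> carrier_of M \<Longrightarrow> u \<in> tangent_space M p \<Longrightarrow> v \<in> tangent_space M p \<Longrightarrow> g p u v = g p v u"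
  unfolding riemannian_metric_def by blast

lemma metric_tensor2: "riemannian_metric M g \<Longrightarrow> tensor2 M g"
proof -
  assume g: "riemannian_metric M g"
  have "linear_map_on (tangent_space M p) (\<lambda>v. g p v u)" if "p \<in> carrier_of M" "u \<in> tangent_space M p" for p u
  proof -
    have "linear_map_on (tangent_space M p) (g p u)" using g that unfolding riemannian_metric_def by blast
    then show ?thesis unfolding linear_map_on_def
      using metric_sym[OF g that(1) _ that(2)] tangent_space_add tangent_space_scaleR by metis
  qed
  then show ?thesis using g unfolding tensor2_def riemannian_metric_def by simp
qed

lemma metric_pos:
  "riemannian_metric M g \<Longrightarrow> p \<in> carrier_of M \<Longrightarrow> u \<in> tangent_space M p \<Longrightarrow> u \<noteq> 0 \<Longrightarrow> g p u u > 0"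
  unfolding riemannian_metric_def by blast

lemma metric_nondegenerate:
  assumes g: "riemannian_metric M g" "p \<in> carrier_of M" and u: "u \<in> tangent_space M p" "v \<in> tangent_space M p"
    and eq: "\<And>w. w \<in> tangent_space M p \<Longrightarrow> g p u w = g p v w"
  shows "u = v"
proof (rule ccontr)
  assume "u \<noteq> v"
  then have "g p (u - v) (u - v) > 0" using metric_pos[OF g tangent_space_diff[OF u]] by simp
  moreover have "g p (u - v) (u - v) = g p u (u - v) - g p v (u - v)"
    using tangent_space_diff[OF u]
    by (intro linear_map_on_diff[OF tensor2_linear(2)[OF metric_tensor2[OF g(1)] g(2)] tangent_space_subspace] u)
  ultimately show False using eq[OF tangent_space_diff[OF u]] by simp
qed

text \<open>The solution of a linear system with a positive definite matrix depends smoothly on the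
  coefficients: eliminating one unknown leaves a system with the Schur complement as its matrix, which
  is again positive definite.\<close>

lemma posdef_solution_smooth:
  fixes G :: "'i \<Rightarrow> 'i \<Rightarrow> 'a \<Rightarrow> real"
  assumes M: "smooth_manifold M" and W: "openin (mtop M) W" and "finite B"
    and "\<And>b c. b \<in> B \<Longrightarrow> c \<in> B \<Longrightarrow> G b c \<in> smooth_funs M W"
    and "\<And>b. b \<in> B \<Longrightarrow> w b \<in> smooth_funs M W"
    and "\<And>b c q. b \<in> B \<Longrightarrow> c \<in> B \<Longrightarrow> q \<in> W \<Longrightarrow> G b c q = G c b q"
    and "\<And>q z. q \<in> W \<Longrightarrow> \<exists>b\<in>B. z b \<noteq> 0 \<Longrightarrow> (\<Sum>b\<in>B. \<Sum>c\<in>B. G b c q * z b * z c) > 0"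
    and "\<And>b q. b \<in> B \<Longrightarrow> q \<in> W \<Longrightarrow> (\<Sum>c\<in>B. G b c q * y c q) = w b q"
    and "b \<in> B"
  shows "y b \<in> smooth_funs M W"
  using assms(3-)
proof (induction B arbitrary: G w b rule: finite_induct)
  case empty then show ?case by simp
next
  case (insert k B)
  note G = insert.prems(1) and w = insert.prems(2) and sym = insert.prems(3) and pos = insert.prems(4) and sol = insert.prems(5)
  have Gkk: "G k k q > 0" if "q \<in> W" for q
    using pos[OF that, of "\<lambda>b. if b = k then 1 else 0"] insert.hyps
    by (simp add: if_distrib[of "\<lambda>x. _ * x"] sum.If_cases cong: if_cong)
  have inv: "(\<lambda>q. inverse (G k k q)) \<in> smooth_funs M W"
    using Gkk by (intro smooth_funs_inverse[OF M W] G) (auto simp: less_le)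
  define G' where "G' b c q = G b c q - G b k q * G k c q * inverse (G k k q)" for b c q
  define w' where "w' b q = w b q - G b k q * w k q * inverse (G k k q)" for b q
  have IH: "y b \<in> smooth_funs M W" if b: "b \<in> B" for b
  proof (rule insert.IH[of G' w' b])
    show "G' b c \<in> smooth_funs M W" if "b \<in> B" "c \<in> B" for b c
      unfolding G'_def using that by (intro smooth_funs_diff[OF M W] smooth_funs_mult[OF M W] G inv) auto
    show "w' b \<in> smooth_funs M W" if "b \<in> B" for b
      unfolding w'_def using that by (intro smooth_funs_diff[OF M W] smooth_funs_mult[OF M W] G w inv) auto
    show "G' b c q = G' c b q" if "b \<in> B" "c \<in> B" "q \<in> W" for b c q
      using sym[of b c q] sym[of b k q] sym[of k c q] that by (simp add: G'_def)
  next
    fix q z assume q: "q \<in> W" and z: "\<exists>b\<in>B. z b \<noteq> (0::real)"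
    define s where "s = (\<Sum>b\<in>B. G k b q * z b)"
    define z' where "z' = z(k := - s * inverse (G k k q))"
    have zB: "z' b = z b" if "b \<in> B" for b using that insert.hyps by (auto simp: z'_def)
    have s': "(\<Sum>b\<in>B. G b k q * z b) = s"
      unfolding s_def by (intro sum.cong refl) (use sym q in auto)
    have "0 < (\<Sum>b\<in>insert k B. \<Sum>c\<in>insert k B. G b c q * z' b * z' c)"
      using z insert.hyps by (intro pos[OF q]) (auto simp: z'_def)
    also have "\<dots> = G k k q * z' k * z' k + (\<Sum>c\<in>B. G k c q * z' k * z' c)
        + ((\<Sum>b\<in>B. G b k q * z' b * z' k) + (\<Sum>b\<in>B. \<Sum>c\<in>B. G b c q * z' b * z' c))"
      using insert.hyps by (simp add: sum.distrib)
    also have "(\<Sum>c\<in>B. G k c q * z' k * z' c) = z' k * s"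
      unfolding s_def sum_distrib_left by (intro sum.cong refl) (simp add: zB)
    also have "(\<Sum>b\<in>B. G b k q * z' b * z' k) = z' k * s"
      unfolding s'[symmetric] sum_distrib_left by (intro sum.cong refl) (simp add: zB)
    also have "(\<Sum>b\<in>B. \<Sum>c\<in>B. G b c q * z' b * z' c) = (\<Sum>b\<in>B. \<Sum>c\<in>B. G b c q * z b * z c)"
      by (intro sum.cong refl) (simp add: zB)
    also have "G k k q * z' k * z' k + z' k * s + (z' k * s + (\<Sum>b\<in>B. \<Sum>c\<in>B. G b c q * z b * z c))
       = (\<Sum>b\<in>B. \<Sum>c\<in>B. G b c q * z b * z c) - s * s * inverse (G k k q)"
      using Gkk[OF q] by (simp add: z'_def field_simps)
    also have "s * s * inverse (G k k q) = (\<Sum>b\<in>B. \<Sum>c\<in>B. (G b k q * z b) * (G k c q * z c) * inverse (G k k q))"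
      by (simp add: s_def[symmetric] sum_distrib_left[symmetric] sum_distrib_right[symmetric] s')
    finally show "0 < (\<Sum>b\<in>B. \<Sum>c\<in>B. G' b c q * z b * z c)"
      by (simp add: G'_def sum_subtractf left_diff_distrib right_diff_distrib mult_ac)
  next
    fix b q assume b: "b \<in> B" and q: "q \<in> W"
    have "G k k q * y k q + (\<Sum>c\<in>B. G k c q * y c q) = w k q" using sol[of k q] q insert.hyps by simp
    then have yk: "(\<Sum>c\<in>B. G k c q * y c q) = w k q - G k k q * y k q" by simp
    have yb: "G b k q * y k q + (\<Sum>c\<in>B. G b c q * y c q) = w b q" using sol[of b q] q b insert.hyps by simp
    have "(\<Sum>c\<in>B. G' b c q * y c q) = (\<Sum>c\<in>B. G b c q * y c q) - G b k q * inverse (G k k q) * (\<Sum>c\<in>B. G k c q * y c q)"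
      by (simp add: G'_def left_diff_distrib right_diff_distrib sum_subtractf sum_distrib_left mult_ac)
    also have "\<dots> = w' b q"
      unfolding yk w'_def yb[symmetric] using Gkk[OF q] by (simp add: field_simps)
    finally show "(\<Sum>c\<in>B. G' b c q * y c q) = w' b q" .
  qed (rule b)
  have "(\<lambda>q. (w k q - (\<Sum>c\<in>B. G k c q * y c q)) * inverse (G k k q)) \<in> smooth_funs M W"
    by (intro smooth_funs_mult[OF M W] smooth_funs_diff[OF M W] smooth_funs_sum[OF M W] w G inv IH) auto
  then have "y k \<in> smooth_funs M W"
  proof (rule smooth_funs_cong[OF M W, rotated])
    fix q assume q: "q \<in> W"
    have "G k k q * y k q + (\<Sum>c\<in>B. G k c q * y c q) = w k q" using sol[of k q] q insert.hyps by simp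
    then show "(w k q - (\<Sum>c\<in>B. G k c q * y c q)) * inverse (G k k q) = y k q"
      using Gkk[OF q] by (simp add: field_simps)
  qed
  with IH insert.prems(6) show ?case by auto
qed

text \<open>The inverse musical isomorphism preserves smoothness: the components of \<open>D\<close> in a frame solve the
  linear system given by the Gram matrix.\<close>

lemma metric_dual_smooth:
  fixes M :: "('a, 'e::euclidean_space) mfd"
  assumes M: "smooth_manifold M" and g: "riemannian_metric M g"
    and T: "\<And>p. p \<in> carrier_of M \<Longrightarrow> D p \<in> tangent_space M p"
    and sm: "\<And>Y. Y \<in> vector_fields M \<Longrightarrow> (\<lambda>p. g p (D p) (Y p)) \<in> smooth_funs M (carrier_of M)"
  shows "D \<in> vector_fields M"
proof (rule vector_fields_localI[OF M T, where B="Basis :: 'e set"])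
  fix p assume "p \<in> carrier_of M"
  then obtain W e x \<kappa> where "local_frame M p W e x \<kappa>" using local_frame_exists[OF M] by blast
  then interpret local_frame M p W e x \<kappa> .
  note g2 = metric_tensor2[OF g]
  define G where "G b c q = g q (e b q) (e c q)" for b c q
  have sub: "f \<in> smooth_funs M W" if "f \<in> smooth_funs M (carrier_of M)" for f
    using smooth_funs_subset[OF that openin_mtop_subset[OF W]] .
  have y: "(\<lambda>q. D q (x b)) \<in> smooth_funs M W" if "b \<in> Basis" for b
  proof (rule posdef_solution_smooth[OF M W finite_Basis, of G "\<lambda>b q. g q (D q) (e b q)" "\<lambda>b q. D q (x b)", OF _ _ _ _ _ that])
    show "G b c \<in> smooth_funs M W" for b c unfolding G_def by (intro sub tensor2_smooth[OF g2] e_field)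
    show "(\<lambda>q. g q (D q) (e b q)) \<in> smooth_funs M W" for b by (intro sub sm e_field)
    show "G b c q = G c b q" if "q \<in> W" for b c q
      unfolding G_def by (intro metric_sym[OF g] carrier e_tangent that)
    show "(\<Sum>b\<in>Basis. \<Sum>c\<in>Basis. G b c q * z b * z c) > 0" if q: "q \<in> W" and z: "\<exists>b\<in>Basis. z b \<noteq> 0" for q z
    proof -
      let ?u = "\<Sum>b\<in>Basis. z b *\<^sub>R e b q"
      obtain b where b: "b \<in> Basis" "z b \<noteq> 0" using z by blast
      have "?u (x b) = (\<Sum>b'\<in>Basis. z b' * (if b' = b then 1 else 0))"
        using e_x[OF q] b by (auto simp: sum_fun_apply intro!: sum.cong)
      also have "\<dots> = z b" using b by (simp add: if_distrib[of "\<lambda>x. _ * x"] cong: if_cong)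
      finally have "?u \<noteq> 0" using b by auto
      then have "g q ?u ?u > 0"
        by (intro metric_pos[OF g carrier[OF q]] tangent_space_sum tangent_space_scaleR e_tangent[OF q])
      also have "g q ?u ?u = (\<Sum>b\<in>Basis. \<Sum>c\<in>Basis. z b * z c * g q (e b q) (e c q))"
        by (rule tensor2_expand[OF g2 carrier[OF q]]) (auto intro: e_tangent[OF q])
      finally show ?thesis by (simp add: G_def mult_ac)
    qed
    show "(\<Sum>c\<in>Basis. G b c q * D q (x c)) = g q (D q) (e b q)" if q: "q \<in> W" for b q
    proof -
      have "g q (D q) (e b q) = g q (\<Sum>c\<in>Basis. D q (x c) *\<^sub>R e c q) (\<Sum>_\<in>{()}. 1 *\<^sub>R e b q)"
        using expand[OF q T[OF carrier[OF q]]] by simp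
      also have "\<dots> = (\<Sum>c\<in>Basis. \<Sum>_\<in>{()}. D q (x c) * 1 * g q (e c q) (e b q))"
        by (rule tensor2_expand[OF g2 carrier[OF q]]) (auto intro: e_tangent[OF q])
      also have "\<dots> = (\<Sum>c\<in>Basis. G b c q * D q (x c))"
        by (intro sum.cong refl) (simp add: G_def metric_sym[OF g carrier[OF q] e_tangent[OF q] e_tangent[OF q], of b])
      finally show ?thesis by simp
    qed
  qed
  show "\<exists>W e y. openin (mtop M) W \<and> p \<in> W \<and>
       (\<forall>b\<in>Basis. e b \<in> vector_fields M \<and> y b \<in> smooth_funs M W) \<and> (\<forall>q\<in>W. D q = (\<Sum>b\<in>(Basis::'e set). y b q *\<^sub>R e b q))"
    using W pW e_field y expand T carrier
    by (intro exI[of _ W] exI[of _ e] exI[of _ "\<lambda>b q. D q (x b)"]) blast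
qed

section \<open>Smooth maps and pullbacks of forms\<close>

lemma smooth_map_carrier: "smooth_map N M h \<Longrightarrow> q \<in> carrier_of N \<Longrightarrow> h q \<in> carrier_of M"
  unfolding smooth_map_def carrier_of_def continuous_map_def by auto

lemma smooth_map_preimage_openin:
  assumes "smooth_map N M h" "openin (mtop M) W"
  shows "openin (mtop N) {q \<in> carrier_of N. h q \<in> W}"
  using assms unfolding smooth_map_def carrier_of_def by (auto intro: openin_continuous_map_preimage)

lemma smooth_funs_pullback:
  assumes N: "smooth_manifold N" and M: "smooth_manifold M" and h: "smooth_map N M h"
    and W: "openin (mtop M) W" and f: "f \<in> smooth_funs M W"
  shows "f \<circ> h \<in> smooth_funs N {q \<in> carrier_of N. h q \<in> W}"
proof (rule smooth_funs_chartI[OF N])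
  fix q assume q: "q \<in> {q \<in> carrier_of N. h q \<in> W}" "q \<in> carrier_of N"
  obtain V d where V: "(V, d) \<in> atlas N" "q \<in> V" using chart_at[OF N q(2)] .
  obtain U c where U: "(U, c) \<in> atlas M" "h q \<in> U" using chart_at[OF M smooth_map_carrier[OF h q(2)]] .
  define W' where "W' = {q \<in> carrier_of N. h q \<in> U \<inter> W}"
  have W': "openin (mtop N) W'"
    unfolding W'_def using W chart_openin[OF M U(1)] by (intro smooth_map_preimage_openin[OF h]) auto
  have o: "open (d ` (V \<inter> W'))" by (rule chart_image_openin[OF N V(1) W'])
  have "smooth_on (d ` (V \<inter> h -` U)) (c \<circ> h \<circ> inv_into V d)"
    using h V(1) U(1) unfolding smooth_map_def by fast
  then have 1: "smooth_on (d ` (V \<inter> W')) (c \<circ> h \<circ> inv_into V d)"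
    by (rule smooth_on_subset) (auto simp: W'_def)
  have "smooth_on (d ` (V \<inter> W')) (\<lambda>y. (f \<circ> inv_into U c) ((c \<circ> h \<circ> inv_into V d) y))"
    by (rule smooth_on_compose[OF o chart_image_openin[OF M U(1) W] _ 1 smooth_funsD[OF f U(1)]])
       (auto simp: W'_def chart_inv[OF N V(1)])
  then have "smooth_on (d ` (V \<inter> W')) (f \<circ> h \<circ> inv_into V d)"
    by (rule smooth_on_cong[OF o, THEN iffD1, rotated]) (auto simp: W'_def chart_inv[OF N V(1)] chart_inv[OF M U(1)])
  then show "\<exists>U c W'. (U, c) \<in> atlas N \<and> openin (mtop N) W' \<and> q \<in> U \<and> q \<in> W' \<and>
       smooth_on (c ` (U \<inter> W')) (f \<circ> h \<circ> inv_into U c)"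
    using V W' q U by (intro exI[of _ V] exI[of _ d] exI[of _ W']) (auto simp: W'_def)
qed

lemma smooth_near_pullback:
  assumes "smooth_manifold N" "smooth_manifold M" "smooth_map N M h" "q \<in> carrier_of N" "smooth_near M (h q) f"
  shows "smooth_near N q (f \<circ> h)"
proof -
  obtain W where W: "openin (mtop M) W" "h q \<in> W" "f \<in> smooth_funs M W"
    using assms(5) unfolding smooth_near_def by blast
  show ?thesis
    by (rule smooth_nearI[OF smooth_map_preimage_openin[OF assms(3) W(1)] _ smooth_funs_pullback[OF assms(1-3) W(1,3)]])
       (use W assms in auto)
qed

lemma pushforward_apply: "smooth_near M (h q) f \<Longrightarrow> pushforward N M h q u f = u (f \<circ> h)"
  by (simp add: pushforward_def)

lemma pushforward_tangent:
  fixes N :: "('a, 'e::euclidean_space) mfd" and M :: "('b, 'd::euclidean_space) mfd"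
  assumes N: "smooth_manifold N" and M: "smooth_manifold M" and h: "smooth_map N M h"
    and q: "q \<in> carrier_of N" and u: "u \<in> tangent_space N q"
  shows "pushforward N M h q u \<in> tangent_space M (h q)"
  unfolding tangent_space_def
proof (intro CollectI conjI allI impI)
  fix f k :: "'b \<Rightarrow> real" and a :: real assume f: "smooth_near M (h q) f" and k: "smooth_near M (h q) k"
  note P = smooth_near_pullback[OF N M h q]
  note f' = P[OF f] and k' = P[OF k]
  have "smooth_near M (h q) (\<lambda>x. a * f x + k x)"
    using f k smooth_map_carrier[OF h q] by (intro smooth_near_add[OF M] smooth_near_mult[OF M]) auto
  then show "pushforward N M h q u (\<lambda>x. a * f x + k x) = a * pushforward N M h q u f + pushforward N M h q u k"
    using tangent_lin[OF u f' k', of a] f k by (simp add: pushforward_apply o_def)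
  have "smooth_near M (h q) (\<lambda>x. f x * k x)" using f k by (rule smooth_near_mult[OF M])
  then show "pushforward N M h q u (\<lambda>x. f x * k x) = f (h q) * pushforward N M h q u k + k (h q) * pushforward N M h q u f"
    using tangent_leibniz[OF u f' k'] f k by (simp add: pushforward_apply o_def)
qed (simp add: pushforward_def)

lemma pushforward_add: "pushforward N M h q (u + v) = pushforward N M h q u + pushforward N M h q v"
  by (auto simp: pushforward_def fun_eq_iff)

lemma pushforward_scaleR: "pushforward N M h q (a *\<^sub>R u) = a *\<^sub>R pushforward N M h q u"
  by (auto simp: pushforward_def fun_eq_iff)

lemma pushforward_zero [simp]: "pushforward N M h q 0 = 0"
  by (auto simp: pushforward_def fun_eq_iff)

lemma pushforward_uminus: "pushforward N M h q (- u) = - pushforward N M h q u"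
  by (auto simp: pushforward_def fun_eq_iff)

lemma pushforward_diff: "pushforward N M h q (u - v) = pushforward N M h q u - pushforward N M h q v"
  by (auto simp: pushforward_def fun_eq_iff)

lemma pushforward_sum: "pushforward N M h q (\<Sum>i\<in>I. u i) = (\<Sum>i\<in>I. pushforward N M h q (u i))"
  by (induction I rule: infinite_finite_induct)
     (simp_all only: simp_thms sum.infinite sum.empty sum.insert pushforward_zero pushforward_add)

text \<open>A frame of the target around \<open>h q0\<close>, used to expand pushforwards of vectors of the source near \<open>q0\<close>
  in terms of the coordinate functions \<open>xi b = x b \<circ> h\<close> of the map.\<close>

locale pullback_frame = local_frame M "h q0" W e x \<kappa>
  for M :: "('b, 'd::euclidean_space) mfd" and h :: "'a \<Rightarrow> 'b" and q0 W e x \<kappa> +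
  fixes N :: "('a, 'e::euclidean_space) mfd"
  assumes N: "smooth_manifold N" and h: "smooth_map N M h" and q0: "q0 \<in> carrier_of N"
begin

definition "W' = {q \<in> carrier_of N. h q \<in> W}"

abbreviation "xi b \<equiv> x b \<circ> h"

lemma W': "openin (mtop N) W'" "q0 \<in> W'"
  using smooth_map_preimage_openin[OF h W] q0 pW by (auto simp: W'_def)

lemma W'D: "q \<in> W' \<Longrightarrow> h q \<in> W" "q \<in> W' \<Longrightarrow> q \<in> carrier_of N"
  by (auto simp: W'_def)

lemma xi_smooth: "xi b \<in> smooth_funs N W'"
  unfolding W'_def by (rule smooth_funs_pullback[OF N M h W x_smooth])

lemma pullback_smooth: "f \<in> smooth_funs M (carrier_of M) \<Longrightarrow> (\<lambda>q. f (h q)) \<in> smooth_funs N W'"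
  using smooth_funs_pullback[OF N M h W smooth_funs_subset[OF _ openin_mtop_subset[OF W]]]
  by (auto simp: W'_def o_def)

lemma pushforward_expand:
  assumes q: "q \<in> W'" and u: "u \<in> tangent_space N q"
  shows "pushforward N M h q u = (\<Sum>b\<in>Basis. u (xi b) *\<^sub>R e b (h q))"
  using expand[OF W'D(1)[OF q] pushforward_tangent[OF N M h W'D(2)[OF q] u]] x_near[OF W'D(1)[OF q]]
  by (simp add: pushforward_apply)

lemma derivative_pullback:
  assumes q: "q \<in> W'" and u: "u \<in> tangent_space N q" and f: "f \<in> smooth_funs M (carrier_of M)"
  shows "u (\<lambda>q. f (h q)) = (\<Sum>b\<in>Basis. u (xi b) * e b (h q) f)"
proof -
  have "smooth_near M (h q) f"
    using smooth_nearI[OF openin_carrier _ f] carrier[OF W'D(1)[OF q]] by auto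
  then have "u (\<lambda>q. f (h q)) = pushforward N M h q u f" by (simp add: pushforward_apply o_def)
  then show ?thesis by (simp add: pushforward_expand[OF q u] sum_fun_apply)
qed

lemma pullback1_expand:
  assumes \<theta>: "one_form M \<theta>" and q: "q \<in> W'" and u: "u \<in> tangent_space N q"
  shows "\<theta> (h q) (pushforward N M h q u) = (\<Sum>b\<in>Basis. \<theta> (h q) (e b (h q)) * u (xi b))"
proof -
  have lin: "linear_map_on (tangent_space M (h q)) (\<theta> (h q))"
    using \<theta> carrier[OF W'D(1)[OF q]] unfolding one_form_def by blast
  note T = e_tangent[OF W'D(1)[OF q]]
  show ?thesis
    unfolding pushforward_expand[OF q u]
    by (subst linear_map_on_sum[OF lin tangent_space_subspace])
       (auto intro: tangent_space_scaleR T simp: linear_map_on_scaleR[OF lin tangent_space_zero T] mult.commute)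
qed

lemma pullback2_expand:
  assumes \<omega>: "tensor2 M \<omega>" and q: "q \<in> W'" and u: "u \<in> tangent_space N q" "v \<in> tangent_space N q"
  shows "\<omega> (h q) (pushforward N M h q u) (pushforward N M h q v) =
    (\<Sum>b\<in>Basis. \<Sum>c\<in>Basis. \<omega> (h q) (e b (h q)) (e c (h q)) * (u (xi b) * v (xi c)))"
  unfolding pushforward_expand[OF q u(1)] pushforward_expand[OF q u(2)]
  by (subst tensor2_expand[OF \<omega> carrier[OF W'D(1)[OF q]]]) (auto intro: e_tangent[OF W'D(1)[OF q]] simp: mult_ac)

end

lemma pullback_frame_exists:
  assumes "smooth_manifold N" "smooth_manifold M" "smooth_map N M h" "q0 \<in> carrier_of N"
  obtains W e x \<kappa> where "pullback_frame M h q0 W e x \<kappa> N"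
proof -
  obtain W e x \<kappa> where "local_frame M (h q0) W e x \<kappa>"
    using local_frame_exists[OF assms(2) smooth_map_carrier[OF assms(3,4)]] .
  then show ?thesis
    using that assms by (simp add: pullback_frame_def pullback_frame_axioms_def)
qed

lemma one_form_smooth:
  "one_form M \<theta> \<Longrightarrow> X \<in> vector_fields M \<Longrightarrow> (\<lambda>p. \<theta> p (X p)) \<in> smooth_funs M (carrier_of M)"
  unfolding one_form_def by blast

lemma one_form_linear:
  "one_form M \<theta> \<Longrightarrow> p \<in> carrier_of M \<Longrightarrow> linear_map_on (tangent_space M p) (\<theta> p)"
  unfolding one_form_def by blast

lemma pullback1_smooth:
  assumes N: "smooth_manifold N" and M: "smooth_manifold M" and h: "smooth_map N M h"
    and \<theta>: "one_form M \<theta>" and Y: "Y \<in> vector_fields N"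
  shows "(\<lambda>q. \<theta> (h q) (pushforward N M h q (Y q))) \<in> smooth_funs N (carrier_of N)"
proof (rule smooth_funs_localI[OF N])
  fix q0 assume q0: "q0 \<in> carrier_of N"
  obtain W e x \<kappa> where "pullback_frame M h q0 W e x \<kappa> N" using pullback_frame_exists[OF N M h q0] .
  then interpret pullback_frame M h q0 W e x \<kappa> N .
  have "(\<lambda>q. \<Sum>b\<in>Basis. \<theta> (h q) (e b (h q)) * Y q (xi b)) \<in> smooth_funs N W'"
    by (intro smooth_funs_sum[OF N W'(1)] smooth_funs_mult[OF N W'(1)] vector_fields_smooth[OF Y W'(1)] xi_smooth
        pullback_smooth one_form_smooth[OF \<theta>] e_field)
  then have "(\<lambda>q. \<theta> (h q) (pushforward N M h q (Y q))) \<in> smooth_funs N W'"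
    by (rule smooth_funs_cong[OF N W'(1), rotated]) (simp add: pullback1_expand[OF \<theta>] vector_fields_tangent[OF Y] W'D)
  then show "\<exists>W. openin (mtop N) W \<and> q0 \<in> W \<and> (\<lambda>q. \<theta> (h q) (pushforward N M h q (Y q))) \<in> smooth_funs N W"
    using W' by blast
qed

lemma pullback2_smooth:
  assumes N: "smooth_manifold N" and M: "smooth_manifold M" and h: "smooth_map N M h"
    and \<omega>: "tensor2 M \<omega>" and Y: "Y \<in> vector_fields N" and Z: "Z \<in> vector_fields N"
  shows "(\<lambda>q. \<omega> (h q) (pushforward N M h q (Y q)) (pushforward N M h q (Z q))) \<in> smooth_funs N (carrier_of N)"
    (is "?F \<in> _")
proof (rule smooth_funs_localI[OF N])
  fix q0 assume q0: "q0 \<in> carrier_of N"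
  obtain W e x \<kappa> where "pullback_frame M h q0 W e x \<kappa> N" using pullback_frame_exists[OF N M h q0] .
  then interpret pullback_frame M h q0 W e x \<kappa> N .
  have "(\<lambda>q. \<Sum>b\<in>Basis. \<Sum>c\<in>Basis. \<omega> (h q) (e b (h q)) (e c (h q)) * (Y q (xi b) * Z q (xi c))) \<in> smooth_funs N W'"
    by (intro smooth_funs_sum[OF N W'(1)] smooth_funs_mult[OF N W'(1)] vector_fields_smooth[OF Y W'(1)]
        vector_fields_smooth[OF Z W'(1)] xi_smooth pullback_smooth[OF tensor2_smooth[OF \<omega>]] e_field)
  then have "?F \<in> smooth_funs N W'"
    by (rule smooth_funs_cong[OF N W'(1), rotated])
       (simp add: pullback2_expand[OF \<omega>] vector_fields_tangent[OF Y] vector_fields_tangent[OF Z] W'D)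
  then show "\<exists>W. openin (mtop N) W \<and> q0 \<in> W \<and> ?F \<in> smooth_funs N W" using W' by blast
qed

text \<open>Closedness is inherited by pullbacks since exterior differentiation commutes with them: in coordinates
  the second derivatives of the map cancel, for 2-forms because of the antisymmetry of the
  coefficients, and the rest is \<open>d\<close> of the given form.\<close>

lemma pullback1_closed:
  fixes N :: "('a, 'e::euclidean_space) mfd" and M :: "('b, 'd::euclidean_space) mfd"
  assumes N: "smooth_manifold N" and M: "smooth_manifold M" and h: "smooth_map N M h"
    and \<theta>: "one_form M \<theta>" and cl: "closed_form1 M \<theta>"
  shows "closed_form1 N (\<lambda>q u. \<theta> (h q) (pushforward N M h q u))"
  unfolding closed_form1_def
proof (intro ballI)
  fix X Y q0 assume X: "X \<in> vector_fields N" and Y: "Y \<in> vector_fields N" and q0: "q0 \<in> carrier_of N"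
  obtain W e x \<kappa> where "pullback_frame M h q0 W e x \<kappa> N" using pullback_frame_exists[OF N M h q0] .
  then interpret pullback_frame M h q0 W e x \<kappa> N .
  define t where "t b q = \<theta> q (e b q)" for b q
  have t: "t b \<in> smooth_funs M (carrier_of M)" for b unfolding t_def by (rule one_form_smooth[OF \<theta> e_field])
  have near: "smooth_near N q0 f" if "f \<in> smooth_funs N W'" for f using smooth_nearI[OF W' that] .
  note nt = near[OF pullback_smooth[OF t]] and nx = near[OF xi_smooth]
  have D: "X q0 (\<lambda>q. \<theta> (h q) (pushforward N M h q (Y q))) =
     (\<Sum>b\<in>Basis. t b (h q0) * X q0 (\<lambda>q. Y q (xi b)) + Y q0 (xi b) * (\<Sum>c\<in>Basis. X q0 (xi c) * e c (h q0) (t b)))"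
    if X: "X \<in> vector_fields N" and Y: "Y \<in> vector_fields N" for X Y
  proof -
    note Xt = vector_fields_tangent[OF X q0]
    note nY = vector_fields_smooth_near[OF Y nx]
    have "X q0 (\<lambda>q. \<theta> (h q) (pushforward N M h q (Y q))) = X q0 (\<lambda>q. \<Sum>b\<in>Basis. t b (h q) * Y q (xi b))"
      by (rule tangent_cong[OF N Xt W'])
         (simp add: pullback1_expand[OF \<theta>] vector_fields_tangent[OF Y] W'D t_def)
    also have "\<dots> = (\<Sum>b\<in>Basis. X q0 (\<lambda>q. t b (h q) * Y q (xi b)))"
      by (intro tangent_sum[OF N Xt q0] smooth_near_mult[OF N] nt nY)
    finally show ?thesis
      by (simp add: tangent_leibniz[OF Xt nt nY] derivative_pullback[OF W'(2) Xt t])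
  qed
  have B: "\<theta> (h q0) (pushforward N M h q0 (lie_bracket N X Y q0)) =
     (\<Sum>b\<in>Basis. t b (h q0) * (X q0 (\<lambda>q. Y q (xi b)) - Y q0 (\<lambda>q. X q (xi b))))"
    by (simp add: pullback1_expand[OF \<theta> W'(2) lie_bracket_tangent[OF N X Y q0]] lie_bracket_apply[OF nx] t_def)
  have E: "e c (h q0) (t b) = e b (h q0) (t c)" if "b \<in> Basis" "c \<in> Basis" for b c
  proof -
    have "ext_deriv1 M \<theta> (e c) (e b) (h q0) = 0"
      using cl e_field carrier[OF pW] unfolding closed_form1_def by blast
    moreover have "\<theta> (h q0) 0 = 0"
      by (rule linear_map_on_zero[OF one_form_linear[OF \<theta> carrier[OF pW]] tangent_space_zero])
    ultimately show ?thesis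
      using bracket_zero[OF pW that(2,1)] by (simp add: ext_deriv1_def t_def[abs_def])
  qed
  have S: "(\<Sum>b\<in>Basis. Y q0 (xi b) * (\<Sum>c\<in>Basis. X q0 (xi c) * e c (h q0) (t b)))
     = (\<Sum>b\<in>Basis. X q0 (xi b) * (\<Sum>c\<in>Basis. Y q0 (xi c) * e c (h q0) (t b)))"
    unfolding sum_distrib_left
    by (subst sum.swap) (intro sum.cong refl, simp add: E mult_ac)
  show "ext_deriv1 N (\<lambda>q u. \<theta> (h q) (pushforward N M h q u)) X Y q0 = 0"
    unfolding ext_deriv1_def D[OF X Y] D[OF Y X] B
    using S by (simp add: sum.distrib right_diff_distrib sum_subtractf)
qed

lemma skew_symmetric_sum_zero:
  fixes w :: "'i \<Rightarrow> 'i \<Rightarrow> real"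
  assumes "\<And>b c. b \<in> B \<Longrightarrow> c \<in> B \<Longrightarrow> w b c = - w c b"
  shows "(\<Sum>b\<in>B. \<Sum>c\<in>B. w b c * (P b * Q c + Q b * P c)) = 0"
proof -
  have "(\<Sum>b\<in>B. \<Sum>c\<in>B. w b c * (P b * Q c + Q b * P c)) = (\<Sum>c\<in>B. \<Sum>b\<in>B. w b c * (P b * Q c + Q b * P c))"
    by (rule sum.swap)
  also have "\<dots> = (\<Sum>c\<in>B. \<Sum>b\<in>B. - (w c b * (P c * Q b + Q c * P b)))"
  proof (intro sum.cong refl)
    fix c b assume "c \<in> B" "b \<in> B"
    then show "w b c * (P b * Q c + Q b * P c) = - (w c b * (P c * Q b + Q c * P b))"
      using assms[of b c] by (simp add: algebra_simps)
  qed
  also have "\<dots> = - (\<Sum>b\<in>B. \<Sum>c\<in>B. w b c * (P b * Q c + Q b * P c))" by (simp add: sum_negf)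
  finally show ?thesis by simp
qed

lemma pullback2_closed:
  fixes N :: "('a, 'e::euclidean_space) mfd" and M :: "('b, 'd::euclidean_space) mfd"
  assumes N: "smooth_manifold N" and M: "smooth_manifold M" and h: "smooth_map N M h"
    and \<omega>: "tensor2 M \<omega>" and cl: "closed_form2 M \<omega>"
    and skew: "\<And>p u v. p \<in> carrier_of M \<Longrightarrow> u \<in> tangent_space M p \<Longrightarrow> v \<in> tangent_space M p \<Longrightarrow> \<omega> p u v = - \<omega> p v u"
  shows "closed_form2 N (\<lambda>q u v. \<omega> (h q) (pushforward N M h q u) (pushforward N M h q v))"
  unfolding closed_form2_def
proof (intro ballI)
  fix X Y Z q0
  assume X: "X \<in> vector_fields N" and Y: "Y \<in> vector_fields N" and Z: "Z \<in> vector_fields N" and q0: "q0 \<in> carrier_of N"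
  obtain W e x \<kappa> where "pullback_frame M h q0 W e x \<kappa> N" using pullback_frame_exists[OF N M h q0] .
  then interpret pullback_frame M h q0 W e x \<kappa> N .
  define w where "w b c q = \<omega> q (e b q) (e c q)" for b c q
  have w: "w b c \<in> smooth_funs M (carrier_of M)" for b c unfolding w_def by (rule tensor2_smooth[OF \<omega> e_field e_field])
  have near: "smooth_near N q0 f" if "f \<in> smooth_funs N W'" for f using smooth_nearI[OF W' that] .
  note nw = near[OF pullback_smooth[OF w]] and nx = near[OF xi_smooth]
  define v where "v b c = w b c (h q0)" for b c
  define E where "E a b c = e a (h q0) (w b c)" for a b c
  let ?d = "\<lambda>X b. X q0 (xi b)" and ?dd = "\<lambda>X Y b. X q0 (\<lambda>q. Y q (xi b))"
  have D: "X q0 (\<lambda>q. \<omega> (h q) (pushforward N M h q (Y q)) (pushforward N M h q (Z q))) =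
      (\<Sum>b\<in>Basis. \<Sum>c\<in>Basis. v b c * (?d Y b * ?dd X Z c + ?d Z c * ?dd X Y b))
      + (\<Sum>b\<in>Basis. \<Sum>c\<in>Basis. \<Sum>a\<in>Basis. ?d X a * ?d Y b * ?d Z c * E a b c)"
    if X: "X \<in> vector_fields N" and Y: "Y \<in> vector_fields N" and Z: "Z \<in> vector_fields N" for X Y Z
  proof -
    note Xt = vector_fields_tangent[OF X q0]
    note nY = vector_fields_smooth_near[OF Y nx] and nZ = vector_fields_smooth_near[OF Z nx]
    note nYZ = smooth_near_mult[OF N nY nZ]
    have "X q0 (\<lambda>q. \<omega> (h q) (pushforward N M h q (Y q)) (pushforward N M h q (Z q))) =
       X q0 (\<lambda>q. \<Sum>b\<in>Basis. \<Sum>c\<in>Basis. w b c (h q) * (Y q (xi b) * Z q (xi c)))"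
      by (rule tangent_cong[OF N Xt W'])
         (simp add: pullback2_expand[OF \<omega>] vector_fields_tangent[OF Y] vector_fields_tangent[OF Z] W'D w_def)
    also have "\<dots> = (\<Sum>b\<in>Basis. X q0 (\<lambda>q. \<Sum>c\<in>Basis. w b c (h q) * (Y q (xi b) * Z q (xi c))))"
      by (intro tangent_sum[OF N Xt q0] smooth_near_sum[OF N q0] smooth_near_mult[OF N nw nYZ])
    also have "\<dots> = (\<Sum>b\<in>Basis. \<Sum>c\<in>Basis. X q0 (\<lambda>q. w b c (h q) * (Y q (xi b) * Z q (xi c))))"
      by (intro sum.cong refl tangent_sum[OF N Xt q0] smooth_near_mult[OF N nw nYZ])
    also have "\<dots> = (\<Sum>b\<in>Basis. \<Sum>c\<in>Basis. v b c * (?d Y b * ?dd X Z c + ?d Z c * ?dd X Y b)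
       + (\<Sum>a\<in>Basis. ?d X a * ?d Y b * ?d Z c * E a b c))"
      by (intro sum.cong refl)
         (simp add: tangent_leibniz[OF Xt nw nYZ] tangent_leibniz[OF Xt nY nZ] derivative_pullback[OF W'(2) Xt w]
           v_def E_def sum_distrib_left mult_ac)
    finally show ?thesis by (simp add: sum.distrib)
  qed
  have B: "\<omega> (h q0) (pushforward N M h q0 (lie_bracket N X Y q0)) (pushforward N M h q0 (Z q0)) =
      (\<Sum>b\<in>Basis. \<Sum>c\<in>Basis. v b c * ((?dd X Y b - ?dd Y X b) * ?d Z c))"
    if X: "X \<in> vector_fields N" and Y: "Y \<in> vector_fields N" and Z: "Z \<in> vector_fields N" for X Y Z
    by (simp add: pullback2_expand[OF \<omega> W'(2) lie_bracket_tangent[OF N X Y q0] vector_fields_tangent[OF Z q0]]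
        lie_bracket_apply[OF nx] v_def w_def)
  have sk: "v b c = - v c b" for b c
    unfolding v_def w_def by (intro skew carrier[OF pW] e_tangent[OF pW])
  have dE: "E a b c - E b a c + E c a b = 0" if "a \<in> Basis" "b \<in> Basis" "c \<in> Basis" for a b c
  proof -
    have "ext_deriv2 M \<omega> (e a) (e b) (e c) (h q0) = 0"
      using cl e_field carrier[OF pW] unfolding closed_form2_def by blast
    moreover have "\<omega> (h q0) 0 (e b (h q0)) = 0" for b
      by (rule linear_map_on_zero[OF tensor2_linear(2)[OF \<omega> carrier[OF pW] e_tangent[OF pW]] tangent_space_zero])
    ultimately show ?thesis
      using bracket_zero[OF pW] that by (simp add: ext_deriv2_def E_def w_def[abs_def])
  qed
  let ?S = "\<lambda>P Q. \<Sum>b\<in>Basis. \<Sum>c\<in>Basis. v b c * (P b * Q c + Q b * P c)"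
  let ?T = "\<lambda>X Y Z. \<Sum>b\<in>Basis. \<Sum>c\<in>Basis. v b c * (?d Y b * ?dd X Z c + ?d Z c * ?dd X Y b)"
  let ?R = "\<lambda>X Y Z. \<Sum>b\<in>Basis. \<Sum>c\<in>Basis. v b c * ((?dd X Y b - ?dd Y X b) * ?d Z c)"
  let ?U = "\<lambda>X Y Z. \<Sum>b\<in>Basis. \<Sum>c\<in>Basis. \<Sum>a\<in>Basis. ?d X a * ?d Y b * ?d Z c * E a b c"
  have first: "?T X Y Z - ?T Y X Z + ?T Z X Y - ?R X Y Z + ?R X Z Y - ?R Y Z X
      = ?S (?d Y) (?dd X Z) - ?S (?d X) (?dd Y Z) + ?S (?d X) (?dd Z Y)"
    unfolding sum_subtractf[symmetric] sum.distrib[symmetric]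
    by (intro sum.cong refl) (simp add: algebra_simps)
  have U1: "?U X Y Z = (\<Sum>a\<in>Basis. \<Sum>b\<in>Basis. \<Sum>c\<in>Basis. ?d X a * ?d Y b * ?d Z c * E a b c)"
    by (rule trans[OF sum.cong[OF refl sum.swap] sum.swap])
  have U2: "?U Y X Z = (\<Sum>a\<in>Basis. \<Sum>b\<in>Basis. \<Sum>c\<in>Basis. ?d X a * ?d Y b * ?d Z c * E b a c)"
    by (rule sum.cong[OF refl], subst sum.swap) (simp add: mult_ac)
  have U3: "?U Z X Y = (\<Sum>a\<in>Basis. \<Sum>b\<in>Basis. \<Sum>c\<in>Basis. ?d X a * ?d Y b * ?d Z c * E c a b)"
    by (intro sum.cong refl) (simp add: mult_ac)
  have second: "?U X Y Z - ?U Y X Z + ?U Z X Y = 0"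
  proof -
    have "?U X Y Z - ?U Y X Z + ?U Z X Y =
        (\<Sum>a\<in>Basis. \<Sum>b\<in>Basis. \<Sum>c\<in>Basis. ?d X a * ?d Y b * ?d Z c * (E a b c - E b a c + E c a b))"
      unfolding U1 U2 U3 sum_subtractf[symmetric] sum.distrib[symmetric]
      by (intro sum.cong refl) (simp add: algebra_simps)
    then show ?thesis by (simp add: dE)
  qed
  show "ext_deriv2 N (\<lambda>q u v. \<omega> (h q) (pushforward N M h q u) (pushforward N M h q v)) X Y Z q0 = 0"
    unfolding ext_deriv2_def D[OF X Y Z] D[OF Y X Z] D[OF Z X Y] B[OF X Y Z] B[OF X Z Y] B[OF Y Z X]
    using first second skew_symmetric_sum_zero[of Basis v, OF sk] by simp
qed

text \<open>For a function \<open>f\<close> on the target, \<open>Y(f \<circ> h) = (Y'f) \<circ> h\<close>, and \<open>X\<close> maps this to \<open>(X'Y'f) \<circ> h\<close>.\<close>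

lemma related_bracket:
  fixes N :: "('a, 'e::euclidean_space) mfd" and M :: "('b, 'd::euclidean_space) mfd"
  assumes N: "smooth_manifold N" and M: "smooth_manifold M" and h: "smooth_map N M h"
    and X: "X \<in> vector_fields N" "X' \<in> vector_fields M" "\<And>q. q \<in> carrier_of N \<Longrightarrow> pushforward N M h q (X q) = X' (h q)"
    and Y: "Y \<in> vector_fields N" "Y' \<in> vector_fields M" "\<And>q. q \<in> carrier_of N \<Longrightarrow> pushforward N M h q (Y q) = Y' (h q)"
    and q: "q \<in> carrier_of N"
  shows "pushforward N M h q (lie_bracket N X Y q) = lie_bracket M X' Y' (h q)"
proof
  fix f
  show "pushforward N M h q (lie_bracket N X Y q) f = lie_bracket M X' Y' (h q) f"
  proof (cases "smooth_near M (h q) f")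
    case True
    have fh: "smooth_near N q (f \<circ> h)" by (rule smooth_near_pullback[OF N M h q True])
    have D: "X q (\<lambda>r. Y r (f \<circ> h)) = X' (h q) (\<lambda>s. Y' s f)"
      if X: "X \<in> vector_fields N" "X' \<in> vector_fields M" "\<And>q. q \<in> carrier_of N \<Longrightarrow> pushforward N M h q (X q) = X' (h q)"
        and Y: "Y \<in> vector_fields N" "Y' \<in> vector_fields M" "\<And>q. q \<in> carrier_of N \<Longrightarrow> pushforward N M h q (Y q) = Y' (h q)"
      for X X' Y Y'
    proof -
      obtain W where W: "openin (mtop M) W" "h q \<in> W" "\<And>r. r \<in> W \<Longrightarrow> smooth_near M r f"
        using smooth_near_open[OF True] by blast
      have "X q (\<lambda>r. Y r (f \<circ> h)) = X q ((\<lambda>s. Y' s f) \<circ> h)"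
      proof (rule tangent_cong[OF N vector_fields_tangent[OF X(1) q] smooth_map_preimage_openin[OF h W(1)]])
        fix r assume r: "r \<in> {r \<in> carrier_of N. h r \<in> W}"
        then have "Y r (f \<circ> h) = pushforward N M h r (Y r) f" using W(3) by (simp add: pushforward_apply)
        then show "Y r (f \<circ> h) = ((\<lambda>s. Y' s f) \<circ> h) r" using Y(3) r by simp
      qed (use q W in auto)
      also have "\<dots> = pushforward N M h q (X q) (\<lambda>s. Y' s f)"
        by (rule pushforward_apply[where h=h and q=q, OF vector_fields_smooth_near[OF Y(2) True], symmetric])
      finally show ?thesis by (simp add: X(3)[OF q])
    qed
    show ?thesis
      unfolding pushforward_apply[where h=h and q=q, OF True] lie_bracket_apply[OF fh] lie_bracket_apply[OF True]
      by (rule arg_cong2[where f="(-)", OF D[OF X Y] D[OF Y X]])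
  next
    case False
    then show ?thesis by (simp add: pushforward_def lie_bracket_def)
  qed
qed

lemma closed_form2_cong:
  assumes M: "smooth_manifold M" and cl: "closed_form2 M \<omega>"
    and eq: "\<And>p u v. p \<in> carrier_of M \<Longrightarrow> u \<in> tangent_space M p \<Longrightarrow> v \<in> tangent_space M p \<Longrightarrow> \<omega> p u v = \<omega>' p u v"
  shows "closed_form2 M \<omega>'"
  unfolding closed_form2_def
proof (intro ballI)
  fix X Y Z p assume XYZ: "X \<in> vector_fields M" "Y \<in> vector_fields M" "Z \<in> vector_fields M" and p: "p \<in> carrier_of M"
  have D: "X p (\<lambda>q. \<omega> q (Y q) (Z q)) = X p (\<lambda>q. \<omega>' q (Y q) (Z q))"
    if "X \<in> vector_fields M" "Y \<in> vector_fields M" "Z \<in> vector_fields M" for X Y Z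
    by (rule tangent_cong[OF M vector_fields_tangent[OF that(1) p] openin_carrier p])
       (intro eq vector_fields_tangent that)
  have B: "\<omega> p (lie_bracket M X Y p) (Z p) = \<omega>' p (lie_bracket M X Y p) (Z p)"
    if "X \<in> vector_fields M" "Y \<in> vector_fields M" "Z \<in> vector_fields M" for X Y Z
    by (intro eq p lie_bracket_tangent[OF M] vector_fields_tangent that)
  have "ext_deriv2 M \<omega> X Y Z p = 0" using cl XYZ p unfolding closed_form2_def by blast
  then show "ext_deriv2 M \<omega>' X Y Z p = 0"
    unfolding ext_deriv2_def
    using D[OF XYZ(1,2,3)] D[OF XYZ(2,1,3)] D[OF XYZ(3,1,2)] B[OF XYZ(1,2,3)] B[OF XYZ(1,3,2)] B[OF XYZ(2,3,1)]
    by linarith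
qed

section \<open>Almost contact metric structures\<close>

lemma app_apply: "app \<phi> X p = \<phi> p (X p)"
  by (simp add: app_def)

lemma tangent_uminus:
  assumes "D \<in> tangent_space M p" "smooth_near M p f" shows "D (\<lambda>x. - f x) = - D f"
  using tangent_lin[OF assms(1,2) smooth_near_const[OF smooth_near_carrier[OF assms(2)], of 0], of "-1"]
    tangent_const[OF assms(1) smooth_near_carrier[OF assms(2)], of 0] by simp

lemma endo_field_linear: "endo_field M \<phi> \<Longrightarrow> p \<in> carrier_of M \<Longrightarrow> linear_map_on (tangent_space M p) (\<phi> p)"
  and endo_field_tangent: "endo_field M \<phi> \<Longrightarrow> p \<in> carrier_of M \<Longrightarrow> u \<in> tangent_space M p \<Longrightarrow> \<phi> p u \<in> tangent_space M p"
  and endo_field_app: "endo_field M \<phi> \<Longrightarrow> X \<in> vector_fields M \<Longrightarrow> app \<phi> X \<in> vector_fields M"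
  unfolding endo_field_def by auto

lemma fundamental_form_tensor2:
  assumes g: "riemannian_metric M g" and \<phi>: "endo_field M \<phi>"
  shows "tensor2 M (fundamental_form g \<phi>)"
proof -
  note lin = tensor2_linear[OF metric_tensor2[OF g]] and fT = endo_field_tangent[OF \<phi>]
  have "linear_map_on (tangent_space M p) (\<lambda>v. g p u (\<phi> p v))" "linear_map_on (tangent_space M p) (\<lambda>v. g p v (\<phi> p u))"
    if p: "p \<in> carrier_of M" and u: "u \<in> tangent_space M p" for p u
  proof -
    show "linear_map_on (tangent_space M p) (\<lambda>v. g p v (\<phi> p u))" by (rule lin(2)[OF p fT[OF p u]])
    show "linear_map_on (tangent_space M p) (\<lambda>v. g p u (\<phi> p v))"
      unfolding linear_map_on_def
      using linear_map_onD[OF endo_field_linear[OF \<phi> p]] linear_map_onD[OF lin(1)[OF p u] fT[OF p] fT[OF p]] by simp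
  qed
  then show ?thesis unfolding tensor2_def fundamental_form_def
    using tensor2_smooth[OF metric_tensor2[OF g] _ endo_field_app[OF \<phi>]] by (simp add: app_apply)
qed

locale acm_manifold =
  fixes M :: "('a, 'e::euclidean_space) mfd" and \<phi> :: "'a endo" and \<xi> :: "'a vfield"
    and \<eta> :: "'a form1" and g :: "'a form2"
  assumes acm: "almost_contact_metric M \<phi> \<xi> \<eta> g"
begin

abbreviation "C \<equiv> carrier_of M"
abbreviation "T \<equiv> tangent_space M"
abbreviation "VF \<equiv> vector_fields M"

lemma M: "smooth_manifold M" and metric: "riemannian_metric M g" and endo: "endo_field M \<phi>"
  and \<xi>_field: "\<xi> \<in> VF" and \<eta>_form: "one_form M \<eta>"
  using acm unfolding almost_contact_metric_def by auto

lemma \<eta>_\<xi>: "p \<in> C \<Longrightarrow> \<eta> p (\<xi> p) = 1"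
  and \<phi>_\<phi>: "p \<in> C \<Longrightarrow> u \<in> T p \<Longrightarrow> \<phi> p (\<phi> p u) = - u + \<eta> p u *\<^sub>R \<xi> p"
  and g_\<phi>_\<phi>: "p \<in> C \<Longrightarrow> u \<in> T p \<Longrightarrow> v \<in> T p \<Longrightarrow> g p (\<phi> p u) (\<phi> p v) = g p u v - \<eta> p u * \<eta> p v"
  using acm unfolding almost_contact_metric_def by auto

lemma \<xi>_T: "p \<in> C \<Longrightarrow> \<xi> p \<in> T p" using vector_fields_tangent[OF \<xi>_field] .

lemmas \<phi>_T = endo_field_tangent[OF endo] and \<phi>_linear = endo_field_linear[OF endo] and \<phi>_field = endo_field_app[OF endo]

lemma g_sym: "p \<in> C \<Longrightarrow> u \<in> T p \<Longrightarrow> v \<in> T p \<Longrightarrow> g p u v = g p v u"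
  by (rule metric_sym[OF metric])

lemmas g_lin = tensor2_linear[OF metric_tensor2[OF metric]]

lemma g_left:
  assumes "p \<in> C" "u \<in> T p" "v \<in> T p" "w \<in> T p"
  shows "g p (u + v) w = g p u w + g p v w" "g p (u - v) w = g p u w - g p v w"
    "g p (- u) w = - g p u w" "g p (a *\<^sub>R u) w = a * g p u w"
  using linear_map_on_add[OF g_lin(2)[OF assms(1,4)] assms(2,3)]
    linear_map_on_diff[OF g_lin(2)[OF assms(1,4)] tangent_space_subspace assms(2,3)]
    linear_map_on_minus[OF g_lin(2)[OF assms(1,4)] tangent_space_subspace assms(2)]
    linear_map_on_scaleR[OF g_lin(2)[OF assms(1,4)] tangent_space_zero assms(2)] by simp_all

lemma g_right:
  assumes "p \<in> C" "u \<in> T p" "v \<in> T p" "w \<in> T p"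
  shows "g p w (u + v) = g p w u + g p w v" "g p w (u - v) = g p w u - g p w v"
    "g p w (- u) = - g p w u" "g p w (a *\<^sub>R u) = a * g p w u"
  using linear_map_on_add[OF g_lin(1)[OF assms(1,4)] assms(2,3)]
    linear_map_on_diff[OF g_lin(1)[OF assms(1,4)] tangent_space_subspace assms(2,3)]
    linear_map_on_minus[OF g_lin(1)[OF assms(1,4)] tangent_space_subspace assms(2)]
    linear_map_on_scaleR[OF g_lin(1)[OF assms(1,4)] tangent_space_zero assms(2)] by simp_all

lemma g_zero:
  assumes "p \<in> C" "u \<in> T p" shows "g p 0 u = 0" "g p u 0 = 0"
  using linear_map_on_zero[OF g_lin(2)[OF assms]] linear_map_on_zero[OF g_lin(1)[OF assms]] by simp_all

lemma \<phi>_zero: "p \<in> C \<Longrightarrow> \<phi> p 0 = 0"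
  by (rule linear_map_on_zero[OF \<phi>_linear tangent_space_zero])

text \<open>Evaluating \<open>\<phi>\<^sup>3\<xi>\<close> in two ways shows that \<open>\<phi>\<xi>\<close> is a multiple of \<open>\<xi>\<close>; as \<open>\<phi>\<^sup>2\<xi> = 0\<close>, the factor vanishes.\<close>

lemma \<phi>_\<xi>:
  assumes p: "p \<in> C" shows "\<phi> p (\<xi> p) = 0"
proof -
  note x = \<xi>_T[OF p] and fx = \<phi>_T[OF p \<xi>_T[OF p]]
  let ?a = "\<eta> p (\<phi> p (\<xi> p))"
  have 1: "\<phi> p (\<phi> p (\<xi> p)) = 0" using \<phi>_\<phi>[OF p x] \<eta>_\<xi>[OF p] by simp
  have "- \<phi> p (\<xi> p) + ?a *\<^sub>R \<xi> p = 0" using \<phi>_\<phi>[OF p fx] 1 \<phi>_zero[OF p] by simp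
  then have 2: "\<phi> p (\<xi> p) = ?a *\<^sub>R \<xi> p" by (metis add.commute add.inverse_inverse minus_unique)
  have "\<phi> p (\<phi> p (\<xi> p)) = ?a *\<^sub>R \<phi> p (\<xi> p)"
    using linear_map_on_scaleR[OF \<phi>_linear[OF p] tangent_space_zero x, of ?a] 2 by simp
  then have "?a *\<^sub>R (\<phi> p (\<xi> p)) = 0" using 1 by simp
  then show ?thesis using 2 by (metis scaleR_eq_0_iff scaleR_zero_left)
qed

lemma \<eta>_\<phi>:
  assumes p: "p \<in> C" and u: "u \<in> T p" shows "\<eta> p (\<phi> p u) = 0"
proof -
  note fu = \<phi>_T[OF p u]
  have "\<phi> p (\<phi> p (\<phi> p u)) = - \<phi> p u + \<eta> p u *\<^sub>R \<phi> p (\<xi> p)"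
    unfolding \<phi>_\<phi>[OF p u]
    using linear_map_on_add[OF \<phi>_linear[OF p] tangent_space_uminus[OF u] tangent_space_scaleR[OF \<xi>_T[OF p]], of "\<eta> p u"]
      linear_map_on_minus[OF \<phi>_linear[OF p] tangent_space_subspace u]
      linear_map_on_scaleR[OF \<phi>_linear[OF p] tangent_space_zero \<xi>_T[OF p], of "\<eta> p u"] by simp
  then have "\<eta> p (\<phi> p u) *\<^sub>R \<xi> p = 0" using \<phi>_\<phi>[OF p fu] \<phi>_\<xi>[OF p] by simp
  moreover have "\<xi> p \<noteq> 0"
    using \<eta>_\<xi>[OF p] linear_map_on_zero[OF one_form_linear[OF \<eta>_form p] tangent_space_zero] by auto
  ultimately show ?thesis using scaleR_eq_0_iff by blast
qed

lemma \<eta>_g: "p \<in> C \<Longrightarrow> u \<in> T p \<Longrightarrow> \<eta> p u = g p u (\<xi> p)"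
  using g_\<phi>_\<phi>[of p u "\<xi> p"] by (simp add: \<phi>_\<xi> \<xi>_T \<phi>_T \<eta>_\<xi> g_zero)

lemma \<phi>_skew:
  assumes p: "p \<in> C" and u: "u \<in> T p" and v: "v \<in> T p"
  shows "g p (\<phi> p u) v = - g p u (\<phi> p v)"
proof -
  note fu = \<phi>_T[OF p u] and fv = \<phi>_T[OF p v] and x = \<xi>_T[OF p]
  have "g p (\<phi> p u) v = g p (\<phi> p (\<phi> p u)) (\<phi> p v)"
    using g_\<phi>_\<phi>[OF p fu v] \<eta>_\<phi>[OF p u] by simp
  also have "\<dots> = - g p u (\<phi> p v) + \<eta> p u * g p (\<phi> p v) (\<xi> p)"
    using g_left(1)[OF p tangent_space_uminus[OF u] tangent_space_scaleR[OF x] fv, of "\<eta> p u"]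
      g_left(3)[OF p u u fv] g_left(4)[OF p x x fv, of "\<eta> p u"] g_sym[OF p x fv]
    by (simp add: \<phi>_\<phi>[OF p u])
  finally show ?thesis using \<eta>_g[OF p fv] \<eta>_\<phi>[OF p v] by simp
qed

lemma g_\<phi>2_left:
  assumes p: "p \<in> C" and u: "u \<in> T p" and v: "v \<in> T p"
  shows "g p (\<phi> p (\<phi> p u)) v = - g p u v + g p u (\<xi> p) * g p (\<xi> p) v"
  using g_left(1)[OF p tangent_space_uminus[OF u] tangent_space_scaleR[OF \<xi>_T[OF p]] v, of "\<eta> p u"]
    g_left(3)[OF p u u v] g_left(4)[OF p \<xi>_T[OF p] \<xi>_T[OF p] v, of "\<eta> p u"]
  by (simp add: \<phi>_\<phi>[OF p u] \<eta>_g[OF p u])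

lemma fundamental_form_skew:
  "p \<in> C \<Longrightarrow> u \<in> T p \<Longrightarrow> v \<in> T p \<Longrightarrow> fundamental_form g \<phi> p u v = - fundamental_form g \<phi> p v u"
  using \<phi>_skew[of p v u] g_sym[of p "\<phi> p v" u] by (simp add: fundamental_form_def \<phi>_T)

end

section \<open>Almost cosymplectic manifolds\<close>

locale almost_cosymplectic_manifold = acm_manifold +
  fixes nabla :: "'a connection"
  assumes lc: "levi_civita M g nabla"
    and closed2: "closed_form2 M (fundamental_form g \<phi>)" and closed1: "closed_form1 M \<eta>"
begin

lemma nabla_field: "X \<in> VF \<Longrightarrow> Y \<in> VF \<Longrightarrow> nabla X Y \<in> VF"
  using lc unfolding levi_civita_def affine_connection_def by blast

lemma nabla_T: "X \<in> VF \<Longrightarrow> Y \<in> VF \<Longrightarrow> p \<in> C \<Longrightarrow> nabla X Y p \<in> T p"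
  using vector_fields_tangent[OF nabla_field] .

lemma torsion_free: "X \<in> VF \<Longrightarrow> Y \<in> VF \<Longrightarrow> p \<in> C \<Longrightarrow> lie_bracket M X Y p = nabla X Y p - nabla Y X p"
  using lc unfolding levi_civita_def by simp

lemma metric_compatible: "X \<in> VF \<Longrightarrow> Y \<in> VF \<Longrightarrow> Z \<in> VF \<Longrightarrow> p \<in> C \<Longrightarrow>
   X p (\<lambda>q. g q (Y q) (Z q)) = g p (nabla X Y p) (Z p) + g p (Y p) (nabla X Z p)"
  using lc unfolding levi_civita_def by blast

lemma nabla_cong_left:
  assumes "X \<in> VF" "X' \<in> VF" "Z \<in> VF" "p \<in> C" "X p = X' p"
  shows "nabla X Z p = nabla X' Z p"
proof (rule tensorial_cong[OF M assms(4), where T="\<lambda>X. nabla X Z p", OF _ _ assms(1,2,5)])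
  show "nabla (\<lambda>q. X q + Y q) Z p = nabla X Z p + nabla Y Z p" if "X \<in> VF" "Y \<in> VF" for X Y
    using lc that assms smooth_funs_const[of 0 M C] unfolding levi_civita_def affine_connection_def by blast
  show "nabla (\<lambda>q. f q *\<^sub>R X q) Z p = f p *\<^sub>R nabla X Z p" if "f \<in> smooth_funs M C" "X \<in> VF" for f X
    using lc that assms unfolding levi_civita_def affine_connection_def by blast
qed

text \<open>This is \<open>g((\<nabla>\<^sub>X \<phi>)Y, Z)\<close>, with the outer \<open>\<phi>\<close> moved to \<open>Z\<close> by skew-symmetry.\<close>

definition F :: "'a vfield \<Rightarrow> 'a vfield \<Rightarrow> 'a vfield \<Rightarrow> 'a \<Rightarrow> real"
  where "F X Y Z p = g p (nabla X (app \<phi> Y) p) (Z p) + g p (nabla X Y p) (\<phi> p (Z p))"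

context
  fixes p X Y Z
  assumes p: "p \<in> C" and X: "X \<in> VF" and Y: "Y \<in> VF" and Z: "Z \<in> VF"
begin

lemma cov_deriv_T: "cov_deriv_endo nabla \<phi> X Y p \<in> T p"
  unfolding cov_deriv_endo_def
  by (intro tangent_space_diff nabla_T X \<phi>_field Y p \<phi>_T)

lemma g_cov_deriv: "g p (cov_deriv_endo nabla \<phi> X Y p) (Z p) = F X Y Z p"
  unfolding cov_deriv_endo_def F_def
  using g_left(2)[OF p nabla_T[OF X \<phi>_field[OF Y] p] \<phi>_T[OF p nabla_T[OF X Y p]] vector_fields_tangent[OF Z p]]
    \<phi>_skew[OF p nabla_T[OF X Y p] vector_fields_tangent[OF Z p]] by simp

lemma F_skew: "F X Y Z p = - F X Z Y p"
proof -
  note [simp] = nabla_T[OF _ _ p] vector_fields_tangent[OF _ p] \<phi>_T[OF p] \<phi>_field X Y Z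
  have n: "smooth_near M p (\<lambda>q. g q (Y q) (app \<phi> Z q))"
    by (rule smooth_nearI[OF openin_carrier p tensor2_smooth[OF metric_tensor2[OF metric] Y \<phi>_field[OF Z]]])
  have "X p (\<lambda>q. g q (app \<phi> Y q) (Z q)) = X p (\<lambda>q. - g q (Y q) (app \<phi> Z q))"
    by (rule tangent_cong[OF M vector_fields_tangent[OF X p] openin_carrier p])
       (simp add: app_apply \<phi>_skew vector_fields_tangent)
  also have "\<dots> = - X p (\<lambda>q. g q (Y q) (app \<phi> Z q))"
    by (rule tangent_uminus[OF vector_fields_tangent[OF X p] n])
  finally show ?thesis
    using metric_compatible[OF X \<phi>_field[OF Y] Z p] metric_compatible[OF X Y \<phi>_field[OF Z] p]
      g_sym[OF p nabla_T[OF X \<phi>_field[OF Z] p] vector_fields_tangent[OF Y p]] g_sym[OF p, of "nabla X Z p" "\<phi> p (Y p)"]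
    by (simp add: F_def app_apply)
qed

end

text \<open>This is \<open>d\<phi> = 0\<close>: as \<open>\<nabla>\<close> is torsion-free and metric, all terms without a derivative of \<open>\<phi>\<close>
  cancel.\<close>

lemma F_cyclic:
  assumes p: "p \<in> C" and X: "X \<in> VF" and Y: "Y \<in> VF" and Z: "Z \<in> VF"
  shows "F X Y Z p + F Y Z X p + F Z X Y p = 0"
proof -
  note T = nabla_T[OF _ _ p] vector_fields_tangent[OF _ p] \<phi>_T[OF p] \<phi>_field X Y Z
  have d: "ext_deriv2 M (fundamental_form g \<phi>) X Y Z p = 0"
    using closed2 X Y Z p unfolding closed_form2_def by blast
  have b: "g p (lie_bracket M X Y p) (\<phi> p (Z p)) = g p (nabla X Y p) (\<phi> p (Z p)) - g p (nabla Y X p) (\<phi> p (Z p))"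
    if "X \<in> VF" "Y \<in> VF" "Z \<in> VF" for X Y Z
    unfolding torsion_free[OF that(1,2) p] by (intro g_left(2) T that p)
  have m: "X p (\<lambda>q. g q (Y q) (\<phi> q (Z q))) = g p (nabla X Y p) (\<phi> p (Z p)) + g p (nabla X (app \<phi> Z) p) (Y p)"
    if "X \<in> VF" "Y \<in> VF" "Z \<in> VF" for X Y Z
    using metric_compatible[OF that(1,2) \<phi>_field[OF that(3)] p]
      g_sym[OF p T(2)[OF that(2)] T(1)[OF that(1) T(4)[OF that(3)]]] by (simp add: app_apply)
  have "F X Z Y p - F Y Z X p + F Z Y X p = 0"
    using d unfolding ext_deriv2_def fundamental_form_def
    by (simp add: m b X Y Z F_def)
  then show ?thesis using F_skew[OF p X Z Y] F_skew[OF p Z Y X] by simp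
qed

text \<open>The covariant derivative of \<open>\<phi>\<^sup>2 = -I + \<eta> \<otimes> \<xi>\<close>. It is computed from the derivative of the function
  \<open>g(\<phi>\<^sup>2 Y, Z)\<close>.\<close>

lemma F_\<phi>:
  assumes p: "p \<in> C" and X: "X \<in> VF" and Y: "Y \<in> VF" and Z: "Z \<in> VF"
  shows "F X (app \<phi> Y) Z p - F X Y (app \<phi> Z) p =
    g p (nabla X \<xi> p) (Y p) * g p (Z p) (\<xi> p) + g p (Y p) (\<xi> p) * g p (nabla X \<xi> p) (Z p)"
proof -
  note XT = vector_fields_tangent[OF X p] and YT = vector_fields_tangent[OF Y p] and ZT = vector_fields_tangent[OF Z p]
  note nT = nabla_T[OF X _ p] and ff = \<phi>_field[OF \<phi>_field[OF Y]]
  have n: "smooth_near M p (\<lambda>q. g q (U q) (V q))" if "U \<in> VF" "V \<in> VF" for U V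
    by (rule smooth_nearI[OF openin_carrier p tensor2_smooth[OF metric_tensor2[OF metric] that]])
  have "X p (\<lambda>q. g q (app \<phi> (app \<phi> Y) q) (Z q)) = X p (\<lambda>q. g q (Y q) (\<xi> q) * g q (Z q) (\<xi> q) - g q (Y q) (Z q))"
  proof (rule tangent_cong[OF M XT openin_carrier p])
    fix q assume q: "q \<in> C"
    show "g q (app \<phi> (app \<phi> Y) q) (Z q) = g q (Y q) (\<xi> q) * g q (Z q) (\<xi> q) - g q (Y q) (Z q)"
      using g_\<phi>2_left[OF q vector_fields_tangent[OF Y q] vector_fields_tangent[OF Z q]]
        g_sym[OF q \<xi>_T[OF q] vector_fields_tangent[OF Z q]] by (simp add: app_apply)
  qed
  also have "\<dots> = X p (\<lambda>q. g q (Y q) (\<xi> q) * g q (Z q) (\<xi> q)) - X p (\<lambda>q. g q (Y q) (Z q))"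
    by (intro tangent_diff[OF XT] smooth_near_mult[OF M] n Y Z \<xi>_field)
  also have "X p (\<lambda>q. g q (Y q) (\<xi> q) * g q (Z q) (\<xi> q)) =
     g p (Y p) (\<xi> p) * X p (\<lambda>q. g q (Z q) (\<xi> q)) + g p (Z p) (\<xi> p) * X p (\<lambda>q. g q (Y q) (\<xi> q))"
    by (rule tangent_leibniz[OF XT n[OF Y \<xi>_field] n[OF Z \<xi>_field]])
  finally have 1: "g p (nabla X (app \<phi> (app \<phi> Y)) p) (Z p) + g p (\<phi> p (\<phi> p (Y p))) (nabla X Z p)
    = g p (Y p) (\<xi> p) * (g p (nabla X Z p) (\<xi> p) + g p (Z p) (nabla X \<xi> p))
      + g p (Z p) (\<xi> p) * (g p (nabla X Y p) (\<xi> p) + g p (Y p) (nabla X \<xi> p))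
      - (g p (nabla X Y p) (Z p) + g p (Y p) (nabla X Z p))"
    using metric_compatible[OF X ff Z p] metric_compatible[OF X Y Z p] metric_compatible[OF X Y \<xi>_field p]
      metric_compatible[OF X Z \<xi>_field p] by (simp add: app_apply)
  have 2: "g p (\<phi> p (\<phi> p (Y p))) (nabla X Z p) = - g p (Y p) (nabla X Z p) + g p (Y p) (\<xi> p) * g p (nabla X Z p) (\<xi> p)"
    using g_\<phi>2_left[OF p YT nT[OF Z]] g_sym[OF p \<xi>_T[OF p] nT[OF Z]] by simp
  have 3: "g p (nabla X Y p) (\<phi> p (\<phi> p (Z p))) = - g p (nabla X Y p) (Z p) + g p (Z p) (\<xi> p) * g p (nabla X Y p) (\<xi> p)"
    using g_\<phi>2_left[OF p ZT nT[OF Y]] g_sym[OF p nT[OF Y] \<phi>_T[OF p \<phi>_T[OF p ZT]]] g_sym[OF p nT[OF Y] ZT]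
      g_sym[OF p nT[OF Y] \<xi>_T[OF p]] by simp
  have 4: "g p (Z p) (nabla X \<xi> p) = g p (nabla X \<xi> p) (Z p)" "g p (Y p) (nabla X \<xi> p) = g p (nabla X \<xi> p) (Y p)"
    using g_sym[OF p _ nT[OF \<xi>_field]] YT ZT by auto
  show ?thesis using 1 2 3 4 unfolding F_def by (simp add: app_apply algebra_simps)
qed

text \<open>This is \<open>d\<eta> = 0\<close>.\<close>

lemma nabla_\<xi>_symmetric:
  assumes p: "p \<in> C" and X: "X \<in> VF" and Y: "Y \<in> VF"
  shows "g p (nabla X \<xi> p) (Y p) = g p (nabla Y \<xi> p) (X p)"
proof -
  have m: "X p (\<lambda>q. \<eta> q (Y q)) = g p (nabla X Y p) (\<xi> p) + g p (nabla X \<xi> p) (Y p)" if X: "X \<in> VF" and Y: "Y \<in> VF" for X Y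
  proof -
    have "X p (\<lambda>q. \<eta> q (Y q)) = X p (\<lambda>q. g q (Y q) (\<xi> q))"
      by (rule tangent_cong[OF M vector_fields_tangent[OF X p] openin_carrier p])
         (simp add: \<eta>_g vector_fields_tangent[OF Y])
    then show ?thesis
      using metric_compatible[OF X Y \<xi>_field p] g_sym[OF p vector_fields_tangent[OF Y p] nabla_T[OF X \<xi>_field p]] by simp
  qed
  have "ext_deriv1 M \<eta> X Y p = 0" using closed1 X Y p unfolding closed_form1_def by blast
  moreover have "\<eta> p (lie_bracket M X Y p) = g p (nabla X Y p) (\<xi> p) - g p (nabla Y X p) (\<xi> p)"
    unfolding torsion_free[OF X Y p]
    using \<eta>_g[OF p tangent_space_diff[OF nabla_T[OF X Y p] nabla_T[OF Y X p]]]
      g_left(2)[OF p nabla_T[OF X Y p] nabla_T[OF Y X p] \<xi>_T[OF p]] by simp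
  ultimately show ?thesis unfolding ext_deriv1_def m[OF X Y] m[OF Y X] by simp
qed

text \<open>Brackets are differences of covariant derivatives, as \<open>\<nabla>\<close> is torsion-free.\<close>

lemma nijenhuis_nabla:
  assumes p: "p \<in> C" and X: "X \<in> VF" and Y: "Y \<in> VF"
  shows "nijenhuis M \<phi> X Y p =
    cov_deriv_endo nabla \<phi> (app \<phi> X) Y p - cov_deriv_endo nabla \<phi> (app \<phi> Y) X p
    - \<phi> p (cov_deriv_endo nabla \<phi> X Y p) + \<phi> p (cov_deriv_endo nabla \<phi> Y X p)"
proof -
  note n = nabla_T[OF _ _ p] and f = \<phi>_field[OF X] \<phi>_field[OF Y]
  note fd = linear_map_on_diff[OF \<phi>_linear[OF p] tangent_space_subspace]
  note ft = \<phi>_T[OF p]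
  show ?thesis
    unfolding nijenhuis_def cov_deriv_endo_def torsion_free[OF X Y p] torsion_free[OF f p]
      torsion_free[OF X f(2) p] torsion_free[OF f(1) Y p]
      fd[OF n[OF X Y] n[OF Y X]] fd[OF ft[OF n[OF X Y]] ft[OF n[OF Y X]]]
      fd[OF n[OF X f(2)] n[OF f(2) X]] fd[OF n[OF f(1) Y] n[OF Y f(1)]]
      fd[OF n[OF X f(2)] ft[OF n[OF X Y]]] fd[OF n[OF Y f(1)] ft[OF n[OF Y X]]]
    by (simp add: algebra_simps)
qed

end

section \<open>Orthogonal decompositions\<close>

lemma metric_annihilator_subspace:
  assumes "riemannian_metric M g" "p \<in> carrier_of M" "w \<in> tangent_space M p"
  shows "subspace {c \<in> tangent_space M p. g p w c = 0}"
proof -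
  note lin = tensor2_linear(1)[OF metric_tensor2[OF assms(1)] assms(2,3)]
  show ?thesis
    using linear_map_on_zero[OF lin tangent_space_zero] linear_map_on_add[OF lin] linear_map_on_scaleR[OF lin tangent_space_zero]
    by (intro subspaceI) (auto intro: tangent_space_add tangent_space_scaleR)
qed

text \<open>One step of the Gram-Schmidt process: the new vector is replaced by its component \<open>?d\<close> orthogonal to
  the previous ones, which may be zero.\<close>

lemma orthogonal_projection_span:
  assumes g: "riemannian_metric M g" and p: "p \<in> carrier_of M"
    and "finite B" "B \<subseteq> tangent_space M p" and u: "u \<in> tangent_space M p"
  shows "\<exists>v\<in>span B. \<forall>b\<in>B. g p (u - v) b = 0"
  using assms(3,4) u
proof (induction B arbitrary: u rule: finite_induct)
  case empty then show ?case by (auto intro: span_zero)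
next
  case (insert b B)
  note lin = tensor2_linear[OF metric_tensor2[OF g] p]
  have B: "B \<subseteq> tangent_space M p" and b: "b \<in> tangent_space M p" and u: "u \<in> tangent_space M p" using insert.prems by auto
  have sB: "span B \<subseteq> tangent_space M p" by (rule span_minimal[OF B tangent_space_subspace])
  obtain v where v: "v \<in> span B" "\<And>c. c \<in> B \<Longrightarrow> g p (u - v) c = 0" using insert.IH[OF B u] by blast
  obtain w where w: "w \<in> span B" "\<And>c. c \<in> B \<Longrightarrow> g p (b - w) c = 0" using insert.IH[OF B b] by blast
  let ?d = "b - w"
  have T: "v \<in> tangent_space M p" "w \<in> tangent_space M p" "?d \<in> tangent_space M p" "u - v \<in> tangent_space M p"
    using v w sB b u by (auto intro: tangent_space_diff)
  have span_sub: "x \<in> span (insert b B)" if "x \<in> span B" for x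
    using that span_mono[of B "insert b B"] by auto
  define a where "a = (if ?d = 0 then 0 else g p (u - v) ?d / g p ?d ?d)"
  have aT: "a *\<^sub>R ?d \<in> tangent_space M p" using T by (intro tangent_space_scaleR)
  have eq: "g p (u - (v + a *\<^sub>R ?d)) c = g p (u - v) c - a * g p ?d c" if "c \<in> tangent_space M p" for c
    using linear_map_on_diff[OF lin(2)[OF that] tangent_space_subspace T(4) aT]
      linear_map_on_scaleR[OF lin(2)[OF that] tangent_space_zero T(3), of a] by (simp add: diff_diff_eq)
  have ort: "g p (u - (v + a *\<^sub>R ?d)) c = 0" if "c \<in> B" for c
    using eq[of c] v(2)[OF that] w(2)[OF that] that B by auto
  have "g p (u - (v + a *\<^sub>R ?d)) ?d = 0"
  proof (cases "?d = 0")
    case True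
    have "u - (v + a *\<^sub>R ?d) \<in> tangent_space M p" using u T(1) aT by (intro tangent_space_diff tangent_space_add)
    then show ?thesis using True linear_map_on_zero[OF lin(1) tangent_space_zero] by metis
  next
    case False
    then have "g p ?d ?d > 0" by (rule metric_pos[OF g p T(3)])
    then show ?thesis using eq[OF T(3)] False by (simp add: a_def)
  qed
  moreover have "g p (u - (v + a *\<^sub>R ?d)) w = 0"
  proof -
    have t: "u - (v + a *\<^sub>R ?d) \<in> tangent_space M p" by (intro tangent_space_diff tangent_space_add u T(1) aT)
    have "B \<subseteq> {c \<in> tangent_space M p. g p (u - (v + a *\<^sub>R ?d)) c = 0}" using ort B by blast
    then have "span B \<subseteq> {c \<in> tangent_space M p. g p (u - (v + a *\<^sub>R ?d)) c = 0}"
      by (rule span_minimal[OF _ metric_annihilator_subspace[OF g p t]])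
    then show ?thesis using w(1) by blast
  qed
  ultimately have "g p (u - (v + a *\<^sub>R ?d)) b = 0"
    using linear_map_on_add[OF lin(1) T(3,2), of "u - (v + a *\<^sub>R ?d)"] u T(1) aT
    by (simp add: tangent_space_diff tangent_space_add)
  moreover have "v + a *\<^sub>R ?d \<in> span (insert b B)"
    by (rule span_add[OF span_sub[OF v(1)] span_scale[OF span_diff[OF span_base[OF insertI1] span_sub[OF w(1)]]]])
  ultimately show ?case using ort by blast
qed

lemma orthogonal_decomposition:
  fixes M :: "('a, 'e::euclidean_space) mfd"
  assumes M: "smooth_manifold M" and g: "riemannian_metric M g" and p: "p \<in> carrier_of M"
    and S: "subspace S" "S \<subseteq> tangent_space M p" and u: "u \<in> tangent_space M p"
  obtains v where "v \<in> S" "u - v \<in> orth_complement M g p S"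
proof -
  obtain W e x \<kappa> where "local_frame M p W e x \<kappa>" using local_frame_exists[OF M p] .
  then interpret local_frame M p W e x \<kappa> .
  have Tspan: "tangent_space M p \<subseteq> span ((\<lambda>b. e b p) ` Basis)"
  proof
    fix u assume "u \<in> tangent_space M p"
    then have "u = (\<Sum>b\<in>Basis. u (x b) *\<^sub>R e b p)" by (rule expand[OF pW])
    also have "\<dots> \<in> span ((\<lambda>b. e b p) ` Basis)"
      by (intro span_sum span_scale span_base imageI)
    finally show "u \<in> span ((\<lambda>b. e b p) ` Basis)" .
  qed
  obtain B where B: "B \<subseteq> S" "independent B" "S \<subseteq> span B" using maximal_independent_subset[of S] by blast
  have "finite B" using independent_span_bound[of "(\<lambda>b. e b p) ` Basis" B] B S Tspan by auto
  then obtain v where v: "v \<in> span B" "\<And>b. b \<in> B \<Longrightarrow> g p (u - v) b = 0"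
    using orthogonal_projection_span[OF g p _ _ u, of B] B S by blast
  have vS: "v \<in> S" using v(1) B(1) S(1) span_minimal by blast
  have uv: "u - v \<in> tangent_space M p" using u vS S by (auto intro: tangent_space_diff)
  have "B \<subseteq> {c \<in> tangent_space M p. g p (u - v) c = 0}" using v(2) B(1) S(2) by blast
  then have "span B \<subseteq> {c \<in> tangent_space M p. g p (u - v) c = 0}"
    by (rule span_minimal[OF _ metric_annihilator_subspace[OF g p uv]])
  then show ?thesis using that[OF vS] uv B(3) unfolding orth_complement_def by blast
qed

lemma orthogonal_independent:
  assumes g: "riemannian_metric M g" and p: "p \<in> carrier_of M"
    and B: "B \<subseteq> tangent_space M p" "0 \<notin> B" "\<And>b c. b \<in> B \<Longrightarrow> c \<in> B \<Longrightarrow> b \<noteq> c \<Longrightarrow> g p b c = 0"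
  shows "independent B"
proof
  assume "dependent B"
  then obtain S u v where S: "finite S" "S \<subseteq> B" "(\<Sum>w\<in>S. u w *\<^sub>R w) = 0" "v \<in> S" "u v \<noteq> 0"
    unfolding dependent_explicit by blast
  have T: "w \<in> tangent_space M p" if "w \<in> S" for w using that S B by auto
  note lin = tensor2_linear(2)[OF metric_tensor2[OF g] p T[OF S(4)]]
  have "0 = g p (\<Sum>w\<in>S. u w *\<^sub>R w) v"
    unfolding S(3) by (rule linear_map_on_zero[OF lin tangent_space_zero, symmetric])
  also have "\<dots> = (\<Sum>w\<in>S. g p (u w *\<^sub>R w) v)"
    by (rule linear_map_on_sum[OF lin tangent_space_subspace]) (intro tangent_space_scaleR T)
  also have "\<dots> = (\<Sum>w\<in>S. u w * g p w v)"
    using linear_map_on_scaleR[OF lin tangent_space_zero T] by (intro sum.cong refl) simp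
  also have "\<dots> = (\<Sum>w\<in>S. if w = v then u v * g p v v else 0)"
    using B(3) S(2,4) by (intro sum.cong refl) auto
  also have "\<dots> = u v * g p v v" using S by simp
  finally show False using metric_pos[OF g p T[OF S(4)]] S B by auto
qed

section \<open>Contact-complex submersions of almost cosymplectic manifolds\<close>

locale cosymplectic_submersion = almost_cosymplectic_manifold M \<phi> \<xi> \<eta> g nabla
  for M :: "('a, 'e::euclidean_space) mfd" and \<phi> \<xi> \<eta> g nabla +
  fixes M' :: "('b, 'd::euclidean_space) mfd" and J :: "'b endo" and g' :: "'b form2" and \<pi> :: "'a \<Rightarrow> 'b"
  assumes submersion: "contact_complex_submersion M \<phi> \<xi> \<eta> g M' J g' \<pi>"
begin

abbreviation "push \<equiv> pushforward M M' \<pi>"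
abbreviation "V \<equiv> vertical_space M M' \<pi>"
abbreviation "H \<equiv> horizontal_space M g M' \<pi>"
abbreviation "sV \<equiv> sections M V"
abbreviation "sH \<equiv> sections M H"

lemma hermitian: "almost_hermitian M' J g'" and riem_sub: "riemannian_submersion M g M' g' \<pi>"
  using submersion unfolding contact_complex_submersion_def by auto

lemma M': "smooth_manifold M'" and metric': "riemannian_metric M' g'" and endo': "endo_field M' J"
  using hermitian unfolding almost_hermitian_def by auto

lemmas J_T = endo_field_tangent[OF endo'] and J_linear = endo_field_linear[OF endo'] and J_field = endo_field_app[OF endo']

lemma \<pi>_smooth: "smooth_map M M' \<pi>" and \<pi>_surj: "\<pi> ` C = carrier_of M'"
  using riem_sub unfolding riemannian_submersion_def by auto

lemma \<pi>_carrier: "p \<in> C \<Longrightarrow> \<pi> p \<in> carrier_of M'" using \<pi>_surj by auto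

lemma push_T: "p \<in> C \<Longrightarrow> u \<in> T p \<Longrightarrow> push p u \<in> tangent_space M' (\<pi> p)"
  by (rule pushforward_tangent[OF M M' \<pi>_smooth])

lemma push_surj: "p \<in> C \<Longrightarrow> push p ` T p = tangent_space M' (\<pi> p)"
  and push_isometry: "p \<in> C \<Longrightarrow> u \<in> H p \<Longrightarrow> v \<in> H p \<Longrightarrow> g' (\<pi> p) (push p u) (push p v) = g p u v"
  using riem_sub unfolding riemannian_submersion_def by auto

lemma push_\<phi>: "p \<in> C \<Longrightarrow> u \<in> T p \<Longrightarrow> push p (\<phi> p u) = J (\<pi> p) (push p u)"
  using submersion unfolding contact_complex_submersion_def by simp

lemma V_iff: "u \<in> V p \<longleftrightarrow> u \<in> T p \<and> push p u = 0" by (simp add: vertical_space_def)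

lemma H_iff: "u \<in> H p \<longleftrightarrow> u \<in> T p \<and> (\<forall>v\<in>V p. g p u v = 0)"
  by (simp add: horizontal_space_def orth_complement_def)

lemma V_subspace: "subspace (V p)"
  by (intro subspaceI) (auto simp: V_iff pushforward_add pushforward_scaleR intro: tangent_space_add tangent_space_scaleR)

lemma V_T: "V p \<subseteq> T p" by (auto simp: V_iff)

lemma g_H_V: "u \<in> H p \<Longrightarrow> v \<in> V p \<Longrightarrow> g p u v = 0" by (auto simp: H_iff)

lemma g_V_H: "p \<in> C \<Longrightarrow> u \<in> H p \<Longrightarrow> v \<in> V p \<Longrightarrow> g p v u = 0"
  using g_sym[of p u v] by (auto simp: H_iff V_iff)

lemma \<xi>_V:
  assumes p: "p \<in> C" shows "\<xi> p \<in> V p"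
proof -
  note b = \<pi>_carrier[OF p] and x = push_T[OF p \<xi>_T[OF p]]
  have "J (\<pi> p) (push p (\<xi> p)) = 0" using push_\<phi>[OF p \<xi>_T[OF p]] \<phi>_\<xi>[OF p] by simp
  moreover have "J (\<pi> p) (J (\<pi> p) (push p (\<xi> p))) = - push p (\<xi> p)"
    using hermitian b x unfolding almost_hermitian_def by blast
  ultimately show ?thesis
    using linear_map_on_zero[OF J_linear[OF b] tangent_space_zero] \<xi>_T[OF p] by (simp add: V_iff)
qed

lemma \<phi>_V: "p \<in> C \<Longrightarrow> u \<in> V p \<Longrightarrow> \<phi> p u \<in> V p"
  using linear_map_on_zero[OF J_linear tangent_space_zero, of "\<pi> p"]
  by (simp add: V_iff push_\<phi> \<phi>_T \<pi>_carrier)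

lemma \<phi>_H: "p \<in> C \<Longrightarrow> u \<in> H p \<Longrightarrow> \<phi> p u \<in> H p"
  using \<phi>_skew[of p u] \<phi>_V[of p] V_T[of p] unfolding H_iff by (auto simp: \<phi>_T)

lemma decompose:
  assumes "p \<in> C" "u \<in> T p" obtains v where "v \<in> V p" "u - v \<in> H p"
  using orthogonal_decomposition[OF M metric assms(1) V_subspace V_T assms(2)]
  unfolding horizontal_space_def by blast

lemma H_V_zero: "p \<in> C \<Longrightarrow> u \<in> H p \<Longrightarrow> u \<in> V p \<Longrightarrow> u = 0"
  using metric_pos[OF metric, of p u] g_H_V[of u p u] by (force simp: H_iff)

lemma H_subspace:
  assumes p: "p \<in> C" shows "subspace (H p)"
proof (rule subspaceI)
  show "0 \<in> H p" using g_zero(1)[OF p] V_T by (auto simp: H_iff)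
  show "u + v \<in> H p" if "u \<in> H p" "v \<in> H p" for u v
    using that by (simp add: H_iff tangent_space_add g_left(1)[OF p] subsetD[OF V_T])
  show "a *\<^sub>R u \<in> H p" if "u \<in> H p" for a u
    using that g_left(4)[OF p _ _ subsetD[OF V_T], of u u] by (simp add: H_iff tangent_space_scaleR)
qed

lemma push_inj_H:
  assumes p: "p \<in> C" and u: "u \<in> H p" "v \<in> H p" and eq: "push p u = push p v" shows "u = v"
proof -
  have d: "u - v \<in> H p" using subspace_diff[OF H_subspace[OF p] u] .
  moreover have "u - v \<in> V p"
    using d eq by (simp add: V_iff H_iff pushforward_diff)
  ultimately have "u - v = 0" by (rule H_V_zero[OF p])
  then show ?thesis by simp
qed

lemma g_push:
  assumes p: "p \<in> C" and h: "h \<in> H p" and u: "u \<in> T p"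
  shows "g p h u = g' (\<pi> p) (push p h) (push p u)" "g p u h = g' (\<pi> p) (push p u) (push p h)"
proof -
  obtain v where v: "v \<in> V p" "u - v \<in> H p" using decompose[OF p u] .
  have T: "h \<in> T p" "v \<in> T p" "u - v \<in> T p" using h v by (auto simp: H_iff V_iff)
  have "push p u = push p (u - v)" using v(1) by (simp add: pushforward_diff V_iff)
  moreover have "g p h u = g p h (u - v)"
    using g_right(2)[OF p u T(2,1)] g_H_V[OF h v(1)] by simp
  ultimately show 1: "g p h u = g' (\<pi> p) (push p h) (push p u)" using push_isometry[OF p h v(2)] by simp
  then show "g p u h = g' (\<pi> p) (push p u) (push p h)"
    using g_sym[OF p u T(1)] metric_sym[OF metric' \<pi>_carrier[OF p] push_T[OF p u] push_T[OF p T(1)]] by simp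
qed

definition hlift :: "'a \<Rightarrow> 'b tvec \<Rightarrow> 'a tvec"
  where "hlift p w = (THE h. h \<in> H p \<and> push p h = w)"

lemma hlift:
  assumes p: "p \<in> C" and w: "w \<in> tangent_space M' (\<pi> p)"
  shows "hlift p w \<in> H p" "push p (hlift p w) = w"
proof -
  have "w \<in> push p ` T p" using push_surj[OF p] w by simp
  then obtain u where u: "w = push p u" "u \<in> T p" by (rule imageE)
  obtain v where v: "v \<in> V p" "u - v \<in> H p" using decompose[OF p u(2)] .
  have e: "u - v \<in> H p \<and> push p (u - v) = w" using u v by (simp add: pushforward_diff V_iff)
  have "\<exists>!h. h \<in> H p \<and> push p h = w"
  proof (rule ex1I[of _ "u - v"])
    show "h = u - v" if "h \<in> H p \<and> push p h = w" for h
      by (rule push_inj_H[OF p]) (use that e in auto)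
  qed (rule e)
  from theI'[OF this] show "hlift p w \<in> H p" "push p (hlift p w) = w"
    unfolding hlift_def by blast+
qed

lemma hlift_push: "p \<in> C \<Longrightarrow> h \<in> H p \<Longrightarrow> hlift p (push p h) = h"
  using hlift[of p "push p h"] push_inj_H[of p] push_T[of p h] by (auto simp: H_iff)

text \<open>The related field on the base is an argument, so that brackets and \<open>\<phi>\<close> can be followed there.\<close>

definition basic :: "'a vfield \<Rightarrow> 'b vfield \<Rightarrow> bool"
  where "basic X X' \<longleftrightarrow> X \<in> sH \<and> X' \<in> vector_fields M' \<and> (\<forall>q\<in>C. push q (X q) = X' (\<pi> q))"

lemma sH_D: "X \<in> sH \<Longrightarrow> X \<in> VF" "X \<in> sH \<Longrightarrow> p \<in> C \<Longrightarrow> X p \<in> H p"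
  by (auto simp: sections_def)

lemma sV_D: "X \<in> sV \<Longrightarrow> X \<in> VF" "X \<in> sV \<Longrightarrow> p \<in> C \<Longrightarrow> X p \<in> V p"
  by (auto simp: sections_def)

lemma basicD: "basic X X' \<Longrightarrow> X \<in> sH" "basic X X' \<Longrightarrow> X' \<in> vector_fields M'"
  "basic X X' \<Longrightarrow> q \<in> C \<Longrightarrow> push q (X q) = X' (\<pi> q)"
  by (auto simp: basic_def)

text \<open>The horizontal lift of \<open>X'\<close> is dual with respect to \<open>g\<close> to the pullback of the 1-form
  \<open>g'(X', \<cdot>)\<close>, hence smooth.\<close>

lemma basic_lift:
  assumes X': "X' \<in> vector_fields M'" shows "basic (\<lambda>p. hlift p (X' (\<pi> p))) X'"
proof -
  note l = hlift[OF _ vector_fields_tangent[OF X' \<pi>_carrier]]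
  have f: "one_form M' (\<lambda>b u. g' b (X' b) u)"
    unfolding one_form_def
    using tensor2_linear(1)[OF metric_tensor2[OF metric'] _ vector_fields_tangent[OF X']]
      tensor2_smooth[OF metric_tensor2[OF metric'] X'] by blast
  have "(\<lambda>p. hlift p (X' (\<pi> p))) \<in> VF"
  proof (rule metric_dual_smooth[OF M metric])
    show "hlift p (X' (\<pi> p)) \<in> T p" if "p \<in> C" for p using l(1)[OF that that] by (simp add: H_iff)
    fix Y assume Y: "Y \<in> VF"
    have "(\<lambda>p. g' (\<pi> p) (X' (\<pi> p)) (push p (Y p))) \<in> smooth_funs M C"
      by (rule pullback1_smooth[OF M M' \<pi>_smooth f Y])
    then show "(\<lambda>p. g p (hlift p (X' (\<pi> p))) (Y p)) \<in> smooth_funs M C"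
      by (rule smooth_funs_cong[OF M openin_carrier, rotated])
         (simp add: g_push(1) l vector_fields_tangent[OF Y])
  qed
  then show ?thesis using l X' by (simp add: basic_def sections_def)
qed

lemma basic_through:
  assumes p: "p \<in> C" and h: "h \<in> H p"
  obtains X X' where "basic X X'" "X p = h"
proof -
  have hT: "h \<in> T p" using h by (simp add: H_iff)
  obtain X' where X': "X' \<in> vector_fields M'" "X' (\<pi> p) = push p h"
    using field_through[OF M' \<pi>_carrier[OF p] push_T[OF p hT]] .
  show ?thesis using that[OF basic_lift[OF X'(1)]] X'(2) hlift_push[OF p h] by simp
qed

text \<open>The vertical part of any field through \<open>v\<close>; its horizontal part is metrically dual to a pullback of
  \<open>g'\<close>, hence smooth.\<close>

lemma vertical_through:
  assumes p: "p \<in> C" and v: "v \<in> V p"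
  obtains U where "U \<in> sV" "U p = v"
proof -
  have "v \<in> T p" using v by (simp add: V_iff)
  then obtain W where W: "W \<in> VF" "W p = v" using field_through[OF M p] by blast
  note WT = vector_fields_tangent[OF W(1)]
  note l = hlift[OF _ push_T[OF _ WT]]
  let ?X = "\<lambda>q. hlift q (push q (W q))"
  have X: "?X \<in> VF"
  proof (rule metric_dual_smooth[OF M metric])
    show "?X q \<in> T q" if "q \<in> C" for q using l(1)[OF that that that] by (simp add: H_iff)
    fix Y assume Y: "Y \<in> VF"
    have "(\<lambda>q. g' (\<pi> q) (push q (W q)) (push q (Y q))) \<in> smooth_funs M C"
      by (rule pullback2_smooth[OF M M' \<pi>_smooth metric_tensor2[OF metric'] W(1) Y])
    then show "(\<lambda>q. g q (?X q) (Y q)) \<in> smooth_funs M C"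
      by (rule smooth_funs_cong[OF M openin_carrier, rotated])
         (simp add: g_push(1) l vector_fields_tangent[OF Y])
  qed
  have "push q (W q - ?X q) = 0" if "q \<in> C" for q using l(2)[OF that that that] by (simp add: pushforward_diff)
  then have "(\<lambda>q. W q - ?X q) \<in> sV"
    using vector_fields_diff[OF M W(1) X] vector_fields_tangent[OF vector_fields_diff[OF M W(1) X]]
    by (simp add: sections_def V_iff)
  moreover have "?X p = 0"
  proof -
    have "push p (W p) = push p 0" using v W(2) by (simp add: V_iff)
    then have "?X p = hlift p (push p 0)" by simp
    also have "\<dots> = 0" by (rule hlift_push[OF p subspace_0[OF H_subspace[OF p]]])
    finally show ?thesis .
  qed
  ultimately show ?thesis using that[of "\<lambda>q. W q - ?X q"] W(2) by simp
qed

lemma vector_eqI: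
  assumes p: "p \<in> C" and u: "u \<in> T p" "u' \<in> T p"
    and eqV: "\<And>U. U \<in> sV \<Longrightarrow> g p u (U p) = g p u' (U p)" and eqH: "\<And>X. X \<in> sH \<Longrightarrow> g p u (X p) = g p u' (X p)"
  shows "u = u'"
proof (rule metric_nondegenerate[OF metric p u])
  fix w assume w: "w \<in> T p"
  obtain v where v: "v \<in> V p" "w - v \<in> H p" using decompose[OF p w] .
  obtain U where U: "U \<in> sV" "U p = v" using vertical_through[OF p v(1)] .
  obtain X X' where X: "basic X X'" "X p = w - v" using basic_through[OF p v(2)] .
  have T: "v \<in> T p" "w - v \<in> T p" using v by (auto simp: H_iff V_iff)
  have "g p z w = g p z v + g p z (w - v)" if "z \<in> T p" for z
    using g_right(1)[OF p T that] by simp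
  then show "g p u w = g p u' w" using u eqV[OF U(1)] eqH[OF basicD(1)[OF X(1)]] U(2) X(2) by simp
qed

lemma app_\<phi>_sV: "U \<in> sV \<Longrightarrow> app \<phi> U \<in> sV"
  using \<phi>_field \<phi>_V by (auto simp: sections_def app_apply)

lemma app_\<phi>_sH: "X \<in> sH \<Longrightarrow> app \<phi> X \<in> sH"
  using \<phi>_field \<phi>_H by (auto simp: sections_def app_apply)

lemma \<xi>_sV: "\<xi> \<in> sV"
  using \<xi>_field \<xi>_V by (auto simp: sections_def)

lemma basic_\<phi>: "basic X X' \<Longrightarrow> basic (app \<phi> X) (app J X')"
  using app_\<phi>_sH[of X] J_field[of X'] push_\<phi> sH_D
  by (auto simp: basic_def app_apply vector_fields_tangent)

text \<open>Vertical fields are related to zero, and so are their brackets with vertical and with basic fields.\<close>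

lemma bracket_vertical:
  assumes U: "U \<in> sV" and p: "p \<in> C"
  shows "W \<in> sV \<Longrightarrow> lie_bracket M U W p \<in> V p" and "basic X X' \<Longrightarrow> lie_bracket M X U p \<in> V p"
proof -
  have U0: "push q (U q) = (\<lambda>_. 0) (\<pi> q)" if "q \<in> C" for q using sV_D(2)[OF U that] by (simp add: V_iff)
  note z = vector_fields_zero[of M']
  show "lie_bracket M U W p \<in> V p" if W: "W \<in> sV"
  proof -
    have W0: "push q (W q) = (\<lambda>_. 0) (\<pi> q)" if "q \<in> C" for q using sV_D(2)[OF W that] by (simp add: V_iff)
    have "push p (lie_bracket M U W p) = lie_bracket M' (\<lambda>_. 0) (\<lambda>_. 0) (\<pi> p)"
      by (rule related_bracket[OF M M' \<pi>_smooth sV_D(1)[OF U] z U0 sV_D(1)[OF W] z W0 p])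
    also have "\<dots> = 0" by (simp add: lie_bracket_def fun_eq_iff)
    finally show ?thesis using lie_bracket_tangent[OF M sV_D(1)[OF U] sV_D(1)[OF W] p] by (simp add: V_iff)
  qed
  show "lie_bracket M X U p \<in> V p" if X: "basic X X'"
  proof -
    note b = basicD(2)[OF X]
    have "push p (lie_bracket M X U p) = lie_bracket M' X' (\<lambda>_. 0) (\<pi> p)"
      by (rule related_bracket[OF M M' \<pi>_smooth sH_D(1)[OF basicD(1)[OF X]] b basicD(3)[OF X] sV_D(1)[OF U] z U0 p])
    also have "\<dots> = 0"
      using tangent_const[OF vector_fields_tangent[OF b \<pi>_carrier[OF p]] \<pi>_carrier[OF p], of 0]
      by (simp add: lie_bracket_def fun_eq_iff)
    finally show ?thesis
      using lie_bracket_tangent[OF M sH_D(1)[OF basicD(1)[OF X]] sV_D(1)[OF U] p] by (simp add: V_iff)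
  qed
qed

lemma nabla_orthogonal:
  assumes p: "p \<in> C" and Z: "Z \<in> VF" and X: "X \<in> sH" and U: "U \<in> sV"
  shows "g p (nabla Z X p) (U p) = - g p (X p) (nabla Z U p)" "g p (nabla Z U p) (X p) = - g p (U p) (nabla Z X p)"
proof -
  note T = vector_fields_tangent[OF _ p] nabla_T[OF Z _ p] and X' = sH_D(1)[OF X] and U' = sV_D(1)[OF U]
  have "Z p (\<lambda>q. g q (X q) (U q)) = Z p (\<lambda>q. 0)"
    by (rule tangent_cong[OF M T(1)[OF Z] openin_carrier p]) (simp add: g_H_V sH_D[OF X] sV_D[OF U])
  then show 1: "g p (nabla Z X p) (U p) = - g p (X p) (nabla Z U p)"
    using metric_compatible[OF Z X' U' p] tangent_const[OF T(1)[OF Z] p, of 0] by simp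
  show "g p (nabla Z U p) (X p) = - g p (U p) (nabla Z X p)"
    using 1 g_sym[OF p T(2)[OF X'] T(1)[OF U']] g_sym[OF p T(2)[OF U'] T(1)[OF X']] by simp
qed

subsection \<open>The horizontal distribution\<close>

text \<open>On horizontal \<open>X, Y\<close> and vertical \<open>U\<close> this is O'Neill's integrability tensor.\<close>

definition \<alpha> :: "'a vfield \<Rightarrow> 'a vfield \<Rightarrow> 'a vfield \<Rightarrow> 'a \<Rightarrow> real"
  where "\<alpha> X Y U p = g p (nabla X Y p) (U p)"

lemma \<alpha>_cong:
  assumes p: "p \<in> C" and X: "X \<in> sH" "X' \<in> sH" "X p = X' p" and Y: "Y \<in> sH" "Y' \<in> sH" "Y p = Y' p" and U: "U \<in> sV"
  shows "\<alpha> X Y U p = \<alpha> X' Y' U p"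
  unfolding \<alpha>_def
  using nabla_orthogonal(1)[OF p sH_D(1)[OF X(1)] Y(1) U] nabla_orthogonal(1)[OF p sH_D(1)[OF X(1)] Y(2) U]
    nabla_cong_left[OF sH_D(1)[OF X(1)] sH_D(1)[OF X(2)] sH_D(1)[OF Y(2)] p X(3)] Y(3) by simp

text \<open>For basic \<open>X\<close> the bracket \<open>[X, U]\<close> is vertical, so that \<open>\<nabla>\<^sub>U X\<close> may be replaced by \<open>\<nabla>\<^sub>X U\<close>.\<close>

lemma nabla_vertical_basic:
  assumes p: "p \<in> C" and X: "basic X X'" and Y: "Y \<in> sH" and U: "U \<in> sV"
  shows "g p (nabla U X p) (Y p) = - \<alpha> X Y U p"
proof -
  note X' = sH_D(1)[OF basicD(1)[OF X]] and U' = sV_D(1)[OF U]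
  note T = nabla_T[OF X' U' p] nabla_T[OF U' X' p] vector_fields_tangent[OF sH_D(1)[OF Y] p]
  have "g p (lie_bracket M X U p) (Y p) = 0"
    by (rule g_V_H[OF p sH_D(2)[OF Y p] bracket_vertical(2)[OF U p X]])
  then have "g p (nabla U X p) (Y p) = g p (nabla X U p) (Y p)"
    unfolding torsion_free[OF X' U' p] using g_left(2)[OF p T] by simp
  then show ?thesis
    using nabla_orthogonal(2)[OF p X' Y U] g_sym[OF p nabla_T[OF X' sH_D(1)[OF Y] p] vector_fields_tangent[OF U' p]]
    by (simp add: \<alpha>_def)
qed

text \<open>O'Neill's tensor is alternating: for basic fields \<open>g(X, Y)\<close> is constant along the fibres.\<close>

lemma \<alpha>_skew_basic:
  assumes p: "p \<in> C" and X: "basic X X'" and Y: "basic Y Y'" and U: "U \<in> sV"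
  shows "\<alpha> X Y U p = - \<alpha> Y X U p"
proof -
  note X' = basicD(1)[OF X] and Y' = basicD(1)[OF Y] and U' = sV_D(1)[OF U]
  let ?f = "\<lambda>b. g' b (X' b) (Y' b)"
  have f: "smooth_near M' (\<pi> p) ?f"
    by (rule smooth_nearI[OF openin_carrier \<pi>_carrier[OF p] tensor2_smooth[OF metric_tensor2[OF metric'] basicD(2)[OF X] basicD(2)[OF Y]]])
  have "U p (\<lambda>q. g q (X q) (Y q)) = U p (?f \<circ> \<pi>)"
    by (rule tangent_cong[OF M vector_fields_tangent[OF U' p] openin_carrier p])
       (simp add: push_isometry[symmetric] sH_D[OF X'] sH_D[OF Y'] basicD(3)[OF X] basicD(3)[OF Y])
  also have "\<dots> = push p (U p) ?f" by (simp add: pushforward_apply[where h=\<pi> and q=p, OF f])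
  also have "\<dots> = 0" using sV_D(2)[OF U p] by (simp add: V_iff)
  finally have "g p (nabla U X p) (Y p) + g p (X p) (nabla U Y p) = 0"
    using metric_compatible[OF U' sH_D(1)[OF X'] sH_D(1)[OF Y'] p] by simp
  moreover have "g p (X p) (nabla U Y p) = g p (nabla U Y p) (X p)"
    by (intro g_sym[OF p] nabla_T[OF U' _ p] vector_fields_tangent sH_D(1) X' Y' p)
  ultimately show ?thesis
    using nabla_vertical_basic[OF p X Y' U] nabla_vertical_basic[OF p Y X' U] by simp
qed

lemma \<alpha>_skew:
  assumes p: "p \<in> C" and X: "X \<in> sH" and Y: "Y \<in> sH" and U: "U \<in> sV"
  shows "\<alpha> X Y U p = - \<alpha> Y X U p"
proof -
  obtain X1 X1' where X1: "basic X1 X1'" "X1 p = X p" using basic_through[OF p sH_D(2)[OF X p]] .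
  obtain Y1 Y1' where Y1: "basic Y1 Y1'" "Y1 p = Y p" using basic_through[OF p sH_D(2)[OF Y p]] .
  show ?thesis
    using \<alpha>_skew_basic[OF p X1(1) Y1(1) U]
      \<alpha>_cong[OF p X basicD(1)[OF X1(1)] X1(2)[symmetric] Y basicD(1)[OF Y1(1)] Y1(2)[symmetric] U]
      \<alpha>_cong[OF p Y basicD(1)[OF Y1(1)] Y1(2)[symmetric] X basicD(1)[OF X1(1)] X1(2)[symmetric] U] by simp
qed

text \<open>The closedness of the fundamental form, evaluated on two horizontal and one vertical argument,
  kills the components along \<open>\<phi> U\<close>.\<close>

lemma \<alpha>_\<phi>:
  assumes p: "p \<in> C" and X: "X \<in> sH" and Y: "Y \<in> sH" and U: "U \<in> sV"
  shows "\<alpha> X Y (app \<phi> U) p = 0"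
proof -
  have main: "\<alpha> X Y (app \<phi> U) p = 0" if Xb: "basic X X'" and Y: "Y \<in> sH" for X X' Y
  proof -
    note X = basicD(1)[OF Xb]
    note XV = sH_D(1)[OF X] and YV = sH_D(1)[OF Y] and UV = sV_D(1)[OF U]
    note fX = app_\<phi>_sH[OF X] and fY = app_\<phi>_sH[OF Y] and fU = app_\<phi>_sV[OF U]
    have F1: "F X Y U p = \<alpha> X (app \<phi> Y) U p + \<alpha> X Y (app \<phi> U) p" by (simp add: F_def \<alpha>_def app_apply)
    have F2: "F Y X U p = \<alpha> Y (app \<phi> X) U p + \<alpha> Y X (app \<phi> U) p" by (simp add: F_def \<alpha>_def app_apply)
    have "F U X Y p = g p (nabla U (app \<phi> X) p) (Y p) + g p (nabla U X p) (app \<phi> Y p)" by (simp add: F_def app_apply)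
    then have F3: "F U X Y p = - \<alpha> (app \<phi> X) Y U p - \<alpha> X (app \<phi> Y) U p"
      using nabla_vertical_basic[OF p basic_\<phi>[OF Xb] Y U] nabla_vertical_basic[OF p Xb fY U] by simp
    have "F X Y U p - F Y X U p + F U X Y p = 0"
      using F_cyclic[OF p XV YV UV] F_skew[OF p YV UV XV] by simp
    then show ?thesis
      unfolding F1 F2 F3 using \<alpha>_skew[OF p Y fX U] \<alpha>_skew[OF p Y X fU] by simp
  qed
  obtain X1 X1' where X1: "basic X1 X1'" "X1 p = X p" using basic_through[OF p sH_D(2)[OF X p]] .
  show ?thesis
    using main[OF X1(1) Y] \<alpha>_cong[OF p X basicD(1)[OF X1(1)] X1(2)[symmetric] Y Y refl app_\<phi>_sV[OF U]] by simp
qed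

text \<open>The component along \<open>\<xi>\<close> is symmetric in \<open>X, Y\<close> because of \<open>d\<eta> = 0\<close>, but also skew; the others are
  covered by \<open>\<alpha>_\<phi>\<close> applied to \<open>\<phi>U\<close>, since \<open>\<phi>\<^sup>2 = -I + \<eta> \<otimes> \<xi>\<close>.\<close>

lemma \<alpha>_zero:
  assumes p: "p \<in> C" and X: "X \<in> sH" and Y: "Y \<in> sH" and U: "U \<in> sV"
  shows "\<alpha> X Y U p = 0"
proof -
  note XV = sH_D(1)[OF X] and YV = sH_D(1)[OF Y]
  have \<xi>: "\<alpha> X Y \<xi> p = - g p (nabla X \<xi> p) (Y p)" if X: "X \<in> sH" and Y: "Y \<in> sH" for X Y
    unfolding \<alpha>_def using nabla_orthogonal(1)[OF p sH_D(1)[OF X] Y \<xi>_sV]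
      g_sym[OF p nabla_T[OF sH_D(1)[OF X] \<xi>_field p] vector_fields_tangent[OF sH_D(1)[OF Y] p]] by simp
  have \<xi>0: "\<alpha> X Y \<xi> p = 0"
    using \<xi>[OF X Y] \<xi>[OF Y X] nabla_\<xi>_symmetric[OF p XV YV] \<alpha>_skew[OF p X Y \<xi>_sV] by simp
  note n = nabla_T[OF XV YV p] and u = vector_fields_tangent[OF sV_D(1)[OF U] p]
  have "g p (nabla X Y p) (\<phi> p (\<phi> p (U p))) = 0"
    using \<alpha>_\<phi>[OF p X Y app_\<phi>_sV[OF U]] by (simp add: \<alpha>_def app_apply)
  then have "- g p (U p) (nabla X Y p) + g p (U p) (\<xi> p) * g p (\<xi> p) (nabla X Y p) = 0"
    using g_\<phi>2_left[OF p u n] g_sym[OF p n \<phi>_T[OF p \<phi>_T[OF p u]]] by simp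
  moreover have "g p (\<xi> p) (nabla X Y p) = 0" using \<xi>0 g_sym[OF p \<xi>_T[OF p] n] by (simp add: \<alpha>_def)
  ultimately show ?thesis using g_sym[OF p n u] by (simp add: \<alpha>_def)
qed

theorem horizontal_totally_geodesic: "totally_geodesic_distribution M nabla H"
  unfolding totally_geodesic_distribution_def
proof (intro ballI)
  fix X Y assume X: "X \<in> sH" and Y: "Y \<in> sH"
  have "nabla X Y p \<in> H p" if p: "p \<in> C" for p
    unfolding H_iff
  proof (intro conjI ballI)
    show "nabla X Y p \<in> T p" by (rule nabla_T[OF sH_D(1)[OF X] sH_D(1)[OF Y] p])
    fix v assume "v \<in> V p"
    then obtain U where "U \<in> sV" "U p = v" using vertical_through[OF p] by blast
    then show "g p (nabla X Y p) v = 0" using \<alpha>_zero[OF p X Y, of U] by (simp add: \<alpha>_def)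
  qed
  then show "nabla X Y \<in> sH" using nabla_field[OF sH_D(1)[OF X] sH_D(1)[OF Y]] by (simp add: sections_def)
qed

lemma horizontal_bracket:
  assumes "X \<in> sH" "Y \<in> sH" "p \<in> C" shows "lie_bracket M X Y p \<in> H p"
  using horizontal_totally_geodesic assms subspace_diff[OF H_subspace[OF assms(3)]]
  unfolding totally_geodesic_distribution_def torsion_free[OF sH_D(1)[OF assms(1)] sH_D(1)[OF assms(2)] assms(3)]
  by (simp add: sections_def)

lemma nabla_horizontal_vertical:
  assumes p: "p \<in> C" and X: "X \<in> sH" and U: "U \<in> sV" and Y: "Y \<in> sH"
  shows "g p (nabla X U p) (Y p) = 0"
  using nabla_orthogonal(2)[OF p sH_D(1)[OF X] Y U] \<alpha>_zero[OF p X Y U]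
    g_sym[OF p nabla_T[OF sH_D(1)[OF X] sH_D(1)[OF Y] p] vector_fields_tangent[OF sV_D(1)[OF U] p]]
  by (simp add: \<alpha>_def)

subsection \<open>The vertical distribution\<close>

text \<open>On horizontal \<open>X\<close> and vertical \<open>U, W\<close> this is the second fundamental form of the fibres.\<close>

definition \<beta> :: "'a vfield \<Rightarrow> 'a vfield \<Rightarrow> 'a vfield \<Rightarrow> 'a \<Rightarrow> real"
  where "\<beta> X U W p = g p (nabla U W p) (X p)"

context
  fixes p X
  assumes p: "p \<in> C" and X: "X \<in> sH"
begin

lemma \<beta>_shape: "U \<in> sV \<Longrightarrow> W \<in> sV \<Longrightarrow> \<beta> X U W p = - g p (W p) (nabla U X p)"
  using nabla_orthogonal(2)[OF p _ X, of U W] sV_D(1) by (simp add: \<beta>_def)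

lemma \<beta>_sym:
  assumes U: "U \<in> sV" and W: "W \<in> sV" shows "\<beta> X U W p = \<beta> X W U p"
proof -
  note U' = sV_D(1)[OF U] and W' = sV_D(1)[OF W]
  have "g p (lie_bracket M U W p) (X p) = 0"
    by (rule g_V_H[OF p sH_D(2)[OF X p] bracket_vertical(1)[OF U p W]])
  then show ?thesis
    unfolding \<beta>_def torsion_free[OF U' W' p]
    using g_left(2)[OF p nabla_T[OF U' W' p] nabla_T[OF W' U' p] vector_fields_tangent[OF sH_D(1)[OF X] p]] by simp
qed

lemma \<beta>_\<phi>_\<phi>_right:
  assumes U: "U \<in> sV" and W: "W \<in> sV"
  shows "\<beta> X U (app \<phi> (app \<phi> W)) p = - \<beta> X U W p + g p (W p) (\<xi> p) * \<beta> X U \<xi> p"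
proof -
  note W' = vector_fields_tangent[OF sV_D(1)[OF W] p] and n = nabla_T[OF sV_D(1)[OF U] sH_D(1)[OF X] p]
  show ?thesis
    unfolding \<beta>_shape[OF U app_\<phi>_sV[OF app_\<phi>_sV[OF W]]] \<beta>_shape[OF U W] \<beta>_shape[OF U \<xi>_sV]
    using g_\<phi>2_left[OF p W' n] by (simp add: app_apply)
qed

lemma F_mixed: "U \<in> sV \<Longrightarrow> W \<in> sV \<Longrightarrow> F U W X p = \<beta> X U (app \<phi> W) p + \<beta> (app \<phi> X) U W p"
  by (simp add: F_def \<beta>_def app_apply)

end

text \<open>In the cyclic identity for \<open>X, U, W\<close>, the two terms that differentiate in a vertical direction are
  expressed by \<open>\<beta>\<close>; the parts with \<open>\<phi>X\<close> cancel by symmetry.\<close>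

lemma F_horizontal_vertical_aux:
  assumes p: "p \<in> C" and X: "X \<in> sH" and U: "U \<in> sV" and W: "W \<in> sV"
  shows "F X U W p = \<beta> X W (app \<phi> U) p - \<beta> X U (app \<phi> W) p"
  using F_cyclic[OF p sH_D(1)[OF X] sV_D(1)[OF U] sV_D(1)[OF W]] F_skew[OF p sV_D(1)[OF W] sH_D(1)[OF X] sV_D(1)[OF U]]
    F_mixed[OF p X U W] F_mixed[OF p X W U] \<beta>_sym[OF p app_\<phi>_sH[OF X] U W] by simp

text \<open>The expression of \<open>F(X; \<cdot>, \<cdot>)\<close> by \<open>\<beta>\<close> is inserted into \<open>F_\<phi>\<close>; the terms with \<open>\<xi>\<close> agree on both sides,
  since \<open>g(\<nabla>\<^sub>X \<xi>, U) = \<beta>(X, U, \<xi>)\<close>.\<close>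

lemma \<beta>_\<phi>:
  assumes p: "p \<in> C" and X: "X \<in> sH" and U: "U \<in> sV" and W: "W \<in> sV"
  shows "\<beta> X (app \<phi> U) (app \<phi> W) p = - \<beta> X U W p"
proof -
  note fU = app_\<phi>_sV[OF U] and fW = app_\<phi>_sV[OF W]
  note s = \<beta>_sym[OF p X]
  have "F X (app \<phi> U) W p - F X U (app \<phi> W) p =
     (- \<beta> X W U p + g p (U p) (\<xi> p) * \<beta> X W \<xi> p) - \<beta> X (app \<phi> U) (app \<phi> W) p
     - \<beta> X (app \<phi> W) (app \<phi> U) p + (- \<beta> X U W p + g p (W p) (\<xi> p) * \<beta> X U \<xi> p)"
    unfolding F_horizontal_vertical_aux[OF p X fU W] F_horizontal_vertical_aux[OF p X U fW]
      \<beta>_\<phi>_\<phi>_right[OF p X W U] \<beta>_\<phi>_\<phi>_right[OF p X U W] by simp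
  moreover have "g p (nabla X \<xi> p) (Z p) = \<beta> X Z \<xi> p" if "Z \<in> sV" for Z
    unfolding \<beta>_def by (rule nabla_\<xi>_symmetric[OF p sH_D(1)[OF X] sV_D(1)[OF that]])
  ultimately show ?thesis
    using F_\<phi>[OF p sH_D(1)[OF X] sV_D(1)[OF U] sV_D(1)[OF W]] s[OF fW fU] s[OF W U] U W by simp
qed

lemma \<beta>_\<xi>:
  assumes p: "p \<in> C" and X: "X \<in> sH" and U: "U \<in> sV" shows "\<beta> X U \<xi> p = 0"
proof -
  note n = nabla_T[OF sV_D(1)[OF app_\<phi>_sV[OF U]] sH_D(1)[OF X] p]
  have "\<beta> X (app \<phi> U) (app \<phi> \<xi>) p = 0"
    unfolding \<beta>_shape[OF p X app_\<phi>_sV[OF U] app_\<phi>_sV[OF \<xi>_sV]] app_apply[of \<phi> \<xi>] \<phi>_\<xi>[OF p] g_zero(1)[OF p n] by simp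
  then show ?thesis using \<beta>_\<phi>[OF p X U \<xi>_sV] by simp
qed

lemma \<beta>_\<phi>_swap:
  assumes p: "p \<in> C" and X: "X \<in> sH" and U: "U \<in> sV" and W: "W \<in> sV"
  shows "\<beta> X (app \<phi> U) W p = \<beta> X U (app \<phi> W) p"
  using \<beta>_\<phi>[OF p X U app_\<phi>_sV[OF W]] \<beta>_\<phi>_\<phi>_right[OF p X app_\<phi>_sV[OF U] W] \<beta>_\<xi>[OF p X app_\<phi>_sV[OF U]] by simp

lemma F_horizontal_vertical:
  assumes p: "p \<in> C" and X: "X \<in> sH" and U: "U \<in> sV"
  shows "W \<in> sV \<Longrightarrow> F X U W p = 0" "Y \<in> sH \<Longrightarrow> F X U Y p = 0"
proof -
  show "F X U W p = 0" if W: "W \<in> sV"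
    using F_horizontal_vertical_aux[OF p X U W] \<beta>_\<phi>_swap[OF p X U W] \<beta>_sym[OF p X app_\<phi>_sV[OF U] W] by simp
  show "F X U Y p = 0" if Y: "Y \<in> sH"
    using nabla_horizontal_vertical[OF p X app_\<phi>_sV[OF U] Y] nabla_horizontal_vertical[OF p X U app_\<phi>_sH[OF Y]]
    by (simp add: F_def app_apply)
qed

theorem nabla_\<phi>_horizontal_vertical:
  assumes p: "p \<in> C" and X: "X \<in> sH" and U: "U \<in> sV"
  shows "cov_deriv_endo nabla \<phi> X U p = 0"
proof (rule vector_eqI[OF p])
  note X' = sH_D(1)[OF X] and U' = sV_D(1)[OF U]
  show "cov_deriv_endo nabla \<phi> X U p \<in> T p" by (rule cov_deriv_T[OF p X' U' X'])
  show "g p (cov_deriv_endo nabla \<phi> X U p) (W p) = g p 0 (W p)" if "W \<in> sV" for W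
    using g_cov_deriv[OF p X' U' sV_D(1)[OF that]] F_horizontal_vertical(1)[OF p X U that]
      g_zero(1)[OF p vector_fields_tangent[OF sV_D(1)[OF that] p]] by simp
  show "g p (cov_deriv_endo nabla \<phi> X U p) (W p) = g p 0 (W p)" if "W \<in> sH" for W
    using g_cov_deriv[OF p X' U' sH_D(1)[OF that]] F_horizontal_vertical(2)[OF p X U that]
      g_zero(1)[OF p vector_fields_tangent[OF sH_D(1)[OF that] p]] by simp
qed simp

text \<open>By the previous theorem only two terms of \<open>N\<^sub>\<phi>(X, \<phi>U)\<close> survive, namely \<open>- (\<nabla>\<^bsub>\<phi>\<phi>U\<^esub> \<phi>)X\<close> and
  \<open>\<phi>(\<nabla>\<^bsub>\<phi>U\<^esub> \<phi>)X\<close>. Neither has a horizontal component, and by the symmetries of \<open>\<beta>\<close> each has the same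
  vertical component as \<open>(\<nabla>\<^sub>U \<phi>)X\<close>.\<close>

theorem nabla_\<phi>_vertical_horizontal:
  assumes p: "p \<in> C" and X: "X \<in> sH" and U: "U \<in> sV"
  shows "cov_deriv_endo nabla \<phi> U X p = (1/2) *\<^sub>R nijenhuis M \<phi> X (app \<phi> U) p"
proof -
  note X' = sH_D(1)[OF X] and fX = app_\<phi>_sH[OF X] and fU = app_\<phi>_sV[OF U] and ffU = app_\<phi>_sV[OF app_\<phi>_sV[OF U]]
  note U' = sV_D(1)[OF U] and fU' = sV_D(1)[OF fU] and ffU' = sV_D(1)[OF ffU]
  let ?A = "cov_deriv_endo nabla \<phi> (app \<phi> (app \<phi> U)) X p" and ?B = "cov_deriv_endo nabla \<phi> (app \<phi> U) X p"
  have A: "?A \<in> T p" and B: "?B \<in> T p" by (rule cov_deriv_T[OF p ffU' X' X'], rule cov_deriv_T[OF p fU' X' X'])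
  have N: "nijenhuis M \<phi> X (app \<phi> U) p = - ?A + \<phi> p ?B"
    unfolding nijenhuis_nabla[OF p X' fU'] nabla_\<phi>_horizontal_vertical[OF p fX fU] nabla_\<phi>_horizontal_vertical[OF p X fU]
    by (simp add: \<phi>_zero[OF p])
  have gN: "g p (nijenhuis M \<phi> X (app \<phi> U) p) (Z p) = - F (app \<phi> (app \<phi> U)) X Z p - F (app \<phi> U) X (app \<phi> Z) p"
    if Z: "Z \<in> VF" for Z
    unfolding N
    using g_left(1)[OF p tangent_space_uminus[OF A] \<phi>_T[OF p B] vector_fields_tangent[OF Z p]]
      g_left(3)[OF p A A vector_fields_tangent[OF Z p]] \<phi>_skew[OF p B vector_fields_tangent[OF Z p]]
      g_cov_deriv[OF p ffU' X' Z] g_cov_deriv[OF p fU' X' \<phi>_field[OF Z]] by (simp add: app_apply)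
  have NT: "nijenhuis M \<phi> X (app \<phi> U) p \<in> T p"
    unfolding N by (intro tangent_space_add tangent_space_uminus \<phi>_T[OF p] A B)
  have FH: "F U X Y p = 0" if Y: "Y \<in> sH" and U: "U \<in> sV" for U Y
    using F_cyclic[OF p sV_D(1)[OF U] X' sH_D(1)[OF Y]] F_skew[OF p X' sH_D(1)[OF Y] sV_D(1)[OF U]]
      F_horizontal_vertical(2)[OF p X U Y] F_horizontal_vertical(2)[OF p Y U X] by simp
  have FV: "F U X W p = - \<beta> X U (app \<phi> W) p - \<beta> (app \<phi> X) U W p" if U: "U \<in> sV" and W: "W \<in> sV" for U W
    using F_skew[OF p sV_D(1)[OF U] X' sV_D(1)[OF W]] F_mixed[OF p X U W] by simp
  show ?thesis
  proof (rule vector_eqI[OF p])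
    show "cov_deriv_endo nabla \<phi> U X p \<in> T p" by (rule cov_deriv_T[OF p U' X' X'])
    show "(1/2) *\<^sub>R nijenhuis M \<phi> X (app \<phi> U) p \<in> T p" by (rule tangent_space_scaleR[OF NT])
    fix W assume W: "W \<in> sV"
    note fW = app_\<phi>_sV[OF W] and W' = sV_D(1)[OF W]
    have "g p (nijenhuis M \<phi> X (app \<phi> U) p) (W p) = 2 * F U X W p"
      unfolding gN[OF W'] FV[OF ffU W] FV[OF fU fW] FV[OF U W]
      using \<beta>_\<phi>[OF p X fU W] \<beta>_\<phi>_swap[OF p X U W] \<beta>_\<phi>_swap[OF p fX fU W] \<beta>_\<phi>[OF p fX U W] \<beta>_\<phi>[OF p X U fW]
      by simp
    then show "g p (cov_deriv_endo nabla \<phi> U X p) (W p) = g p ((1/2) *\<^sub>R nijenhuis M \<phi> X (app \<phi> U) p) (W p)"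
      using g_cov_deriv[OF p U' X' W'] g_left(4)[OF p NT NT vector_fields_tangent[OF W' p], of "1/2"] by simp
  next
    fix Y assume Y: "Y \<in> sH"
    note Y' = sH_D(1)[OF Y]
    have "g p (nijenhuis M \<phi> X (app \<phi> U) p) (Y p) = 0"
      unfolding gN[OF Y'] using FH[OF Y ffU] FH[OF app_\<phi>_sH[OF Y] fU] by simp
    then show "g p (cov_deriv_endo nabla \<phi> U X p) (Y p) = g p ((1/2) *\<^sub>R nijenhuis M \<phi> X (app \<phi> U) p) (Y p)"
      using g_cov_deriv[OF p U' X' Y'] FH[OF Y U] g_left(4)[OF p NT NT vector_fields_tangent[OF Y' p], of "1/2"] by simp
  qed
qed

subsection \<open>The base\<close>

text \<open>On horizontal lifts every term of \<open>d\<phi>\<close> is the pullback of the corresponding term of \<open>d\<Omega>\<close>, because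
  lifts are related to the given fields and \<open>\<pi>\<close> is isometric on horizontal vectors.\<close>

theorem base_almost_kaehler: "almost_kaehler M' J g'"
  unfolding almost_kaehler_def closed_form2_def
proof (intro conjI ballI hermitian)
  fix X' Y' Z' b
  assume X': "X' \<in> vector_fields M'" and Y': "Y' \<in> vector_fields M'" and Z': "Z' \<in> vector_fields M'" and b: "b \<in> carrier_of M'"
  obtain p where p: "p \<in> C" "b = \<pi> p" using \<pi>_surj b by auto
  let ?L = "\<lambda>X' p. hlift p (X' (\<pi> p))" and ?\<Phi> = "fundamental_form g \<phi>" and ?\<Omega> = "fundamental_form g' J"
  note L = basic_lift[OF X'] basic_lift[OF Y'] basic_lift[OF Z']
  note LV = L[THEN basicD(1), THEN sH_D(1)]
  note \<Omega>2 = fundamental_form_tensor2[OF metric' endo']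
  have eq: "?\<Phi> q u (?L Z' q) = ?\<Omega> (\<pi> q) (push q u) (Z' (\<pi> q))"
    if q: "q \<in> C" and u: "u \<in> T q" and Z': "Z' \<in> vector_fields M'" for q u Z'
  proof -
    note bz = basic_lift[OF Z']
    have "?L Z' q \<in> H q" using sH_D(2)[OF basicD(1)[OF bz] q] .
    then have "g q u (\<phi> q (?L Z' q)) = g' (\<pi> q) (push q u) (push q (\<phi> q (?L Z' q)))"
      by (intro g_push(2)[OF q \<phi>_H[OF q]] u)
    also have "push q (\<phi> q (?L Z' q)) = J (\<pi> q) (Z' (\<pi> q))"
      using push_\<phi>[OF q, of "?L Z' q"] basicD(3)[OF bz q] \<open>?L Z' q \<in> H q\<close> by (simp add: H_iff)
    finally show ?thesis by (simp add: fundamental_form_def)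
  qed
  have d: "?L X' p (\<lambda>q. ?\<Phi> q (?L Y' q) (?L Z' q)) = X' b (\<lambda>b. ?\<Omega> b (Y' b) (Z' b))"
    if X': "X' \<in> vector_fields M'" and Y': "Y' \<in> vector_fields M'" and Z': "Z' \<in> vector_fields M'" for X' Y' Z'
  proof -
    note bx = basic_lift[OF X'] and bY = basic_lift[OF Y']
    let ?f = "\<lambda>b. ?\<Omega> b (Y' b) (Z' b)"
    have f: "smooth_near M' (\<pi> p) ?f"
      by (rule smooth_nearI[OF openin_carrier \<pi>_carrier[OF p(1)] tensor2_smooth[OF \<Omega>2 Y' Z']])
    have "?L X' p (\<lambda>q. ?\<Phi> q (?L Y' q) (?L Z' q)) = ?L X' p (?f \<circ> \<pi>)"
    proof (rule tangent_cong[OF M vector_fields_tangent[OF sH_D(1)[OF basicD(1)[OF bx]] p(1)] openin_carrier p(1)])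
      fix q assume q: "q \<in> C"
      show "?\<Phi> q (?L Y' q) (?L Z' q) = (?f \<circ> \<pi>) q"
        using eq[OF q vector_fields_tangent[OF sH_D(1)[OF basicD(1)[OF bY]] q] Z'] basicD(3)[OF bY q] by simp
    qed
    also have "\<dots> = push p (?L X' p) ?f" by (simp add: pushforward_apply[where h=\<pi> and q=p, OF f])
    finally show ?thesis using basicD(3)[OF bx p(1)] p(2) by simp
  qed
  have br: "?\<Phi> p (lie_bracket M (?L X') (?L Y') p) (?L Z' p) = ?\<Omega> b (lie_bracket M' X' Y' b) (Z' b)"
    if X': "X' \<in> vector_fields M'" and Y': "Y' \<in> vector_fields M'" and Z': "Z' \<in> vector_fields M'" for X' Y' Z'
  proof -
    note bx = basic_lift[OF X'] and bY = basic_lift[OF Y']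
    note xv = sH_D(1)[OF basicD(1)[OF bx]] and yv = sH_D(1)[OF basicD(1)[OF bY]]
    show ?thesis
      using eq[OF p(1) lie_bracket_tangent[OF M xv yv p(1)] Z']
        related_bracket[OF M M' \<pi>_smooth xv X' basicD(3)[OF bx] yv Y' basicD(3)[OF bY] p(1)] p(2) by simp
  qed
  have "ext_deriv2 M ?\<Phi> (?L X') (?L Y') (?L Z') p = 0"
    using closed2 LV p(1) unfolding closed_form2_def by blast
  then show "ext_deriv2 M' ?\<Omega> X' Y' Z' b = 0"
    unfolding ext_deriv2_def d[OF X' Y' Z'] d[OF Y' X' Z'] d[OF Z' X' Y'] br[OF X' Y' Z'] br[OF X' Z' Y'] br[OF Y' Z' X'] .
qed

end

section \<open>Fibres\<close>

locale submersion_fibre = cosymplectic_submersion M \<phi> \<xi> \<eta> g nabla M' J g' \<pi>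
  for M :: "('a, 'e::euclidean_space) mfd" and \<phi> \<xi> \<eta> g nabla
    and M' :: "('b, 'd::euclidean_space) mfd" and J g' \<pi> +
  fixes N :: "('a, 'f::euclidean_space) mfd" and b :: 'b
  assumes emb: "embedded_submanifold M N" and fib: "carrier_of N = fibre M \<pi> b"
    and dim: "DIM('f) + DIM('d) = DIM('e)"
begin

abbreviation "inc \<equiv> pushforward N M (\<lambda>x. x)"
abbreviation "TN \<equiv> tangent_space N"

lemma N: "smooth_manifold N" and N_sub: "carrier_of N \<subseteq> C" and inc_smooth: "smooth_map N M (\<lambda>x. x)"
  and N_top: "mtop N = subtopology (mtop M) (carrier_of N)"
  and inc_inj: "p \<in> carrier_of N \<Longrightarrow> inj_on (inc p) (TN p)"
  using emb unfolding embedded_submanifold_def by auto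

lemma NC: "p \<in> carrier_of N \<Longrightarrow> p \<in> C" using N_sub by auto

lemma inc_T: "p \<in> carrier_of N \<Longrightarrow> u \<in> TN p \<Longrightarrow> inc p u \<in> T p"
  using pushforward_tangent[OF N M inc_smooth] by simp

text \<open>\<open>\<pi>\<close> is constant on the fibre, so pullbacks of functions of the base are constant along it.\<close>

lemma inc_V:
  assumes p: "p \<in> carrier_of N" and u: "u \<in> TN p" shows "inc p u \<in> V p"
proof -
  have "push p (inc p u) = 0"
  proof
    fix f
    show "push p (inc p u) f = 0 f"
    proof (cases "smooth_near M' (\<pi> p) f")
      case True
      have "smooth_near M p (f \<circ> \<pi>)" by (rule smooth_near_pullback[OF M M' \<pi>_smooth NC[OF p] True])
      then have "push p (inc p u) f = u (f \<circ> \<pi> \<circ> (\<lambda>x. x))" using True by (simp add: pushforward_def)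
      also have "\<dots> = u (\<lambda>_. f b)"
        by (rule tangent_cong[OF N u openin_carrier p]) (simp add: fib fibre_def)
      also have "\<dots> = 0" by (rule tangent_const[OF u p])
      finally show ?thesis by simp
    qed (simp add: pushforward_def)
  qed
  then show ?thesis using inc_T[OF p u] by (simp add: V_iff)
qed

text \<open>The tangent spaces of the fibre and the horizontal space intersect trivially and have
  complementary dimensions.\<close>

lemma tangent_in_eq_V:
  assumes p: "p \<in> carrier_of N" shows "tangent_in M N p = V p"
proof
  show "tangent_in M N p \<subseteq> V p" unfolding tangent_in_def using inc_V[OF p] by auto
  obtain W e x \<kappa> where fr: "local_frame M p W e x \<kappa>" using local_frame_exists[OF M NC[OF p]] .
  obtain W1 e1 x1 \<kappa>1 where fr1: "local_frame N p W1 e1 x1 \<kappa>1" using local_frame_exists[OF N p] .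
  obtain W2 e2 x2 \<kappa>2 where fr2: "local_frame M' (\<pi> p) W2 e2 x2 \<kappa>2"
    using local_frame_exists[OF M' \<pi>_carrier[OF NC[OF p]]] .
  interpret A: local_frame M p W e x \<kappa> by (rule fr)
  interpret A1: local_frame N p W1 e1 x1 \<kappa>1 by (rule fr1)
  interpret A2: local_frame M' "\<pi> p" W2 e2 x2 \<kappa>2 by (rule fr2)
  note C = NC[OF p]
  let ?h = "\<lambda>c. \<Sum>j\<in>Basis. (c \<bullet> j) *\<^sub>R hlift p (e2 j (\<pi> p))"
  have hl: "hlift p (e2 j (\<pi> p)) \<in> H p" "push p (hlift p (e2 j (\<pi> p))) = e2 j (\<pi> p)" for j
    by (rule hlift[OF C A2.e_tangent[OF A2.pW]])+
  have hH: "?h c \<in> H p" for c by (intro subspace_sum[OF H_subspace[OF C]] subspace_scale[OF H_subspace[OF C]] hl)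
  have hp: "push p (?h c) = A2.comb (\<pi> p) c" for c
    unfolding pushforward_sum pushforward_scaleR hl(2) A2.comb_def ..
  define I where "I a = A.coords (inc p (A1.comb p a))" for a
  define L where "L c = A.coords (?h c)" for c
  have linI: "linear I"
    by (rule linearI) (simp_all only: I_def A1.comb_add A1.comb_scaleR pushforward_add pushforward_scaleR A.coords_add A.coords_scaleR)
  have linL: "linear L"
    by (rule linearI)
       (simp_all only: L_def inner_add_left inner_scaleR_left scaleR_add_left sum.distrib scaleR_scaleR[symmetric]
         scaleR_sum_right[symmetric] A.coords_add A.coords_scaleR)
  note iT = A1.comb_tangent[OF A1.pW]
  have Ia: "A.comb p (I a) = inc p (A1.comb p a)" for a
    unfolding I_def by (rule A.comb_coords[OF A.pW inc_T[OF p iT]])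
  have Lc: "A.comb p (L c) = ?h c" for c
    unfolding L_def using hH[of c] by (intro A.comb_coords[OF A.pW]) (simp add: H_iff)
  have int: "a = 0 \<and> c = 0" if eq: "I a = L c" for a c
  proof -
    have 1: "inc p (A1.comb p a) = ?h c" using Ia[of a] Lc[of c] eq by simp
    then have "?h c = 0" using H_V_zero[OF C hH] inc_V[OF p iT[of a]] by simp
    then have "A2.comb (\<pi> p) c = 0" "inc p (A1.comb p a) = inc p 0" using hp[of c] 1 by simp_all
    then have "A2.comb (\<pi> p) c = A2.comb (\<pi> p) 0" "A1.comb p a = 0"
      using inj_onD[OF inc_inj[OF p] _ iT tangent_space_zero] by (simp_all add: A2.comb_def)
    moreover have "A1.comb p 0 = 0" by (simp add: A1.comb_def)
    ultimately show ?thesis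
      using A2.coords_comb[OF A2.pW, of c] A2.coords_comb[OF A2.pW, of 0] A1.coords_comb[OF A1.pW, of a]
        A1.coords_comb[OF A1.pW, of 0] by metis
  qed
  have "inj I" unfolding linear_inj_iff_eq_0[OF linI] using int[of _ 0] linear_0[OF linL] by auto
  then have dI: "dim (range I) = DIM('f)" using dim_image_eq[OF linI, of UNIV] by simp
  have "inj L" unfolding linear_inj_iff_eq_0[OF linL] using int[of 0] linear_0[OF linI] by auto
  then have dL: "dim (range L) = DIM('d)" using dim_image_eq[OF linL, of UNIV] by simp
  have sI: "subspace (range I)" and sL: "subspace (range L)"
    by (rule linear_subspace_image[OF linI subspace_UNIV], rule linear_subspace_image[OF linL subspace_UNIV])
  have "range I \<inter> range L \<subseteq> {0}" using int linear_0[OF linI] by fastforce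
  then have d0: "dim (range I \<inter> range L) = 0" by simp
  then have "dim {y + z |y z. y \<in> range I \<and> z \<in> range L} = DIM('e)"
    using dim_sums_Int[OF sI sL] dI dL dim d0 by linarith
  then have full: "{y + z |y z. y \<in> range I \<and> z \<in> range L} = UNIV"
    using dim_eq_full subspace_sums[OF sI sL] by (metis (no_types, lifting) span_eq_iff)
  show "V p \<subseteq> tangent_in M N p"
  proof
    fix v assume v: "v \<in> V p"
    then have vT: "v \<in> T p" by (simp add: V_iff)
    obtain a c where ac: "A.coords v = I a + L c" using full by blast
    have "v = A.comb p (I a + L c)" using A.comb_coords[OF A.pW vT] ac by simp
    then have eq: "v = inc p (A1.comb p a) + ?h c" by (simp only: A.comb_add Ia Lc)
    then have "?h c = v - inc p (A1.comb p a)" by simp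
    then have "?h c \<in> V p" using subspace_diff[OF V_subspace v inc_V[OF p iT]] by simp
    then have "?h c = 0" by (rule H_V_zero[OF C hH])
    then show "v \<in> tangent_in M N p" using eq iT unfolding tangent_in_def by simp
  qed
qed

lemma pull_vec:
  assumes "p \<in> carrier_of N" "v \<in> V p"
  shows "pull_vec M N p v \<in> TN p" "inc p (pull_vec M N p v) = v"
  using assms(2) unfolding tangent_in_eq_V[OF assms(1), symmetric] pull_vec_def tangent_in_def
  by (auto simp: f_inv_into_f inv_into_into)

lemma inc_eqI: "p \<in> carrier_of N \<Longrightarrow> u \<in> TN p \<Longrightarrow> v \<in> TN p \<Longrightarrow> inc p u = inc p v \<Longrightarrow> u = v"
  using inj_onD[OF inc_inj] by blast

abbreviation "\<phi>N \<equiv> induced_endo M N \<phi>"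
abbreviation "\<xi>N \<equiv> induced_vfield M N \<xi>"
abbreviation "\<eta>N \<equiv> induced_form1 M N \<eta>"
abbreviation "gN \<equiv> induced_form2 M N g"

lemma \<phi>N:
  assumes p: "p \<in> carrier_of N" and u: "u \<in> TN p"
  shows "\<phi>N p u \<in> TN p" "inc p (\<phi>N p u) = \<phi> p (inc p u)"
  unfolding induced_endo_def using pull_vec[OF p \<phi>_V[OF NC[OF p] inc_V[OF p u]]] by auto

lemma \<xi>N:
  assumes p: "p \<in> carrier_of N" shows "\<xi>N p \<in> TN p" "inc p (\<xi>N p) = \<xi> p"
  unfolding induced_vfield_def using pull_vec[OF p \<xi>_V[OF NC[OF p]]] by auto

lemma gN_metric: "riemannian_metric N gN"
  unfolding riemannian_metric_def
proof (intro conjI ballI impI)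
  fix p u assume p: "p \<in> carrier_of N" and u: "u \<in> TN p"
  note lin = g_lin(1)[OF NC[OF p] inc_T[OF p u]]
  show "linear_map_on (TN p) (gN p u)"
    unfolding linear_map_on_def induced_form2_def pushforward_add pushforward_scaleR
    using linear_map_onD[OF lin inc_T[OF p] inc_T[OF p]] by blast
  show "gN p u v = gN p v u" if "v \<in> TN p" for v
    unfolding induced_form2_def by (rule g_sym[OF NC[OF p] inc_T[OF p u] inc_T[OF p that]])
  show "gN p u u > 0" if "u \<noteq> 0"
  proof -
    have "inc p u \<noteq> 0" using inc_eqI[OF p u tangent_space_zero] that by auto
    then show ?thesis unfolding induced_form2_def by (rule metric_pos[OF metric NC[OF p] inc_T[OF p u]])
  qed
next
  fix X Y assume "X \<in> vector_fields N" "Y \<in> vector_fields N"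
  from pullback2_smooth[OF N M inc_smooth metric_tensor2[OF metric] this]
  show "(\<lambda>p. gN p (X p) (Y p)) \<in> smooth_funs N (carrier_of N)" by (simp add: induced_form2_def)
qed

text \<open>Smoothness of \<open>\<phi>N X\<close> holds because its metric dual is a contraction of the pulled back fundamental form.\<close>

lemma \<phi>N_endo: "endo_field N \<phi>N"
  unfolding endo_field_def
proof (intro conjI ballI)
  fix p assume p: "p \<in> carrier_of N"
  note C = NC[OF p]
  show "\<phi>N p ` TN p \<subseteq> TN p" using \<phi>N(1)[OF p] by auto
  show "linear_map_on (TN p) (\<phi>N p)"
    unfolding linear_map_on_def
  proof (intro ballI allI)
    fix u v a assume u: "u \<in> TN p" and v: "v \<in> TN p"
    have uv: "a *\<^sub>R u + v \<in> TN p" by (intro tangent_space_add tangent_space_scaleR u v)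
    show "\<phi>N p (a *\<^sub>R u + v) = a *\<^sub>R \<phi>N p u + \<phi>N p v"
    proof (rule inc_eqI[OF p \<phi>N(1)[OF p uv]])
      show "a *\<^sub>R \<phi>N p u + \<phi>N p v \<in> TN p" by (intro tangent_space_add tangent_space_scaleR \<phi>N(1)[OF p] u v)
      show "inc p (\<phi>N p (a *\<^sub>R u + v)) = inc p (a *\<^sub>R \<phi>N p u + \<phi>N p v)"
        unfolding \<phi>N(2)[OF p uv] pushforward_add pushforward_scaleR \<phi>N(2)[OF p u] \<phi>N(2)[OF p v]
        by (rule linear_map_onD[OF \<phi>_linear[OF C] inc_T[OF p u] inc_T[OF p v]])
    qed
  qed
next
  fix X assume X: "X \<in> vector_fields N"
  show "app \<phi>N X \<in> vector_fields N"
  proof (rule metric_dual_smooth[OF N gN_metric])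
    show "app \<phi>N X p \<in> TN p" if "p \<in> carrier_of N" for p
      unfolding app_apply by (rule \<phi>N(1)[OF that vector_fields_tangent[OF X that]])
    fix Y assume Y: "Y \<in> vector_fields N"
    from pullback2_smooth[OF N M inc_smooth fundamental_form_tensor2[OF metric endo] Y X]
    have "(\<lambda>q. g q (inc q (Y q)) (\<phi> q (inc q (X q)))) \<in> smooth_funs N (carrier_of N)"
      by (simp add: fundamental_form_def)
    then show "(\<lambda>p. gN p (app \<phi>N X p) (Y p)) \<in> smooth_funs N (carrier_of N)"
    proof (rule smooth_funs_cong[OF N openin_carrier, rotated])
      fix q assume q: "q \<in> carrier_of N"
      note xT = vector_fields_tangent[OF X q] and yT = vector_fields_tangent[OF Y q]
      show "g q (inc q (Y q)) (\<phi> q (inc q (X q))) = gN q (app \<phi>N X q) (Y q)"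
        unfolding induced_form2_def app_apply \<phi>N(2)[OF q xT]
        by (rule g_sym[OF NC[OF q] inc_T[OF q yT] \<phi>_T[OF NC[OF q] inc_T[OF q xT]]])
    qed
  qed
qed

lemma \<eta>N_form: "one_form N \<eta>N"
  unfolding one_form_def
proof (intro conjI ballI)
  show "linear_map_on (TN p) (\<eta>N p)" if p: "p \<in> carrier_of N" for p
    unfolding linear_map_on_def induced_form1_def pushforward_add pushforward_scaleR
    using linear_map_onD[OF one_form_linear[OF \<eta>_form NC[OF p]] inc_T[OF p] inc_T[OF p]] by blast
  show "(\<lambda>p. \<eta>N p (X p)) \<in> smooth_funs N (carrier_of N)" if "X \<in> vector_fields N" for X
    using pullback1_smooth[OF N M inc_smooth \<eta>_form that] by (simp add: induced_form1_def)
qed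

lemma \<xi>N_field: "\<xi>N \<in> vector_fields N"
proof (rule metric_dual_smooth[OF N gN_metric \<xi>N(1)])
  fix Y assume Y: "Y \<in> vector_fields N"
  have "(\<lambda>p. \<eta>N p (Y p)) \<in> smooth_funs N (carrier_of N)" by (rule one_form_smooth[OF \<eta>N_form Y])
  then show "(\<lambda>p. gN p (\<xi>N p) (Y p)) \<in> smooth_funs N (carrier_of N)"
  proof (rule smooth_funs_cong[OF N openin_carrier, rotated])
    fix q assume q: "q \<in> carrier_of N"
    note yT = inc_T[OF q vector_fields_tangent[OF Y q]]
    show "\<eta>N q (Y q) = gN q (\<xi>N q) (Y q)"
      unfolding induced_form2_def induced_form1_def \<xi>N(2)[OF q] \<eta>_g[OF NC[OF q] yT]
      by (rule g_sym[OF NC[OF q] yT \<xi>_T[OF NC[OF q]]])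
  qed
qed

theorem fibre_almost_cosymplectic:
  assumes odd: "odd DIM('f)"
  shows "almost_cosymplectic N \<phi>N \<xi>N \<eta>N gN"
  unfolding almost_cosymplectic_def almost_contact_metric_def
proof (intro conjI ballI N odd gN_metric \<phi>N_endo \<xi>N_field \<eta>N_form)
  fix p assume p: "p \<in> carrier_of N"
  note C = NC[OF p]
  show "\<eta>N p (\<xi>N p) = 1" unfolding induced_form1_def \<xi>N(2)[OF p] by (rule \<eta>_\<xi>[OF C])
  fix u assume u: "u \<in> TN p"
  show "\<phi>N p (\<phi>N p u) = - u + \<eta>N p u *\<^sub>R \<xi>N p"
  proof (rule inc_eqI[OF p])
    show "\<phi>N p (\<phi>N p u) \<in> TN p" by (intro \<phi>N(1)[OF p] u)
    show "- u + \<eta>N p u *\<^sub>R \<xi>N p \<in> TN p" by (intro tangent_space_add tangent_space_uminus tangent_space_scaleR u \<xi>N[OF p])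
    show "inc p (\<phi>N p (\<phi>N p u)) = inc p (- u + \<eta>N p u *\<^sub>R \<xi>N p)"
      unfolding \<phi>N(2)[OF p \<phi>N(1)[OF p u]] \<phi>N(2)[OF p u] pushforward_add pushforward_uminus pushforward_scaleR \<xi>N(2)[OF p]
        induced_form1_def by (rule \<phi>_\<phi>[OF C inc_T[OF p u]])
  qed
  fix v assume v: "v \<in> TN p"
  show "gN p (\<phi>N p u) (\<phi>N p v) = gN p u v - \<eta>N p u * \<eta>N p v"
    unfolding induced_form2_def induced_form1_def \<phi>N(2)[OF p u] \<phi>N(2)[OF p v]
    by (rule g_\<phi>_\<phi>[OF C inc_T[OF p u] inc_T[OF p v]])
next
  have "closed_form2 N (\<lambda>q u v. fundamental_form g \<phi> q (inc q u) (inc q v))"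
    using pullback2_closed[OF N M inc_smooth fundamental_form_tensor2[OF metric endo] closed2 fundamental_form_skew] by simp
  then show "closed_form2 N (fundamental_form gN \<phi>N)"
  proof (rule closed_form2_cong[OF N])
    fix p u v assume p: "p \<in> carrier_of N" and v: "v \<in> TN p"
    show "fundamental_form g \<phi> p (inc p u) (inc p v) = fundamental_form gN \<phi>N p u v"
      unfolding fundamental_form_def induced_form2_def \<phi>N(2)[OF p v] ..
  qed
  show "closed_form1 N \<eta>N"
    using pullback1_closed[OF N M inc_smooth \<eta>_form closed1] by (simp add: induced_form1_def[abs_def])
qed

lemma normal_component:
  assumes p: "p \<in> carrier_of N" and u: "u \<in> T p"
  shows "normal_component M g N p u \<in> H p" "u - normal_component M g N p u \<in> V p"
proof -
  note C = NC[OF p]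
  obtain v where v: "v \<in> V p" "u - v \<in> H p" using decompose[OF C u] .
  have "\<exists>!w. w \<in> H p \<and> u - w \<in> V p"
  proof (rule ex1I[of _ "u - v"])
    show "u - v \<in> H p \<and> u - (u - v) \<in> V p" using v by simp
    fix w assume w: "w \<in> H p \<and> u - w \<in> V p"
    have "v - (u - w) \<in> V p" using subspace_diff[OF V_subspace v(1)] w by blast
    moreover have "w - (u - v) \<in> H p" using subspace_diff[OF H_subspace[OF C]] w v(2) by blast
    moreover have "v - (u - w) = w - (u - v)" by simp
    ultimately have "w - (u - v) = 0" using H_V_zero[OF C] by metis
    then show "w = u - v" by simp
  qed
  from theI'[OF this]
  show "normal_component M g N p u \<in> H p" "u - normal_component M g N p u \<in> V p"
    unfolding normal_component_def tangent_in_eq_V[OF p] horizontal_space_def by blast+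
qed

text \<open>Otherwise the remainder would extend the \<open>E i\<close> to more independent vectors than the dimension of the
  fibre permits.\<close>

lemma orthonormal_expansion:
  fixes E :: "nat \<Rightarrow> 'a tvec"
  assumes p: "p \<in> carrier_of N" and E: "\<And>i. i < DIM('f) \<Longrightarrow> E i \<in> V p"
    and on: "\<And>i j. i < DIM('f) \<Longrightarrow> j < DIM('f) \<Longrightarrow> g p (E i) (E j) = (if i = j then 1 else 0)"
    and v: "v \<in> V p"
  shows "v = (\<Sum>i<DIM('f). g p v (E i) *\<^sub>R E i)"
proof (rule ccontr)
  assume neq: "\<not> ?thesis"
  note C = NC[OF p]
  have ET: "E i \<in> T p" if "i < DIM('f)" for i using E[OF that] V_T by auto
  let ?s = "\<Sum>i<DIM('f). g p v (E i) *\<^sub>R E i"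
  have sT: "?s \<in> T p" by (intro tangent_space_sum tangent_space_scaleR ET) simp
  have sV: "?s \<in> V p" by (intro subspace_sum[OF V_subspace] subspace_scale[OF V_subspace] E) simp
  define r where "r = v - ?s"
  have r: "r \<in> V p" "r \<noteq> 0" using subspace_diff[OF V_subspace v sV] neq by (simp_all add: r_def)
  have vT: "v \<in> T p" and rT: "r \<in> T p" using v r V_T by auto
  have rE: "g p r (E j) = 0" if j: "j < DIM('f)" for j
  proof -
    have "g p ?s (E j) = (\<Sum>i<DIM('f). g p (g p v (E i) *\<^sub>R E i) (E j))"
      by (rule linear_map_on_sum[OF g_lin(2)[OF C ET[OF j]] tangent_space_subspace]) (intro tangent_space_scaleR ET, simp)
    also have "\<dots> = (\<Sum>i<DIM('f). if i = j then g p v (E j) else 0)"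
      by (intro sum.cong refl) (use g_left(4)[OF C ET ET ET[OF j]] on j in auto)
    also have "\<dots> = g p v (E j)" using j by simp
    finally show ?thesis unfolding r_def using g_left(2)[OF C vT sT ET[OF j]] by simp
  qed
  have injE: "inj_on E {..<DIM('f)}"
  proof (rule inj_onI)
    fix i j assume "i \<in> {..<DIM('f)}" "j \<in> {..<DIM('f)}" "E i = E j"
    then show "i = j" using on[of i j] on[of j j] by (auto split: if_splits)
  qed
  have rnE: "r \<notin> E ` {..<DIM('f)}" using rE metric_pos[OF metric C rT r(2)] by fastforce
  have E0: "E i \<noteq> 0" if "i < DIM('f)" for i using on[OF that that] g_zero(1)[OF C ET[OF that]] by auto
  have "independent (insert r (E ` {..<DIM('f)}))"
  proof (rule orthogonal_independent[OF metric C])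
    show "insert r (E ` {..<DIM('f)}) \<subseteq> T p" using rT ET by auto
    show "0 \<notin> insert r (E ` {..<DIM('f)})"
    proof
      assume "0 \<in> insert r (E ` {..<DIM('f)})"
      then obtain i where "i < DIM('f)" "0 = E i" using r(2) by blast
      then show False using E0[of i] by simp
    qed
    fix y z assume y: "y \<in> insert r (E ` {..<DIM('f)})" and z: "z \<in> insert r (E ` {..<DIM('f)})" and yz: "y \<noteq> z"
    have Er: "g p (E j) r = 0" if "j < DIM('f)" for j using rE[OF that] g_sym[OF C ET[OF that] rT] by simp
    show "g p y z = 0" using y z yz rE Er on by auto
  qed
  moreover obtain W1 e1 x1 \<kappa>1 where fr1: "local_frame N p W1 e1 x1 \<kappa>1" using local_frame_exists[OF N p] .
  moreover have "insert r (E ` {..<DIM('f)}) \<subseteq> span ((\<lambda>j. inc p (e1 j p)) ` Basis)"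
  proof
    interpret A1: local_frame N p W1 e1 x1 \<kappa>1 by (rule fr1)
    fix y assume "y \<in> insert r (E ` {..<DIM('f)})"
    then have "y \<in> V p" using r E by auto
    then obtain u where u: "u \<in> TN p" "y = inc p u" unfolding tangent_in_eq_V[OF p, symmetric] tangent_in_def by blast
    have "y = inc p (\<Sum>j\<in>Basis. u (x1 j) *\<^sub>R e1 j p)" using A1.expand[OF A1.pW u(1)] u(2) by simp
    also have "\<dots> \<in> span ((\<lambda>j. inc p (e1 j p)) ` Basis)"
      unfolding pushforward_sum pushforward_scaleR by (intro span_sum span_scale span_base imageI)
    finally show "y \<in> span ((\<lambda>j. inc p (e1 j p)) ` Basis)" .
  qed
  ultimately have "card (insert r (E ` {..<DIM('f)})) \<le> card ((\<lambda>j. inc p (e1 j p)) ` (Basis :: 'f set))"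
    using independent_span_bound[OF finite_imageI[OF finite_Basis]] by blast
  also have "\<dots> \<le> DIM('f)" by (rule card_image_le[OF finite_Basis])
  finally show False using rnE card_image[OF injE] by simp
qed

text \<open>For fields tangent to the fibre, \<open>g(\<nabla>\<^sub>E E, X)\<close> depends on the value of \<open>E\<close> at the point only;
  so the given fields may be replaced by vertical ones.\<close>

lemma second_fundamental_form_vertical:
  assumes p: "p \<in> carrier_of N" and E: "E \<in> VF" and tan: "tangent_near M N p E"
    and U: "U \<in> sV" "U p = E p" and X: "X \<in> sH"
  shows "g p (nabla E E p) (X p) = \<beta> X U U p"
proof -
  note C = NC[OF p] and X' = sH_D(1)[OF X] and U' = sV_D(1)[OF U(1)]
  obtain W where W: "openin (mtop M) W" "p \<in> W" "\<And>q. q \<in> W \<Longrightarrow> q \<in> carrier_of N \<Longrightarrow> E q \<in> V q"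
    using tan tangent_in_eq_V unfolding tangent_near_def by blast
  obtain u where u: "u \<in> TN p" "E p = inc p u"
    using W(3)[OF W(2) p] unfolding tangent_in_eq_V[OF p, symmetric] tangent_in_def by blast
  let ?f = "\<lambda>q. g q (E q) (X q)"
  have f: "smooth_near M p ?f"
    by (rule smooth_nearI[OF openin_carrier C tensor2_smooth[OF metric_tensor2[OF metric] E X']])
  have oW: "openin (mtop N) (W \<inter> carrier_of N)" "p \<in> W \<inter> carrier_of N"
    using W p N_top by (auto simp: openin_subtopology)
  have "E p ?f = u (?f \<circ> (\<lambda>x. x))" using f u(2) by (simp add: pushforward_def)
  also have "\<dots> = u (\<lambda>_. 0)"
    by (rule tangent_cong[OF N u(1) oW]) (use W(3) g_V_H[OF NC sH_D(2)[OF X NC]] in auto)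
  also have "\<dots> = 0" by (rule tangent_const[OF u(1) p])
  finally have "g p (nabla E E p) (X p) = - g p (E p) (nabla E X p)"
    using metric_compatible[OF E E X' C] by simp
  also have "\<dots> = - g p (U p) (nabla U X p)"
    using nabla_cong_left[OF E U' X' C U(2)[symmetric]] U(2) by simp
  also have "\<dots> = \<beta> X U U p" using \<beta>_shape[OF C X U(1) U(1)] by simp
  finally show ?thesis .
qed

text \<open>As \<open>\<beta>(\<phi> U, \<phi> U) = - \<beta>(U, U)\<close> and \<open>\<beta>(\<cdot>, \<xi>) = 0\<close>, while \<open>\<phi>\<close> is an isometry orthogonally to \<open>\<xi>\<close>,
  the trace of \<open>\<beta>\<close> equals its negative.\<close>

lemma \<beta>_trace:
  fixes U :: "nat \<Rightarrow> 'a vfield"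
  assumes p: "p \<in> carrier_of N" and X: "X \<in> sH" and U: "\<And>i. i < DIM('f) \<Longrightarrow> U i \<in> sV"
    and on: "\<And>i j. i < DIM('f) \<Longrightarrow> j < DIM('f) \<Longrightarrow> g p (U i p) (U j p) = (if i = j then 1 else 0)"
  shows "(\<Sum>i<DIM('f). \<beta> X (U i) (U i) p) = 0"
proof -
  note C = NC[OF p]
  let ?I = "{..<DIM('f)}"
  have UV: "U i p \<in> V p" if "i \<in> ?I" for i using sV_D(2)[OF U C] that by simp
  have UT: "U i p \<in> T p" if "i \<in> ?I" for i using UV[OF that] V_T by auto
  have expand: "v = (\<Sum>i\<in>?I. g p v (U i p) *\<^sub>R U i p)" if "v \<in> V p" for v
    by (rule orthonormal_expansion[OF p _ on that]) (use UV in auto)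
  have lin: "\<beta> X Z Y p = (\<Sum>k\<in>?I. g p (Y p) (U k p) * \<beta> X Z (U k) p)" if Z: "Z \<in> sV" and Y: "Y \<in> sV" for Z Y
  proof -
    note nT = nabla_T[OF sV_D(1)[OF Z] sH_D(1)[OF X] C]
    have "g p (Y p) (nabla Z X p) = g p (\<Sum>k\<in>?I. g p (Y p) (U k p) *\<^sub>R U k p) (nabla Z X p)"
      using expand[OF sV_D(2)[OF Y C]] by simp
    also have "\<dots> = (\<Sum>k\<in>?I. g p (g p (Y p) (U k p) *\<^sub>R U k p) (nabla Z X p))"
      by (rule linear_map_on_sum[OF g_lin(2)[OF C nT] tangent_space_subspace]) (intro tangent_space_scaleR UT)
    also have "\<dots> = (\<Sum>k\<in>?I. g p (Y p) (U k p) * g p (U k p) (nabla Z X p))"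
      by (intro sum.cong refl g_left(4)[OF C UT UT nT])
    finally have "g p (Y p) (nabla Z X p) = (\<Sum>k\<in>?I. g p (Y p) (U k p) * g p (U k p) (nabla Z X p))" .
    then show ?thesis using \<beta>_shape[OF C X Z Y] \<beta>_shape[OF C X Z U] by (simp add: sum_negf[symmetric])
  qed
  define a where "a i j = g p (\<phi> p (U i p)) (U j p)" for i j
  have aa: "(\<Sum>i\<in>?I. a i k * a i j) = (if k = j then 1 else 0) - g p (U k p) (\<xi> p) * g p (U j p) (\<xi> p)"
    if k: "k \<in> ?I" and j: "j \<in> ?I" for k j
  proof -
    have fj: "\<phi> p (U j p) \<in> V p" and fk: "\<phi> p (U k p) \<in> V p" using \<phi>_V[OF C UV] j k by auto
    have fT: "\<phi> p (U j p) \<in> T p" "\<phi> p (U k p) \<in> T p" using fj fk V_T by auto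
    have a: "a i l = - g p (\<phi> p (U l p)) (U i p)" if "i \<in> ?I" "l \<in> ?I" for i l
      unfolding a_def using \<phi>_skew[OF C UT UT] g_sym[OF C UT[OF that(1)] \<phi>_T[OF C UT[OF that(2)]]] that by simp
    have "g p (\<phi> p (U k p)) (\<phi> p (U j p)) = g p (\<Sum>i\<in>?I. g p (\<phi> p (U k p)) (U i p) *\<^sub>R U i p) (\<phi> p (U j p))"
      using expand[OF fk] by simp
    also have "\<dots> = (\<Sum>i\<in>?I. g p (g p (\<phi> p (U k p)) (U i p) *\<^sub>R U i p) (\<phi> p (U j p)))"
      by (rule linear_map_on_sum[OF g_lin(2)[OF C fT(1)] tangent_space_subspace]) (intro tangent_space_scaleR UT)
    also have "\<dots> = (\<Sum>i\<in>?I. a i k * a i j)"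
    proof (intro sum.cong refl)
      fix i assume i: "i \<in> ?I"
      show "g p (g p (\<phi> p (U k p)) (U i p) *\<^sub>R U i p) (\<phi> p (U j p)) = a i k * a i j"
        using g_left(4)[OF C UT[OF i] UT[OF i] fT(1)] a[OF i k] a[OF i j] g_sym[OF C UT[OF i] fT(1)] by simp
    qed
    finally show ?thesis
      using g_\<phi>_\<phi>[OF C UT[OF k] UT[OF j]] on j k \<eta>_g[OF C UT[OF k]] \<eta>_g[OF C UT[OF j]] by simp
  qed
  have b: "\<beta> X (app \<phi> (U i)) (app \<phi> (U i)) p = (\<Sum>k\<in>?I. \<Sum>j\<in>?I. a i k * a i j * \<beta> X (U k) (U j) p)" if i: "i \<in> ?I" for i
  proof -
    have Ui: "U i \<in> sV" using U i by simp
    note fU = app_\<phi>_sV[OF Ui]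
    have "\<beta> X (app \<phi> (U i)) (app \<phi> (U i)) p = (\<Sum>k\<in>?I. a i k * \<beta> X (app \<phi> (U i)) (U k) p)"
      unfolding lin[OF fU fU] by (simp add: a_def app_apply)
    also have "\<dots> = (\<Sum>k\<in>?I. a i k * \<beta> X (U k) (app \<phi> (U i)) p)"
      by (intro sum.cong refl) (simp add: \<beta>_sym[OF C X fU U])
    also have "\<dots> = (\<Sum>k\<in>?I. a i k * (\<Sum>j\<in>?I. a i j * \<beta> X (U k) (U j) p))"
      by (intro sum.cong refl) (simp add: lin[OF U fU] a_def app_apply)
    finally show ?thesis by (simp add: sum_distrib_left mult.assoc)
  qed
  have "- (\<Sum>i\<in>?I. \<beta> X (U i) (U i) p) = (\<Sum>i\<in>?I. \<beta> X (app \<phi> (U i)) (app \<phi> (U i)) p)"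
    by (simp add: \<beta>_\<phi>[OF C X U U] sum_negf)
  also have "\<dots> = (\<Sum>i\<in>?I. \<Sum>k\<in>?I. \<Sum>j\<in>?I. a i k * a i j * \<beta> X (U k) (U j) p)"
    by (intro sum.cong refl b)
  also have "\<dots> = (\<Sum>k\<in>?I. \<Sum>i\<in>?I. \<Sum>j\<in>?I. a i k * a i j * \<beta> X (U k) (U j) p)" by (rule sum.swap)
  also have "\<dots> = (\<Sum>k\<in>?I. \<Sum>j\<in>?I. \<Sum>i\<in>?I. a i k * a i j * \<beta> X (U k) (U j) p)"
    by (intro sum.cong[OF refl] sum.swap)
  also have "\<dots> = (\<Sum>k\<in>?I. \<Sum>j\<in>?I. (if k = j then \<beta> X (U k) (U j) p else 0) - g p (U k p) (\<xi> p) * g p (U j p) (\<xi> p) * \<beta> X (U k) (U j) p)"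
    by (intro sum.cong refl) (simp add: sum_distrib_right[symmetric] aa left_diff_distrib)
  also have "\<dots> = (\<Sum>k\<in>?I. \<beta> X (U k) (U k) p) - (\<Sum>k\<in>?I. g p (U k p) (\<xi> p) * (\<Sum>j\<in>?I. g p (U j p) (\<xi> p) * \<beta> X (U k) (U j) p))"
    by (simp add: sum_subtractf sum_distrib_left mult.assoc)
  also have "(\<Sum>k\<in>?I. g p (U k p) (\<xi> p) * (\<Sum>j\<in>?I. g p (U j p) (\<xi> p) * \<beta> X (U k) (U j) p)) = 0"
  proof (rule sum.neutral, intro ballI)
    fix k assume k: "k \<in> ?I"
    have "(\<Sum>j\<in>?I. g p (U j p) (\<xi> p) * \<beta> X (U k) (U j) p) = \<beta> X (U k) \<xi> p"
      using k by (simp add: lin[OF U \<xi>_sV] g_sym[OF C UT \<xi>_T[OF C]])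
    then show "g p (U k p) (\<xi> p) * (\<Sum>j\<in>?I. g p (U j p) (\<xi> p) * \<beta> X (U k) (U j) p) = 0"
      using \<beta>_\<xi>[OF C X U] k by simp
  qed
  finally show ?thesis by simp
qed

theorem fibre_minimal: "minimal_submanifold M g nabla N"
  unfolding minimal_submanifold_def
proof (intro conjI emb ballI allI impI)
  fix p and E :: "nat \<Rightarrow> 'a vfield"
  assume p: "p \<in> carrier_of N" and E: "\<forall>i<DIM('f). E i \<in> VF \<and> tangent_near M N p (E i)"
    and on: "\<forall>i<DIM('f). \<forall>j<DIM('f). g p (E i p) (E j p) = (if i = j then 1 else 0)"
  note C = NC[OF p]
  have EV: "E i p \<in> V p" if "i < DIM('f)" for i
    using E that p unfolding tangent_near_def tangent_in_eq_V[OF p, symmetric] by blast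
  have "\<exists>U. U \<in> sV \<and> U p = E i p" if "i < DIM('f)" for i
    using vertical_through[OF C EV[OF that]] by blast
  then obtain U where U: "\<And>i. i < DIM('f) \<Longrightarrow> U i \<in> sV" "\<And>i. i < DIM('f) \<Longrightarrow> U i p = E i p" by metis
  have nT: "nabla (E i) (E i) p \<in> T p" if "i < DIM('f)" for i using nabla_T E that C by blast
  let ?n = "\<lambda>i. normal_component M g N p (nabla (E i) (E i) p)"
  note n = normal_component[OF p nT]
  have nt: "?n i \<in> T p" if "i < DIM('f)" for i using n(1)[OF that] by (simp add: H_iff)
  have S: "(\<Sum>i<DIM('f). ?n i) \<in> H p" by (intro subspace_sum[OF H_subspace[OF C]] n(1)) simp
  have "(\<Sum>i<DIM('f). ?n i) = 0"
  proof (rule vector_eqI[OF C])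
    show "(\<Sum>i<DIM('f). ?n i) \<in> T p" using S by (simp add: H_iff)
    show "g p (\<Sum>i<DIM('f). ?n i) (Y p) = g p 0 (Y p)" if "Y \<in> sV" for Y
      using g_H_V[OF S sV_D(2)[OF that C]] g_zero(1)[OF C vector_fields_tangent[OF sV_D(1)[OF that] C]] by simp
    fix X assume X: "X \<in> sH"
    note XT = vector_fields_tangent[OF sH_D(1)[OF X] C]
    have "g p (\<Sum>i<DIM('f). ?n i) (X p) = (\<Sum>i<DIM('f). g p (?n i) (X p))"
      by (rule linear_map_on_sum[OF g_lin(2)[OF C XT] tangent_space_subspace]) (simp add: nt)
    also have "\<dots> = (\<Sum>i<DIM('f). \<beta> X (U i) (U i) p)"
    proof (intro sum.cong refl)
      fix i assume "i \<in> {..<DIM('f)}"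
      then have i: "i < DIM('f)" by simp
      have "g p (nabla (E i) (E i) p - ?n i) (X p) = 0" by (rule g_V_H[OF C sH_D(2)[OF X C] n(2)[OF i]])
      then have "g p (?n i) (X p) = g p (nabla (E i) (E i) p) (X p)"
        using g_left(2)[OF C nT[OF i] nt[OF i] XT] by simp
      also have "\<dots> = \<beta> X (U i) (U i) p"
        by (rule second_fundamental_form_vertical[where E="E i" and U="U i" and p=p and X=X, OF p _ _ U(1)[OF i] U(2)[OF i] X])
           (use E i in auto)
      finally show "g p (?n i) (X p) = \<beta> X (U i) (U i) p" .
    qed
    also have "\<dots> = 0" by (rule \<beta>_trace[OF p X U(1)]) (use on U(2) in auto)
    finally show "g p (\<Sum>i<DIM('f). ?n i) (X p) = g p 0 (X p)" using g_zero(1)[OF C XT] by simp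
  qed simp
  then show "(\<Sum>i<DIM('f). second_fundamental_form M g nabla N (E i) (E i) p) = 0"
    unfolding second_fundamental_form_def .
qed

end

section \<open>Integrability of the horizontal distribution\<close>

context cosymplectic_submersion begin

text \<open>The lifts of coordinate fields of the base commute, since their brackets are horizontal and
  project to zero. Hence the total differential equation whose solutions have these lifts as partial
  derivatives is compatible. The image of a solution is an integral manifold; the solution is inverted
  by the coordinates of the base, which shows that it is an embedding.\<close>

theorem horizontal_integrable: "integrable_distribution TYPE('d) M H"
  unfolding integrable_distribution_def
proof (intro ballI)
  fix p assume p: "p \<in> C"
  obtain U c where Uc: "(U, c) \<in> atlas M" "p \<in> U" using chart_at[OF M p] .
  obtain W2 e2 x2 \<kappa>2 where "local_frame M' (\<pi> p) W2 e2 x2 \<kappa>2"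
    using local_frame_exists[OF M' \<pi>_carrier[OF p]] .
  then interpret B: local_frame M' "\<pi> p" W2 e2 x2 \<kappa>2 .
  let ?inv = "inv_into U c"
  note inv = chart_inv[OF M Uc(1)]
  define L where "L b q = hlift q (e2 b (\<pi> q))" for b q
  have Lb: "basic (L b) (e2 b)" for b using basic_lift[OF B.e_field] by (simp add: L_def[abs_def])
  note LH = basicD(1)[OF Lb] and Lpush = basicD(3)[OF Lb]
  note LVF = sH_D(1)[OF LH] and LHq = sH_D(2)[OF LH]
  define P where "P = {q \<in> C. \<pi> q \<in> W2}"
  have P: "openin (mtop M) P" "p \<in> P" unfolding P_def using smooth_map_preimage_openin[OF \<pi>_smooth B.W] p B.pW by auto
  have PC: "q \<in> C" "\<pi> q \<in> W2" if "q \<in> P" for q using that by (auto simp: P_def)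
  have Lcomb: "push q (\<Sum>j\<in>Basis. (w \<bullet> j) *\<^sub>R L j q) = B.comb (\<pi> q) w" if "q \<in> P" for q w
    unfolding pushforward_sum pushforward_scaleR Lpush[OF PC(1)[OF that]] B.comb_def ..
  have LcombH: "(\<Sum>j\<in>Basis. (w \<bullet> j) *\<^sub>R L j q) \<in> H q" if "q \<in> P" for q w
    using LHq[OF PC(1)[OF that]] by (intro subspace_sum[OF H_subspace] subspace_scale[OF H_subspace] PC(1)[OF that])
  have xL: "L j q (x2 b \<circ> \<pi>) = (if j = b then 1 else 0)" if q: "q \<in> P" and "j \<in> Basis" "b \<in> Basis" for j b q
  proof -
    have "L j q (x2 b \<circ> \<pi>) = push q (L j q) (x2 b)"
      using B.x_near[OF PC(2)[OF q], of b] by (simp add: pushforward_def)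
    then show ?thesis using B.e_x[OF PC(2)[OF q] that(2,3)] Lpush[OF PC(1)[OF q]] by simp
  qed
  have bracket: "lie_bracket M (L j) (L k) q = 0" if q: "q \<in> P" and jk: "j \<in> Basis" "k \<in> Basis" for j k q
  proof -
    note qC = PC(1)[OF q]
    have "push q (lie_bracket M (L j) (L k) q) = lie_bracket M' (e2 j) (e2 k) (\<pi> q)"
      by (rule related_bracket[OF M M' \<pi>_smooth LVF B.e_field Lpush LVF B.e_field Lpush qC])
    also have "\<dots> = 0" by (rule B.bracket_zero[OF PC(2)[OF q] jk])
    finally show ?thesis
      using H_V_zero[OF qC horizontal_bracket[OF LH LH qC, of j k]] lie_bracket_tangent[OF M LVF LVF qC] by (simp add: V_iff)
  qed

  \<comment> \<open>the components of the lifts in a chart are the coefficients of a total differential equation, and their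
    commutation relations are its compatibility conditions\<close>
  define S where "S = c ` (U \<inter> P)"
  have S: "open S" "c p \<in> S" unfolding S_def using chart_image_openin[OF M Uc(1) P(1)] Uc P by auto
  have SU: "S \<subseteq> c ` U" by (auto simp: S_def)
  have inS: "?inv y \<in> U \<inter> P" "c (?inv y) = y" if "y \<in> S" for y using that inv by (auto simp: S_def)
  define a where "a j y = (\<Sum>i\<in>Basis. L j (?inv y) (\<lambda>r. c r \<bullet> i) *\<^sub>R i)" for j y
  have LU: "(\<lambda>q. L j q (\<lambda>r. c r \<bullet> i)) \<in> smooth_funs M U" for i j
    by (rule vector_fields_smooth[OF LVF chart_openin[OF M Uc(1)] smooth_funs_coordinate[OF M Uc(1)]])
  have Lsm: "smooth_on S ((\<lambda>q. L j q (\<lambda>r. c r \<bullet> i)) \<circ> ?inv)" for i j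
    by (rule smooth_on_subset[OF smooth_funsD[OF LU Uc(1)]]) (use SU in simp)
  have a_smooth: "smooth_on S (a j)" for j
    unfolding a_def[abs_def] using Lsm by (intro smooth_on_sum smooth_on_scaleR S) (auto simp: o_def)
  have L_near: "smooth_near M q (\<lambda>q. L j q (\<lambda>r. c r \<bullet> i))" if "q \<in> U" for q i j
    using smooth_nearI[OF chart_openin[OF M Uc(1)] that LU] .
  have L_frechet: "L j q f = frechet_derivative (f \<circ> ?inv) (at (c q)) (a j (c q))"
    if q: "q \<in> U" and f: "smooth_near M q f" for j q f
  proof -
    have "L j q \<in> T q" using vector_fields_tangent[OF LVF smooth_near_carrier[OF f]] .
    from tangent_frechet[OF M Uc(1) q this f] show ?thesis by (simp add: a_def inv q)
  qed
  have compat: "frechet_derivative (a k) (at y) (a j y) = frechet_derivative (a j) (at y) (a k y)"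
    if y: "y \<in> S" and jk: "j \<in> Basis" "k \<in> Basis" for y j k
  proof (rule euclidean_eqI)
    fix i :: 'e assume i: "i \<in> Basis"
    have q: "?inv y \<in> U" "?inv y \<in> P" "c (?inv y) = y" using inS[OF y] by auto
    have comp: "frechet_derivative (a k) (at y) v \<bullet> i = frechet_derivative ((\<lambda>q. L k q (\<lambda>r. c r \<bullet> i)) \<circ> ?inv) (at y) v" for k v
    proof -
      have "((\<lambda>y. a k y \<bullet> i) has_derivative (\<lambda>v. frechet_derivative (a k) (at y) v \<bullet> i)) (at y)"
        using smooth_on_has_derivative[OF a_smooth y] by (rule has_derivative_inner_left)
      moreover have "(\<lambda>y. a k y \<bullet> i) = (\<lambda>q. L k q (\<lambda>r. c r \<bullet> i)) \<circ> ?inv"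
        using i by (auto simp: a_def fun_eq_iff)
      ultimately show ?thesis using frechet_derivative_has_derivative by metis
    qed
    have D: "frechet_derivative (a k) (at y) (a j y) \<bullet> i = L j (?inv y) (\<lambda>q. L k q (\<lambda>r. c r \<bullet> i))" for j k
      unfolding comp using L_frechet[OF q(1) L_near[OF q(1)], of j k i] q(3) by simp
    have "lie_bracket M (L j) (L k) (?inv y) (\<lambda>r. c r \<bullet> i) = 0" using bracket[OF q(2) jk] by simp
    then have "L j (?inv y) (\<lambda>q. L k q (\<lambda>r. c r \<bullet> i)) = L k (?inv y) (\<lambda>q. L j q (\<lambda>r. c r \<bullet> i))"
      using lie_bracket_apply[OF smooth_near_coordinate[OF M Uc(1) q(1)]] by simp
    then show "frechet_derivative (a k) (at y) (a j y) \<bullet> i = frechet_derivative (a j) (at y) (a k y) \<bullet> i"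
      unfolding D .
  qed
  obtain \<delta> \<sigma> where \<delta>: "\<delta> > 0" and \<sigma>0: "\<sigma> 0 = c p" and \<sigma>S: "\<sigma> ` ball 0 \<delta> \<subseteq> S" and \<sigma>_smooth: "smooth_on (ball 0 \<delta>) \<sigma>"
    and \<sigma>': "\<And>x. x \<in> ball 0 \<delta> \<Longrightarrow> (\<sigma> has_derivative (\<lambda>v. \<Sum>b\<in>Basis. (v \<bullet> b) *\<^sub>R a b (\<sigma> x))) (at x)"
  proof (rule frobenius_total_differential[OF S, of a])
    show "smooth_on S (a j)" for j by (rule a_smooth)
    show "frechet_derivative (a k) (at y) (a j y) = frechet_derivative (a j) (at y) (a k y)"
      if "y \<in> S" "j \<in> Basis" "k \<in> Basis" for y j k using that by (rule compat)
  qed (rule that)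
  define K where "K = ball (0::'d) \<delta>"
  have K: "open K" "0 \<in> K" "convex K" using \<delta> by (auto simp: K_def)
  note \<sigma>S = \<sigma>S[folded K_def] and \<sigma>_smooth = \<sigma>_smooth[folded K_def] and \<sigma>' = \<sigma>'[folded K_def]
  define \<gamma> where "\<gamma> x = ?inv (\<sigma> x)" for x
  have \<gamma>U: "\<gamma> x \<in> U" "\<gamma> x \<in> P" "c (\<gamma> x) = \<sigma> x" if "x \<in> K" for x
    unfolding \<gamma>_def using inS[of "\<sigma> x"] \<sigma>S that by auto
  have \<gamma>0: "\<gamma> 0 = p" unfolding \<gamma>_def \<sigma>0 by (rule inv[OF Uc(2)])
  have \<gamma>': "((\<lambda>x. f (\<gamma> x)) has_derivative (\<lambda>v. \<Sum>j\<in>Basis. (v \<bullet> j) * L j (\<gamma> x) f)) (at x)"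
    if x: "x \<in> K" and f: "smooth_near M (\<gamma> x) f" for x f
  proof -
    note df = smooth_near_chart_derivative[OF M f Uc(1) \<gamma>U(1)[OF x], unfolded \<gamma>U(3)[OF x]]
    have lin: "linear (frechet_derivative (f \<circ> ?inv) (at (\<sigma> x)))" using df has_derivative_linear by blast
    have "frechet_derivative (f \<circ> ?inv) (at (\<sigma> x)) (\<Sum>b\<in>Basis. (v \<bullet> b) *\<^sub>R a b (\<sigma> x)) = (\<Sum>j\<in>Basis. (v \<bullet> j) * L j (\<gamma> x) f)" for v
      unfolding linear_sum[OF lin] linear_cmul[OF lin] L_frechet[OF \<gamma>U(1)[OF x] f] \<gamma>U(3)[OF x] by simp
    then show ?thesis
      using has_derivative_compose[OF \<sigma>'[OF x] df] by (simp add: \<gamma>_def)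
  qed

  \<comment> \<open>\<open>\<kappa>\<close>, the coordinates of the base centred at \<open>\<pi> p\<close>, inverts the solution\<close>
  define \<kappa> where "\<kappa> q = (\<Sum>b\<in>Basis. (x2 b (\<pi> q) - x2 b (\<pi> p)) *\<^sub>R b)" for q
  have x2_near: "smooth_near M q (x2 b \<circ> \<pi>)" if "q \<in> P" for q b
    by (rule smooth_near_pullback[OF M M' \<pi>_smooth PC(1)[OF that] B.x_near[OF PC(2)[OF that]]])
  have \<kappa>\<gamma>: "\<kappa> (\<gamma> x) = x" if x: "x \<in> K" for x
  proof (rule euclidean_eqI)
    fix b :: 'd assume b: "b \<in> Basis"
    \<comment> \<open>by construction of the lifts, both functions have the same derivative\<close>
    have "\<exists>k. \<forall>z\<in>K. x2 b (\<pi> (\<gamma> z)) - z \<bullet> b = k"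
    proof (rule has_derivative_zero_constant[OF K(3)])
      fix z assume z: "z \<in> K"
      have "((\<lambda>x. (x2 b \<circ> \<pi>) (\<gamma> x)) has_derivative (\<lambda>v. \<Sum>j\<in>Basis. (v \<bullet> j) * L j (\<gamma> z) (x2 b \<circ> \<pi>))) (at z)"
        by (rule \<gamma>'[OF z x2_near[OF \<gamma>U(2)[OF z]]])
      moreover have "(\<Sum>j\<in>Basis. (v \<bullet> j) * L j (\<gamma> z) (x2 b \<circ> \<pi>)) = v \<bullet> b" for v
        using b by (simp add: xL[OF \<gamma>U(2)[OF z]] if_distrib[of "\<lambda>x. _ * x"] cong: if_cong)
      ultimately have "((\<lambda>x. x2 b (\<pi> (\<gamma> x))) has_derivative (\<lambda>v. v \<bullet> b)) (at z)" by simp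
      then have "((\<lambda>x. x2 b (\<pi> (\<gamma> x)) - x \<bullet> b) has_derivative (\<lambda>v. v \<bullet> b - v \<bullet> b)) (at z)"
        by (intro has_derivative_diff has_derivative_inner_left has_derivative_ident)
      then show "((\<lambda>x. x2 b (\<pi> (\<gamma> x)) - x \<bullet> b) has_derivative (\<lambda>v. 0)) (at z within K)"
        by (simp add: has_derivative_at_withinI)
    qed
    then have "x2 b (\<pi> (\<gamma> x)) - x \<bullet> b = x2 b (\<pi> (\<gamma> 0)) - 0 \<bullet> b" using x K(2) by metis
    then show "\<kappa> (\<gamma> x) \<bullet> b = x \<bullet> b" using b by (simp add: \<kappa>_def \<gamma>0)
  qed
  define Q where "Q = \<gamma> ` K"
  have Q: "Q \<subseteq> U" "Q \<subseteq> P" "Q \<subseteq> C" unfolding Q_def using \<gamma>U PC by auto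
  have \<kappa>Q: "\<kappa> ` Q = K" using \<kappa>\<gamma> by (force simp: Q_def)
  have \<gamma>\<kappa>: "\<kappa> q \<in> K" "\<gamma> (\<kappa> q) = q" if "q \<in> Q" for q using that \<kappa>\<gamma> by (auto simp: Q_def)
  have \<kappa>inj: "inj_on \<kappa> Q" using \<gamma>\<kappa>(2) by (metis inj_onI)
  have inv\<kappa>: "inv_into Q \<kappa> x = \<gamma> x" if "x \<in> K" for x
    using inv_into_f_f[OF \<kappa>inj, of "\<gamma> x"] \<kappa>\<gamma>[OF that] that by (simp add: Q_def)

  \<comment> \<open>\<open>\<kappa>\<close> serves as the only chart of the integral manifold\<close>
  define N :: "('a, 'd) mfd" where "N = \<lparr>mtop = subtopology (mtop M) Q, atlas = {(Q, \<kappa>)}\<rparr>"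
  have NC: "carrier_of N = Q" using Q(3) by (auto simp: N_def carrier_of_def)
  have chart: "(Q, \<kappa>) \<in> atlas N" by (simp add: N_def)
  have cont_c: "continuous_map (subtopology (mtop M) Q) (top_of_set S) c"
  proof -
    have "continuous_map (subtopology (mtop M) U) (top_of_set (c ` U)) c"
      using chart_homeo[OF M Uc(1)] by (rule homeomorphic_imp_continuous_map)
    then have "continuous_map (subtopology (mtop M) Q) (top_of_set (c ` U)) c"
      using Q(1) continuous_map_from_subtopology_mono by blast
    then have "continuous_map (subtopology (mtop M) Q) euclidean c"
      using continuous_map_in_subtopology by blast
    moreover have "c ` Q \<subseteq> S" using Q by (auto simp: S_def)
    ultimately show ?thesis by (auto simp: continuous_map_in_subtopology)
  qed
  have "continuous_map (subtopology (mtop M) Q) euclidean \<kappa>"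
  proof -
    define k where "k y = (\<Sum>b\<in>Basis. ((x2 b \<circ> \<pi> \<circ> ?inv) y - x2 b (\<pi> p)) *\<^sub>R b)" for y
    have "smooth_on S (x2 b \<circ> \<pi> \<circ> ?inv)" for b
      using smooth_funsD[OF smooth_funs_pullback[OF M M' \<pi>_smooth B.W B.x_smooth] Uc(1)] by (simp add: S_def P_def)
    then have "continuous_on S k"
      unfolding k_def by (intro continuous_intros smooth_on_imp_continuous_on)
    then have "continuous_map (top_of_set S) euclidean k" by simp
    from continuous_map_compose[OF cont_c this]
    have "continuous_map (subtopology (mtop M) Q) euclidean (k \<circ> c)" .
    then show ?thesis
    proof (rule continuous_map_eq)
      fix q assume "q \<in> topspace (subtopology (mtop M) Q)"
      then have "q \<in> U" using Q by auto
      then show "(k \<circ> c) q = \<kappa> q" by (simp add: k_def \<kappa>_def inv)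
    qed
  qed
  then have cont_\<kappa>: "continuous_map (subtopology (mtop M) Q) (top_of_set K) \<kappa>"
    using \<kappa>Q by (auto simp: continuous_map_in_subtopology)
  have "continuous_map (top_of_set K) (mtop M) \<gamma>"
  proof -
    have "continuous_map (top_of_set K) (top_of_set (c ` U)) \<sigma>"
      using smooth_on_imp_continuous_on[OF \<sigma>_smooth] \<sigma>S SU by (auto simp: continuous_map_in_subtopology)
    from continuous_map_compose[OF this chart_inv_continuous[OF M Uc(1)]] show ?thesis
      by (simp add: \<gamma>_def[abs_def] o_def)
  qed
  then have cont_\<gamma>: "continuous_map (top_of_set K) (subtopology (mtop M) Q) \<gamma>"
    by (auto simp: continuous_map_in_subtopology Q_def)
  have "homeomorphic_maps (subtopology (mtop M) Q) (top_of_set K) \<kappa> \<gamma>"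
    unfolding homeomorphic_maps_def using cont_\<kappa> cont_\<gamma> \<gamma>\<kappa>(2) \<kappa>\<gamma> by auto
  then have homeo: "homeomorphic_map (subtopology (mtop M) Q) (top_of_set K) \<kappa>"
    by (rule homeomorphic_maps_imp_map)
  have N: "smooth_manifold N"
    unfolding smooth_manifold_def NC
  proof (intro conjI)
    have "Hausdorff_space (mtop M)" "second_countable (mtop M)" using M unfolding smooth_manifold_def by auto
    then show "Hausdorff_space (mtop N)" "second_countable (mtop N)"
      by (simp_all add: N_def Hausdorff_space_subtopology second_countable_subtopology)
    have id: "smooth_on K (\<kappa> \<circ> inv_into Q \<kappa>)"
      using smooth_on_cong[OF K(1), of "\<kappa> \<circ> inv_into Q \<kappa>" "\<lambda>x. x"] smooth_on_bounded_linear[OF bounded_linear_ident K(1)]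
      by (simp add: inv\<kappa> \<kappa>\<gamma>)
    then show "\<forall>(U, c)\<in>atlas N. \<forall>(V, d)\<in>atlas N. smooth_on (c ` (U \<inter> V)) (d \<circ> inv_into U c)"
      by (simp add: N_def \<kappa>Q)
    show "\<forall>(U, c)\<in>atlas N. openin (mtop N) U \<and> open (c ` U) \<and>
       homeomorphic_map (subtopology (mtop N) U) (top_of_set (c ` U)) c"
      using homeo K Q(3) by (simp add: N_def \<kappa>Q subtopology_subtopology carrier_of_def openin_subtopology_refl)
  qed (simp add: N_def)
  have incl: "smooth_map N M (\<lambda>x. x)"
    unfolding smooth_map_def
  proof (intro conjI ballI, goal_cases)
    case 1
    show ?case using continuous_map_from_subtopology[OF continuous_map_id, of "mtop M" Q] by (simp add: N_def id_def)
  next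
    case (2 A)
    show ?case
    proof (clarify)
      fix Q' \<kappa>' V d assume A: "A = (Q', \<kappa>')" and V: "(V, d) \<in> atlas M"
      have Q': "Q' = Q" "\<kappa>' = \<kappa>" using 2 A by (auto simp: N_def)
      define K' where "K' = \<kappa> ` (Q \<inter> V)"
      have K'eq: "K' = {x \<in> K. \<sigma> x \<in> c ` (U \<inter> V)}"
      proof (intro equalityI subsetI)
        fix x assume "x \<in> K'"
        then obtain q where q: "q \<in> Q" "q \<in> V" "x = \<kappa> q" by (auto simp: K'_def)
        then have x: "x \<in> K" "\<gamma> x = q" using \<gamma>\<kappa> by auto
        then have "\<sigma> x = c q" "q \<in> U" using \<gamma>U[of x] by auto
        then show "x \<in> {x \<in> K. \<sigma> x \<in> c ` (U \<inter> V)}" using x(1) q(2) by auto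
      next
        fix x assume x: "x \<in> {x \<in> K. \<sigma> x \<in> c ` (U \<inter> V)}"
        then obtain q where "q \<in> U" "q \<in> V" "\<sigma> x = c q" by auto
        then have "\<gamma> x \<in> V" by (simp add: \<gamma>_def inv)
        then show "x \<in> K'" using x \<kappa>\<gamma>[of x] unfolding K'_def Q_def by (intro image_eqI[of _ _ "\<gamma> x"]) auto
      qed
      have oV: "open (c ` (U \<inter> V))" by (rule chart_image_openin[OF M Uc(1) chart_openin[OF M V]])
      have oK': "open K'"
      proof -
        have "open (\<sigma> -` (c ` (U \<inter> V)) \<inter> K)"
          using smooth_on_imp_continuous_on[OF \<sigma>_smooth] continuous_on_open_vimage[OF K(1)] oV by blast
        moreover have "\<sigma> -` (c ` (U \<inter> V)) \<inter> K = K'" unfolding K'eq by auto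
        ultimately show ?thesis by simp
      qed
      have "smooth_on K' (\<lambda>x. (d \<circ> ?inv) (\<sigma> x))"
        by (rule smooth_on_compose[OF oK' oV _ smooth_on_subset[OF \<sigma>_smooth] chart_transition[OF M Uc(1) V]])
           (auto simp: K'eq)
      then have "smooth_on K' (d \<circ> (\<lambda>x. x) \<circ> inv_into Q \<kappa>)"
        by (rule smooth_on_cong[OF oK', THEN iffD1, rotated]) (auto simp: K'eq inv\<kappa> \<gamma>_def)
      then show "smooth_on (\<kappa>' ` (Q' \<inter> (\<lambda>x. x) -` V)) (d \<circ> (\<lambda>x. x) \<circ> inv_into Q' \<kappa>')"
        unfolding Q' by (simp add: K'_def)
    qed
  qed
  let ?inc = "pushforward N M (\<lambda>x. x)"
  let ?w = "\<lambda>u. \<Sum>b\<in>Basis. u (\<lambda>r. \<kappa> r \<bullet> b) *\<^sub>R b"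
  have inc: "?inc q u = (\<Sum>j\<in>Basis. (?w u \<bullet> j) *\<^sub>R L j q)" if q: "q \<in> Q" and u: "u \<in> tangent_space N q" for q u
  proof
    fix f
    note x = \<gamma>\<kappa>(1)[OF q]
    have qC: "q \<in> C" using q Q by auto
    show "?inc q u f = (\<Sum>j\<in>Basis. (?w u \<bullet> j) *\<^sub>R L j q) f"
    proof (cases "smooth_near M q f")
      case True
      then have f: "smooth_near M (\<gamma> (\<kappa> q)) f" by (simp add: \<gamma>\<kappa>(2)[OF q])
      have fN: "smooth_near N q (f \<circ> (\<lambda>x. x))"
        by (rule smooth_near_pullback[OF N M incl]) (use q True in \<open>simp_all add: NC\<close>)
      have der: "((f \<circ> (\<lambda>x. x) \<circ> inv_into Q \<kappa>) has_derivative (\<lambda>v. \<Sum>j\<in>Basis. (v \<bullet> j) * L j q f)) (at (\<kappa> q))"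
      proof (rule has_derivative_transform_within_open[OF _ K(1) x])
        show "((\<lambda>x. f (\<gamma> x)) has_derivative (\<lambda>v. \<Sum>j\<in>Basis. (v \<bullet> j) * L j q f)) (at (\<kappa> q))"
          using \<gamma>'[OF x f] by (simp add: \<gamma>\<kappa>(2)[OF q])
      qed (simp add: inv\<kappa>)
      have "?inc q u f = u (f \<circ> (\<lambda>x. x))" using True by (simp add: pushforward_def)
      also have "\<dots> = (\<Sum>j\<in>Basis. (?w u \<bullet> j) * L j q f)"
        unfolding tangent_frechet[OF N chart q u fN] frechet_derivative_has_derivative[OF der] ..
      finally show ?thesis by (simp add: sum_fun_apply)
    next
      case False
      then show ?thesis
        using tangent_not_smooth[OF vector_fields_tangent[OF LVF qC] False] by (simp add: pushforward_def sum_fun_apply)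
    qed
  qed
  have inj: "inj_on (?inc q) (tangent_space N q)" if q: "q \<in> Q" for q
  proof (rule inj_onI)
    fix u v assume u: "u \<in> tangent_space N q" and v: "v \<in> tangent_space N q" and eq: "?inc q u = ?inc q v"
    have qP: "q \<in> P" using q Q by auto
    have "B.comb (\<pi> q) (?w u) = B.comb (\<pi> q) (?w v)"
      unfolding Lcomb[OF qP, symmetric] inc[OF q u, symmetric] inc[OF q v, symmetric] eq ..
    then have w: "?w u = ?w v"
      using B.coords_comb[OF PC(2)[OF qP], of "?w u"] B.coords_comb[OF PC(2)[OF qP], of "?w v"] by argo
    have "u (\<lambda>r. \<kappa> r \<bullet> b) = v (\<lambda>r. \<kappa> r \<bullet> b)" if b: "b \<in> Basis" for b
    proof -
      have "?w u \<bullet> b = u (\<lambda>r. \<kappa> r \<bullet> b)" "?w v \<bullet> b = v (\<lambda>r. \<kappa> r \<bullet> b)" using b by simp_all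
      then show ?thesis unfolding w by argo
    qed
    then have "(\<Sum>b\<in>Basis. u (\<lambda>r. \<kappa> r \<bullet> b) *\<^sub>R coord_vec N Q \<kappa> q b) = (\<Sum>b\<in>Basis. v (\<lambda>r. \<kappa> r \<bullet> b) *\<^sub>R coord_vec N Q \<kappa> q b)"
      by (intro sum.cong refl) simp
    then show "u = v" using coord_vec_expand[OF N chart q u] coord_vec_expand[OF N chart q v] by metis
  qed
  have tan: "tangent_in M N q = H q" if q: "q \<in> Q" for q
  proof
    have qP: "q \<in> P" and qC: "q \<in> C" using q Q by auto
    show "tangent_in M N q \<subseteq> H q"
    proof
      fix h assume "h \<in> tangent_in M N q"
      then obtain u where u: "h = ?inc q u" "u \<in> tangent_space N q" unfolding tangent_in_def by (rule imageE)
      show "h \<in> H q" unfolding u(1) inc[OF q u(2)] by (rule LcombH[OF qP])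
    qed
    show "H q \<subseteq> tangent_in M N q"
    proof
      fix h assume h: "h \<in> H q"
      then have hT: "h \<in> T q" by (simp add: H_iff)
      define w where "w = B.coords (push q h)"
      have "push q (\<Sum>j\<in>Basis. (w \<bullet> j) *\<^sub>R L j q) = push q h"
        unfolding Lcomb[OF qP] w_def by (rule B.comb_coords[OF PC(2)[OF qP] push_T[OF qC hT]])
      then have hw: "(\<Sum>j\<in>Basis. (w \<bullet> j) *\<^sub>R L j q) = h" by (rule push_inj_H[OF qC LcombH[OF qP] h])
      let ?u = "coord_vec N Q \<kappa> q w"
      have u: "?u \<in> tangent_space N q" by (rule coord_vec_tangent[OF N chart q])
      have "?w ?u = w" unfolding coord_vec_coordinate[OF N chart q] by (rule euclidean_representation)
      then have "?inc q ?u = h" using inc[OF q u] hw by simp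
      then show "h \<in> tangent_in M N q" unfolding tangent_in_def using u by blast
    qed
  qed
  have "embedded_submanifold M N"
    unfolding embedded_submanifold_def NC using N Q(3) incl inj by (simp add: N_def)
  moreover have "p \<in> Q" unfolding Q_def using \<gamma>0 K(2) by force
  ultimately show "\<exists>N :: ('a, 'd) mfd. embedded_submanifold M N \<and> p \<in> carrier_of N \<and> (\<forall>q\<in>carrier_of N. tangent_in M N q = H q)"
    using tan NC by metis
qed

end

section \<open>The structure of contact-complex submersions\<close>

theorem theorem3p1:
  fixes M :: "('a, 'e::euclidean_space) mfd"
    and M' :: "('b, 'd::euclidean_space) mfd"
    and \<phi> :: "'a endo" and \<xi> :: "'a vfield" and \<eta> :: "'a form1" and g :: "'a form2"
    and J :: "'b endo" and g' :: "'b form2"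
    and \<pi> :: "'a \<Rightarrow> 'b" and nabla :: "'a connection" and m n :: nat
  assumes "contact_complex_submersion M \<phi> \<xi> \<eta> g M' J g' \<pi>"
    and "levi_civita M g nabla"
    and "DIM('e) = 2 * m + 1" "2 * m + 1 \<ge> 5"
    and "DIM('d) = 2 * n" "2 * n \<ge> 2"
    and "almost_cosymplectic M \<phi> \<xi> \<eta> g"
  shows
    "(integrable_distribution TYPE('d) M (horizontal_space M g M' \<pi>) \<and>
      totally_geodesic_distribution M nabla (horizontal_space M g M' \<pi>)) \<and>
     (\<forall>b\<in>carrier_of M'. \<forall>F :: ('a, 'f::euclidean_space) mfd.
        DIM('f) + DIM('d) = DIM('e) \<longrightarrow> embedded_submanifold M F \<longrightarrow>
        carrier_of F = fibre M \<pi> b \<longrightarrow>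
        minimal_submanifold M g nabla F \<and>
        almost_cosymplectic F (induced_endo M F \<phi>) (induced_vfield M F \<xi>)
          (induced_form1 M F \<eta>) (induced_form2 M F g)) \<and>
     (\<forall>X\<in>sections M (horizontal_space M g M' \<pi>). \<forall>U\<in>sections M (vertical_space M M' \<pi>).
        \<forall>p\<in>carrier_of M.
          cov_deriv_endo nabla \<phi> X U p = 0 \<and>
          cov_deriv_endo nabla \<phi> U X p = (1/2) *\<^sub>R nijenhuis M \<phi> X (app \<phi> U) p) \<and>
     almost_kaehler M' J g'"
proof -
  interpret cosymplectic_submersion M \<phi> \<xi> \<eta> g nabla M' J g' \<pi>
    by unfold_locales (use assms(1,2,7) in \<open>auto simp: contact_complex_submersion_def almost_cosymplectic_def\<close>)
  have fibres: "minimal_submanifold M g nabla F \<and>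
      almost_cosymplectic F (induced_endo M F \<phi>) (induced_vfield M F \<xi>)
        (induced_form1 M F \<eta>) (induced_form2 M F g)"
    if "DIM('f) + DIM('d) = DIM('e)" "embedded_submanifold M F" "carrier_of F = fibre M \<pi> b"
    for F :: "('a, 'f) mfd" and b
  proof -
    interpret submersion_fibre M \<phi> \<xi> \<eta> g nabla M' J g' \<pi> F b
      by unfold_locales (use that in auto)
    have "odd DIM('f)" using that(1) assms(3,5) by presburger
    then show ?thesis using fibre_minimal fibre_almost_cosymplectic by blast
  qed
  show ?thesis
    using horizontal_integrable horizontal_totally_geodesic fibres
      nabla_\<phi>_horizontal_vertical nabla_\<phi>_vertical_horizontal base_almost_kaehler
    by blast
qed

end
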